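(* Let $u$ be the solution of the stochastic wave equation $\partial_t^2u=\partial_x^2u+u\dot W$ on $\mathbb{R}_+\times\mathbb{R}$ with $u(0,\cdot)=1$, $\partial_tu(0,\cdot)=0$, and let $D_{r,z}u(t,x)$ denote its Malliavin derivative. For any $T>0$, $$\sup_{(t,x)\in[0,T]\times\mathbb{R}}\ \sup_{r\in[0,t]}\ \mathbb{E}\int_{\mathbb{R}}|D_{r,z}u(t,x)|^2\,dz\le C_T,$$ where $C_T>0$ is a constant depending on $T$ (which may not be increasing in $T$).
   Context: Noise. Let $\gamma,f:\mathbb{R}\to[0,\infty]$ be continuous, symmetric, locally integrable, with $\gamma(t)<\infty$ iff $t\neq0$, $f(x)<\infty$ iff $x\neq0$, both non-negative-definite in the sense of distributions; $\nu,\mu$ are the tempered measures on $\mathbb{R}$ with $\gamma=\mathcal{F}\nu$, $f=\mathcal{F}\mu$ as tempered distributions ($\mathcal{F}\varphi(\xi)=\int e^{-i\xi x}\varphi(x)dx$). $W$ is a zero-mean Gaussian process indexed by $\mathcal{D}(\mathbb{R}^2)$ (real test functions) with covariance $\langle\varphi_1,\varphi_2\rangle_{\mathcal{H}}=\int\gamma(t-s)f(x-y)\varphi_1(t,x)\varphi_2(s,y)dxdydtds$; $\mathcal{H}$ is the completion of $\mathcal{D}(\mathbb{R}^2)$ under this inner product. Standing Assumption A: $\mu(d\xi)=(2\pi)^{-1}g(\xi)d\xi$, $\nu(d\tau)=(2\pi)^{-1}h(\tau)d\tau$ and, for some integer $k\ge1$, $\int_{\{hg>0\}}(1+\tau^2+|\xi|^2)^{-k}\frac{1}{h(\tau)g(\xi)}d\tau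 d\xi<\infty$. Chaos expansion. $I_n$ is the multiple Wiener integral of order $n$ with respect to $W$ (from $\mathcal{H}^{\otimes n}$ onto the $n$-th Wiener chaos; $\mathcal{H}^{\otimes 0}=\mathbb{R}$, $I_0=\mathrm{id}$). With $G(t,x)=\frac121_{\{|x|<t\}}$, let $$f_n(t_1,x_1,\dots,t_n,x_n,t,x)=G(t-t_n,x-x_n)\cdots G(t_2-t_1,x_2-x_1)1_{\{0<t_1<\dots<t_n<t\}},$$ and let $\widetilde f_n(\cdot,t,x)$ be its symmetrization in the $n$ pairs $(t_1,x_1),\dots,(t_n,x_n)$. The unique mild Skorohod solution is $u(t,x)=1+\sum_{n\ge1}I_n(f_n(\cdot,t,x))$. For $(r,z)\in[0,t]\times\mathbb{R}$, $D_{r,z}u(t,x)=\sum_{n\ge1}nI_{n-1}(\widetilde f_n(\cdot,r,z,t,x))$, a series converging in $L^2(\Omega)$, where $(r,z)$ replaces the last of the $n$ pairs; one works with a modification jointly measurable in $(\omega,r,z)$. *)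

theory Defs
  imports "HOL-Probability.Probability" "HOL-Library.Nonpos_Ints"
begin

subsection \<open>Test functions, tempered measures and Fourier transforms\<close>

definition iter_dir_deriv ::
  "'a::real_normed_vector list \<Rightarrow> ('a \<Rightarrow> 'b::real_normed_vector) \<Rightarrow> 'a \<Rightarrow> 'b"
  where "iter_dir_deriv vs \<phi> = foldr (\<lambda>v \<psi> x. frechet_derivative \<psi> (at x) v) vs \<phi>"

text \<open>Being smooth is expressed by Frechet differentiability of all iterated directional derivatives.\<close>

definition smooth :: "('a::real_normed_vector \<Rightarrow> 'b::real_normed_vector) \<Rightarrow> bool"
  where "smooth \<phi> \<longleftrightarrow> (\<forall>vs. iter_dir_deriv vs \<phi> differentiable_on UNIV)"

definition test_function :: "('a::real_normed_vector \<Rightarrow> 'b::real_normed_vector) \<Rightarrow> bool"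
  where "test_function \<phi> \<longleftrightarrow> smooth \<phi> \<and> compact (closure {x. \<phi> x \<noteq> 0})"

definition schwartz :: "(real \<Rightarrow> complex) \<Rightarrow> bool"
  where "schwartz \<phi> \<longleftrightarrow>
    smooth \<phi> \<and> (\<forall>k vs. bounded (range (\<lambda>x. \<bar>x\<bar> ^ k *\<^sub>R iter_dir_deriv vs \<phi> x)))"

definition fourier :: "(real \<Rightarrow> complex) \<Rightarrow> real \<Rightarrow> complex"
  where "fourier \<phi> \<xi> = (LINT x|lborel. exp (- (\<i> * of_real (\<xi> * x))) * \<phi> x)"

definition tempered_measure :: "real measure \<Rightarrow> bool"
  where "tempered_measure \<nu> \<longleftrightarrow> sets \<nu> = sets borel \<and>
    (\<exists>k::nat. (\<integral>\<^sup>+\<xi>. ennreal (1 / (1 + \<xi>\<^sup>2) ^ k) \<partial>\<nu>) < \<infinity>)"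

text \<open>The identity of tempered distributions \<open>\<gamma> = \<F>\<nu>\<close>, where \<open>\<gamma>\<close> acts by integration; the
  values at the single point where \<open>\<gamma>\<close> is infinite do not matter.\<close>

definition is_fourier_of_measure :: "(real \<Rightarrow> ennreal) \<Rightarrow> real measure \<Rightarrow> bool"
  where "is_fourier_of_measure \<gamma> \<nu> \<longleftrightarrow>
    (\<forall>\<phi>. schwartz \<phi> \<longrightarrow>
      integrable lborel (\<lambda>x. of_real (enn2real (\<gamma> x)) * \<phi> x) \<and>
      (LINT x|lborel. of_real (enn2real (\<gamma> x)) * \<phi> x) = (LINT \<xi>|\<nu>. fourier \<phi> \<xi>))"

text \<open>Non-negative definiteness in the sense of distributions:
  \<open>\<langle>\<gamma>, \<phi> * \<phi>'\<rangle> \<ge> 0\<close> with \<open>\<phi>'(x) = cnj (\<phi> (- x))\<close>, for complex test functions.\<close>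

definition nonneg_definite :: "(real \<Rightarrow> ennreal) \<Rightarrow> bool"
  where "nonneg_definite \<gamma> \<longleftrightarrow>
    (\<forall>\<phi> :: real \<Rightarrow> complex. test_function \<phi> \<longrightarrow>
      (LINT x|lborel. of_real (enn2real (\<gamma> x)) * (LINT y|lborel. \<phi> y * cnj (\<phi> (y - x))))
        \<in> \<real>\<^sub>\<ge>\<^sub>0)"

definition covariance_function :: "(real \<Rightarrow> ennreal) \<Rightarrow> bool"
  where "covariance_function \<gamma> \<longleftrightarrow>
    continuous_on UNIV \<gamma> \<and>
    (\<forall>t. \<gamma> (- t) = \<gamma> t) \<and>
    (\<forall>K. compact K \<longrightarrow> (\<integral>\<^sup>+t\<in>K. \<gamma> t \<partial>lborel) < \<infinity>) \<and>
    (\<forall>t. \<gamma> t < \<infinity> \<longleftrightarrow> t \<noteq> 0) \<and>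
    nonneg_definite \<gamma>"


subsection \<open>The Gaussian noise\<close>

definition noise_cov ::
  "(real \<Rightarrow> ennreal) \<Rightarrow> (real \<Rightarrow> ennreal) \<Rightarrow> real \<times> real \<Rightarrow> real \<times> real \<Rightarrow> ennreal"
  where "noise_cov \<gamma> f p q = \<gamma> (fst p - fst q) * f (snd p - snd q)"

definition inner_H ::
  "(real \<Rightarrow> ennreal) \<Rightarrow> (real \<Rightarrow> ennreal) \<Rightarrow> (real \<times> real \<Rightarrow> real) \<Rightarrow> (real \<times> real \<Rightarrow> real) \<Rightarrow> real"
  where "inner_H \<gamma> f \<phi> \<psi> =
    (LINT (p, q)|(lborel \<Otimes>\<^sub>M lborel). enn2real (noise_cov \<gamma> f p q) * \<phi> p * \<psi> q)"

text \<open>Degenerate Gaussian variables are admitted.\<close>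

definition centered_gaussian :: "'w measure \<Rightarrow> ('w \<Rightarrow> real) \<Rightarrow> bool"
  where "centered_gaussian M X \<longleftrightarrow> X \<in> borel_measurable M \<and>
    ((AE \<omega> in M. X \<omega> = 0) \<or>
     (\<exists>\<sigma>>0. distributed M lborel X (\<lambda>x. ennreal (normal_density 0 \<sigma> x))))"

definition gaussian_noise ::
  "(real \<Rightarrow> ennreal) \<Rightarrow> (real \<Rightarrow> ennreal) \<Rightarrow> 'w measure \<Rightarrow> ((real \<times> real \<Rightarrow> real) \<Rightarrow> 'w \<Rightarrow> real) \<Rightarrow> bool"
  where "gaussian_noise \<gamma> f M W \<longleftrightarrow>
    (\<forall>cs. (\<forall>(c, \<phi>)\<in>set cs. test_function \<phi>) \<longrightarrow>
       centered_gaussian M (\<lambda>\<omega>. \<Sum>(c, \<phi>)\<leftarrow>cs. c * W \<phi> \<omega>)) \<and>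
    (\<forall>\<phi> \<psi>. test_function \<phi> \<longrightarrow> test_function \<psi> \<longrightarrow>
       (LINT \<omega>|M. W \<phi> \<omega> * W \<psi> \<omega>) = inner_H \<gamma> f \<phi> \<psi>)"


subsection \<open>Multiple Wiener integrals\<close>

text \<open>A kernel of order \<open>n\<close> is a function of the \<open>n\<close> pairs \<open>p 0, \<dots>, p (n - 1)\<close>.\<close>

abbreviation pairs_measure :: "nat \<Rightarrow> (nat \<Rightarrow> real \<times> real) measure"
  where "pairs_measure n \<equiv> PiM {..<n} (\<lambda>_. lborel)"

definition norm2_H ::
  "(real \<Rightarrow> ennreal) \<Rightarrow> (real \<Rightarrow> ennreal) \<Rightarrow> nat \<Rightarrow> ((nat \<Rightarrow> real \<times> real) \<Rightarrow> real) \<Rightarrow> real"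
  where "norm2_H \<gamma> f n k =
    (LINT (p, q)|(pairs_measure n \<Otimes>\<^sub>M pairs_measure n).
       (\<Prod>i<n. enn2real (noise_cov \<gamma> f (p i) (q i))) * k p * k q)"

definition abs_integrable_H ::
  "(real \<Rightarrow> ennreal) \<Rightarrow> (real \<Rightarrow> ennreal) \<Rightarrow> nat \<Rightarrow> ((nat \<Rightarrow> real \<times> real) \<Rightarrow> real) \<Rightarrow> bool"
  where "abs_integrable_H \<gamma> f n k \<longleftrightarrow>
    k \<in> borel_measurable (pairs_measure n) \<and>
    (\<integral>\<^sup>+(p, q). (\<Prod>i<n. noise_cov \<gamma> f (p i) (q i)) * ennreal (\<bar>k p * k q\<bar>)
       \<partial>(pairs_measure n \<Otimes>\<^sub>M pairs_measure n)) < \<infinity>"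

definition symmetrization ::
  "nat \<Rightarrow> ((nat \<Rightarrow> 'a) \<Rightarrow> real) \<Rightarrow> (nat \<Rightarrow> 'a) \<Rightarrow> real"
  where "symmetrization n k p = (\<Sum>\<pi> | \<pi> permutes {..<n}. k (p \<circ> \<pi>)) / fact n"

text \<open>A list of pairs \<open>(c, \<phi>)\<close> encodes the symmetric tensor \<open>\<Sum> c \<phi>\<^sup>\<otimes>\<^sup>n\<close>. For \<open>\<phi>\<close> in
  \<open>\<D>(\<real>\<^sup>2)\<close> these tensors are dense in the symmetric part of \<open>\<H>\<^sup>\<otimes>\<^sup>n\<close>.\<close>

definition power_tensor ::
  "nat \<Rightarrow> (real \<times> ('a \<Rightarrow> real)) list \<Rightarrow> (nat \<Rightarrow> 'a) \<Rightarrow> real"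
  where "power_tensor n cs p = (\<Sum>(c, \<phi>)\<leftarrow>cs. c * (\<Prod>i<n. \<phi> (p i)))"

text \<open>\<open>hermite n v\<close> is the monic Hermite polynomial for the variance \<open>v\<close>: for \<open>v > 0\<close>,
  \<open>hermite n v x = v\<^sup>n\<^sup>/\<^sup>2 He\<^sub>n(x / sqrt v)\<close>, with \<open>He\<^sub>n\<close> orthogonal for the standard normal law.\<close>

fun hermite :: "nat \<Rightarrow> real \<Rightarrow> real \<Rightarrow> real" where
  "hermite 0 v x = 1"
| "hermite (Suc 0) v x = x"
| "hermite (Suc (Suc n)) v x = x * hermite (Suc n) v x - real (Suc n) * v * hermite n v x"

definition wiener_power_tensor ::
  "(real \<Rightarrow> ennreal) \<Rightarrow> (real \<Rightarrow> ennreal) \<Rightarrow> ((real \<times> real \<Rightarrow> real) \<Rightarrow> 'w \<Rightarrow> real)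
    \<Rightarrow> nat \<Rightarrow> (real \<times> (real \<times> real \<Rightarrow> real)) list \<Rightarrow> 'w \<Rightarrow> real"
  where "wiener_power_tensor \<gamma> f W n cs \<omega> =
    (\<Sum>(c, \<phi>)\<leftarrow>cs. c * hermite n (inner_H \<gamma> f \<phi> \<phi>) (W \<phi> \<omega>))"

definition L2_tendsto :: "'w measure \<Rightarrow> (nat \<Rightarrow> 'w \<Rightarrow> real) \<Rightarrow> ('w \<Rightarrow> real) \<Rightarrow> bool"
  where "L2_tendsto M X Y \<longleftrightarrow>
    (\<forall>j. X j \<in> borel_measurable M \<and> integrable M (\<lambda>\<omega>. (X j \<omega>)\<^sup>2)) \<and>
    Y \<in> borel_measurable M \<and> integrable M (\<lambda>\<omega>. (Y \<omega>)\<^sup>2) \<and>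
    (\<lambda>j. LINT \<omega>|M. (X j \<omega> - Y \<omega>)\<^sup>2) \<longlonglongrightarrow> 0"

text \<open>\<open>is_wiener_integral \<gamma> f M W n k X\<close>: the random variable \<open>X\<close> is a version of \<open>I\<^sub>n(k)\<close>. On
  \<open>\<phi>\<^sup>\<otimes>\<^sup>n\<close> the integral is the Hermite polynomial of \<open>W(\<phi>)\<close>; it is extended by linearity and by
  continuity from \<open>\<H>\<^sup>\<otimes>\<^sup>n\<close> to \<open>L\<^sup>2(\<Omega>)\<close>, and \<open>I\<^sub>n(k)\<close> is \<open>I\<^sub>n\<close> of the symmetrization of \<open>k\<close>.
  A function with absolutely convergent \<open>\<H>\<^sup>\<otimes>\<^sup>n\<close>-norm is identified with the element of the
  completion to which a Cauchy sequence of tensors of test functions converges if the sequence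
  converges to the function in the (semi)norm given by \<open>norm2_H\<close>. Absolute convergence is required
  explicitly, because a divergent Bochner integral is \<open>0\<close> by convention.\<close>

definition is_wiener_integral ::
  "(real \<Rightarrow> ennreal) \<Rightarrow> (real \<Rightarrow> ennreal) \<Rightarrow> 'w measure \<Rightarrow> ((real \<times> real \<Rightarrow> real) \<Rightarrow> 'w \<Rightarrow> real)
    \<Rightarrow> nat \<Rightarrow> ((nat \<Rightarrow> real \<times> real) \<Rightarrow> real) \<Rightarrow> ('w \<Rightarrow> real) \<Rightarrow> bool"
  where "is_wiener_integral \<gamma> f M W n k X \<longleftrightarrow>
    abs_integrable_H \<gamma> f n k \<and>
    (\<exists>cs :: nat \<Rightarrow> (real \<times> (real \<times> real \<Rightarrow> real)) list.
      (\<forall>j. \<forall>(c, \<phi>)\<in>set (cs j). test_function \<phi>) \<and>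
      (\<forall>j. abs_integrable_H \<gamma> f n (\<lambda>p. power_tensor n (cs j) p - symmetrization n k p)) \<and>
      (\<lambda>j. norm2_H \<gamma> f n (\<lambda>p. power_tensor n (cs j) p - symmetrization n k p)) \<longlonglongrightarrow> 0 \<and>
      L2_tendsto M (\<lambda>j. wiener_power_tensor \<gamma> f W n (cs j)) X)"


subsection \<open>Chaos expansions and the Malliavin derivative\<close>

text \<open>\<open>F = \<Sum>\<^sub>n I\<^sub>n(k\<^sub>n)\<close> in \<open>L\<^sup>2(\<Omega>)\<close>.\<close>

definition has_chaos_expansion ::
  "(real \<Rightarrow> ennreal) \<Rightarrow> (real \<Rightarrow> ennreal) \<Rightarrow> 'w measure \<Rightarrow> ((real \<times> real \<Rightarrow> real) \<Rightarrow> 'w \<Rightarrow> real)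
    \<Rightarrow> (nat \<Rightarrow> (nat \<Rightarrow> real \<times> real) \<Rightarrow> real) \<Rightarrow> ('w \<Rightarrow> real) \<Rightarrow> bool"
  where "has_chaos_expansion \<gamma> f M W k F \<longleftrightarrow>
    (\<exists>Y. (\<forall>n. is_wiener_integral \<gamma> f M W n (k n) (Y n)) \<and>
         L2_tendsto M (\<lambda>N \<omega>. \<Sum>n<N. Y n \<omega>) F)"

text \<open>For \<open>F = \<Sum>\<^sub>n I\<^sub>n(k\<^sub>n)\<close>, the variable \<open>DF\<close> is a version of the Malliavin derivative
  \<open>D\<^bsub>r,z\<^esub> F = \<Sum>\<^bsub>n \<ge> 1\<^esub> n I\<^bsub>n-1\<^esub>(k'\<^sub>n(\<cdot>, r, z))\<close>, where \<open>k'\<^sub>n\<close> is the symmetrization of \<open>k\<^sub>n\<close>. The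
  summation index is \<open>m = n - 1\<close>, and \<open>(r, z)\<close> replaces the last pair, which has index \<open>m\<close>.\<close>

definition is_malliavin_derivative ::
  "(real \<Rightarrow> ennreal) \<Rightarrow> (real \<Rightarrow> ennreal) \<Rightarrow> 'w measure \<Rightarrow> ((real \<times> real \<Rightarrow> real) \<Rightarrow> 'w \<Rightarrow> real)
    \<Rightarrow> (nat \<Rightarrow> (nat \<Rightarrow> real \<times> real) \<Rightarrow> real) \<Rightarrow> ('w \<Rightarrow> real) \<Rightarrow> real \<times> real \<Rightarrow> ('w \<Rightarrow> real) \<Rightarrow> bool"
  where "is_malliavin_derivative \<gamma> f M W k F rz DF \<longleftrightarrow>
    has_chaos_expansion \<gamma> f M W k F \<and>
    (\<exists>Y. (\<forall>m. is_wiener_integral \<gamma> f M W m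
                (\<lambda>p. symmetrization (Suc m) (k (Suc m)) (p(m := rz))) (Y m)) \<and>
         L2_tendsto M (\<lambda>N \<omega>. \<Sum>m<N. real (Suc m) * Y m \<omega>) DF)"


subsection \<open>The stochastic wave equation\<close>

definition wave_fundamental :: "real \<Rightarrow> real \<Rightarrow> real"
  where "wave_fundamental t x = (if \<bar>x\<bar> < t then 1 / 2 else 0)"

text \<open>The kernel \<open>f\<^sub>n(\<cdot>, t, x)\<close>: the pairs \<open>(t\<^sub>1, x\<^sub>1), \<dots>, (t\<^sub>n, x\<^sub>n)\<close> are \<open>p 0, \<dots>, p (n - 1)\<close>, and
  \<open>q n\<close> is \<open>(t, x)\<close>. Because the conditions are all inside the quantifier over \<open>i < n\<close>, the kernel of
  order \<open>0\<close> is the constant \<open>1\<close>, which is the leading term of the chaos expansion of the solution.\<close>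

definition wave_kernel :: "real \<Rightarrow> real \<Rightarrow> nat \<Rightarrow> (nat \<Rightarrow> real \<times> real) \<Rightarrow> real"
  where "wave_kernel t x n p =
    (let q = p(n := (t, x)) in
      if \<forall>i<n. 0 < fst (q i) \<and> fst (q i) < fst (q (Suc i))
      then (\<Prod>i<n. wave_fundamental (fst (q (Suc i)) - fst (q i)) (snd (q (Suc i)) - snd (q i)))
      else 0)"

text \<open>The mild Skorohod solution of \<open>\<partial>\<^sub>t\<^sup>2 u = \<partial>\<^sub>x\<^sup>2 u + u \<partial>W\<close> with \<open>u(0, \<cdot>) = 1\<close>, \<open>\<partial>\<^sub>t u(0, \<cdot>) = 0\<close>
  is the process \<open>u(t, x) = 1 + \<Sum>\<^bsub>n \<ge> 1\<^esub> I\<^sub>n(f\<^sub>n(\<cdot>, t, x))\<close>.\<close>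

definition wave_solution ::
  "(real \<Rightarrow> ennreal) \<Rightarrow> (real \<Rightarrow> ennreal) \<Rightarrow> 'w measure \<Rightarrow> ((real \<times> real \<Rightarrow> real) \<Rightarrow> 'w \<Rightarrow> real)
    \<Rightarrow> (real \<Rightarrow> real \<Rightarrow> 'w \<Rightarrow> real) \<Rightarrow> bool"
  where "wave_solution \<gamma> f M W u \<longleftrightarrow>
    (\<forall>t\<ge>0. \<forall>x. has_chaos_expansion \<gamma> f M W (wave_kernel t x) (u t x))"

text \<open>\<open>D t x r z\<close> is \<open>D\<^bsub>r,z\<^esub> u(t, x)\<close> for \<open>(r, z) \<in> [0, t] \<times> \<real>\<close>, in a version that is jointly
  measurable in \<open>(\<omega>, r, z)\<close>.\<close>

definition wave_malliavin_derivative ::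
  "(real \<Rightarrow> ennreal) \<Rightarrow> (real \<Rightarrow> ennreal) \<Rightarrow> 'w measure \<Rightarrow> ((real \<times> real \<Rightarrow> real) \<Rightarrow> 'w \<Rightarrow> real)
    \<Rightarrow> (real \<Rightarrow> real \<Rightarrow> 'w \<Rightarrow> real) \<Rightarrow> (real \<Rightarrow> real \<Rightarrow> real \<Rightarrow> real \<Rightarrow> 'w \<Rightarrow> real) \<Rightarrow> bool"
  where "wave_malliavin_derivative \<gamma> f M W u D \<longleftrightarrow>
    (\<forall>t\<ge>0. \<forall>x.
      (\<forall>r\<in>{0..t}. \<forall>z.
        is_malliavin_derivative \<gamma> f M W (wave_kernel t x) (u t x) (r, z) (D t x r z)) \<and>
      (\<lambda>(\<omega>, r, z). D t x r z \<omega>)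
        \<in> borel_measurable (M \<Otimes>\<^sub>M (restrict_space borel {0..t} \<Otimes>\<^sub>M borel)))"

end

theory Submission
  imports Defs
begin

text \<open>The permutations of the kernel have disjoint supports, so the symmetrized kernel of order \<open>m + 1\<close> is at
  most \<open>2\<^sup>-\<^sup>m\<^sup>-\<^sup>1 / (m + 1)!\<close>, and it vanishes unless all pairs lie in \<open>(0, T) \<times> (x - T, x + T)\<close>. With
  \<open>A\<close> a bound, uniform in \<open>x\<close>, for the integral of the covariance over this box squared, the \<open>m\<close>-th
  chaos of \<open>D\<^bsub>r,z\<^esub> u(t, x)\<close> then has second moment at most of the order \<open>(A / 4)\<^sup>m / m!\<close>, and it is \<open>0\<close>
  for \<open>\<bar>z - x\<bar> \<ge> T\<close>.

  Passing from the Wiener integrals of tensors of test functions to those of the kernels needs only one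
  inequality of the Wiener isometry, up to a constant; it follows from the parallelogram law once \<open>norm2_H\<close> is known to be
  non-negative. For this, \<open>\<gamma>\<close> and \<open>f\<close> are convolved with Gaussian densities: the convolutions are
  mixtures of the kernels \<open>cos (\<xi> (t - s))\<close>, and positivity survives products with these kernels by
  the addition theorem of the cosine.\<close>

text \<open>The decay 1 / m! is a balance of factorials: the Wiener isometry contributes m!, the
  derivative contributes (m + 1)^2, and the squared kernel bound contributes 1 / ((m + 1)!)^2. The
  factorial in the kernel, which comes from the ordering of the times, is therefore essential.
  Against this decay constant factors are cheap: the isometry may be replaced by a one-sided
  estimate, and the partial sums of the chaos series may be estimated by Cauchy-Schwarz with weights
  2^m, which only doubles the argument of an exponential.

  The obstacle is that \<open>norm2_H\<close> is merely an integral formula: its non-negativity has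
  to be extracted from a distributional Fourier identity, for functions that blow up at 0. Gaussian
  densities help in three ways. They are Schwartz functions, so the Fourier identity applies to them
  and makes \<gamma> and f integrable against them on the whole line; their transforms make the
  spectral measures finite; and, being strictly positive, their products dominate test functions as
  well as indicators of boxes, so that one type of majorant covers all kernels that occur.\<close>

subsection \<open>Gaussian pairs and Hermite polynomials\<close>

text \<open>Odd moments vanish, and the closed form
  \<open>fact (2 * k) / ((2 / \<sigma>\<^sup>2) ^ k * fact k)\<close> of the even ones gains the
  factor \<open>real (2 * k + 1) * \<sigma>\<^sup>2\<close> when k increases by one.\<close>

lemma normal_density_moment_step:
  fixes \<sigma> :: real
  assumes "\<sigma> > 0"
  shows "(LINT x|lborel. normal_density 0 \<sigma> x * x ^ (n + 2))
      = real (n + 1) * \<sigma>\<^sup>2 * (LINT x|lborel. normal_density 0 \<sigma> x * x ^ n)"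
proof (cases "even n")
  case True
  then obtain k where k: "n = 2 * k" by (elim evenE)
  have e: "n + 2 = 2 * Suc k" using k by simp
  have "(LINT x|lborel. normal_density 0 \<sigma> x * x ^ (n + 2)) = fact (2 * Suc k) / ((2 / \<sigma>\<^sup>2) ^ Suc k * fact (Suc k))"
    unfolding e using integral_normal_moment_even[OF assms, of 0 "Suc k"] by simp
  also have "fact (2 * Suc k) = (2 * real (Suc k)) * (real (2 * k + 1) * fact (2 * k))"
    by (simp add: algebra_simps)
  also have "fact (Suc k) = real (Suc k) * (fact k :: real)" by simp
  also have "(2 * real (Suc k)) * (real (2 * k + 1) * fact (2 * k)) / ((2 / \<sigma>\<^sup>2) ^ Suc k * (real (Suc k) * fact k))
      = real (2 * k + 1) * \<sigma>\<^sup>2 * (fact (2 * k) / ((2 / \<sigma>\<^sup>2) ^ k * fact k))"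
    using assms by (simp add: divide_simps del: of_nat_Suc of_nat_add of_nat_mult)
  also have "fact (2 * k) / ((2 / \<sigma>\<^sup>2) ^ k * fact k) = (LINT x|lborel. normal_density 0 \<sigma> x * x ^ n)"
    unfolding k using integral_normal_moment_even[OF assms, of 0 k] by simp
  finally show ?thesis unfolding k by simp
next
  case False
  then obtain k where k: "n = 2 * k + 1" by (elim oddE)
  have e: "n + 2 = 2 * Suc k + 1" using k by simp
  show ?thesis
    unfolding e unfolding k
    using integral_normal_moment_odd[OF assms, of 0 k] integral_normal_moment_odd[OF assms, of 0 "Suc k"] by simp
qed

text \<open>With the variance written as a second moment, the recursion also holds for a variable
  that vanishes almost surely, so degenerate Gaussian variables need no separate treatment
  afterwards.\<close>

lemma (in prob_space) centered_gaussian_moments: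
  assumes "centered_gaussian M X"
  shows "X \<in> borel_measurable M"
    and "expectation X = 0"
    and "integrable M (\<lambda>\<omega>. X \<omega> ^ n)"
    and "expectation (\<lambda>\<omega>. X \<omega> ^ (n + 2)) = real (n + 1) * expectation (\<lambda>\<omega>. X \<omega> ^ 2) * expectation (\<lambda>\<omega>. X \<omega> ^ n)"
proof -
  show [measurable]: "X \<in> borel_measurable M"
    using assms by (simp add: centered_gaussian_def)
  consider (zero) "AE \<omega> in M. X \<omega> = 0"
    | (normal) \<sigma> where "\<sigma> > 0" "distributed M lborel X (\<lambda>x. ennreal (normal_density 0 \<sigma> x))"
    using assms by (auto simp: centered_gaussian_def)
  then have "expectation X = 0 \<and> integrable M (\<lambda>\<omega>. X \<omega> ^ n) \<and>
    expectation (\<lambda>\<omega>. X \<omega> ^ (n + 2)) = real (n + 1) * expectation (\<lambda>\<omega>. X \<omega> ^ 2) * expectation (\<lambda>\<omega>. X \<omega> ^ n)"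
  proof cases
    case zero
    have pow: "integrable M (\<lambda>\<omega>. X \<omega> ^ k) \<and> expectation (\<lambda>\<omega>. X \<omega> ^ k) = 0 ^ k" for k
    proof -
      have "AE \<omega> in M. X \<omega> ^ k = 0 ^ k" using zero by eventually_elim simp
      then have "expectation (\<lambda>\<omega>. X \<omega> ^ k) = expectation (\<lambda>\<omega>. 0 ^ k)"
        by (intro integral_cong_AE) simp_all
      moreover have "integrable M (\<lambda>\<omega>. X \<omega> ^ k)"
      proof (rule integrable_cong_AE_imp)
        show "integrable M (\<lambda>\<omega>. 0 ^ k :: real)" by simp
        show "AE \<omega> in M. 0 ^ k = X \<omega> ^ k" using zero by eventually_elim simp
      qed simp
      ultimately have "expectation (\<lambda>\<omega>. X \<omega> ^ k) = expectation (\<lambda>\<omega>. 0 ^ k)"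
        and "integrable M (\<lambda>\<omega>. X \<omega> ^ k)" by auto
      then show ?thesis by (simp add: prob_space)
    qed
    show ?thesis using pow[of 1] pow[of n] pow[of 2] pow[of "n + 2"] by simp
  next
    case normal
    have mom: "expectation (\<lambda>\<omega>. X \<omega> ^ k) = (LINT x|lborel. normal_density 0 \<sigma> x * x ^ k)" for k
      by (rule distributed_integral[OF normal(2), symmetric]) auto
    have "integrable lborel (\<lambda>x. normal_density 0 \<sigma> x * x ^ n)"
      using integrable_normal_moment[OF normal(1), of 0 n] by simp
    then have "integrable M (\<lambda>\<omega>. X \<omega> ^ n)"
      by (subst distributed_integrable[OF normal(2), symmetric]) auto
    moreover have "expectation X = 0"
      using mom[of 1] integral_normal_moment_odd[OF normal(1), of 0 0] by simp
    moreover have "expectation (\<lambda>\<omega>. X \<omega> ^ 2) = \<sigma>\<^sup>2"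
      using normal_density_moment_step[OF normal(1), of 0] normal(1) mom[of 2] by (simp add: numeral_2_eq_2)
    ultimately show ?thesis
      using normal_density_moment_step[OF normal(1), of n] by (simp only: mom)
  qed
  then show "expectation X = 0" and "integrable M (\<lambda>\<omega>. X \<omega> ^ n)"
    and "expectation (\<lambda>\<omega>. X \<omega> ^ (n + 2)) = real (n + 1) * expectation (\<lambda>\<omega>. X \<omega> ^ 2) * expectation (\<lambda>\<omega>. X \<omega> ^ n)"
    by auto
qed

section \<open>Gaussian integration by parts for a jointly Gaussian pair\<close>

locale gaussian_pair = prob_space M for M :: "'w measure" +
  fixes X Y :: "'w \<Rightarrow> real"
  assumes gaussian: "centered_gaussian M (\<lambda>\<omega>. c * X \<omega> + d * Y \<omega>)"
begin

abbreviation "L c d \<equiv> \<lambda>\<omega>. c * X \<omega> + d * Y \<omega>"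

lemma measurable_X [measurable]: "X \<in> borel_measurable M"
  and measurable_Y [measurable]: "Y \<in> borel_measurable M"
  using centered_gaussian_moments(1)[OF gaussian[of 1 0]] centered_gaussian_moments(1)[OF gaussian[of 0 1]]
  by auto

lemma integrable_monomial2: "integrable M (\<lambda>\<omega>. X \<omega> ^ a * Y \<omega> ^ b)"
proof (rule Bochner_Integration.integrable_bound)
  show "integrable M (\<lambda>\<omega>. X \<omega> ^ (2 * a) + Y \<omega> ^ (2 * b))"
    using centered_gaussian_moments(3)[OF gaussian[of 1 0]] centered_gaussian_moments(3)[OF gaussian[of 0 1]]
    by auto
  have "\<bar>x * y\<bar> \<le> x\<^sup>2 + y\<^sup>2" for x y :: real
  proof -
    have "0 \<le> (\<bar>x\<bar> - \<bar>y\<bar>)\<^sup>2" by simp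
    then have "2 * (\<bar>x\<bar> * \<bar>y\<bar>) \<le> x\<^sup>2 + y\<^sup>2" by (simp add: power2_diff)
    moreover have "0 \<le> \<bar>x\<bar> * \<bar>y\<bar>" by simp
    ultimately show ?thesis by (simp only: abs_mult)
  qed
  from this[of "X _ ^ a" "Y _ ^ b"]
  show "AE \<omega> in M. norm (X \<omega> ^ a * Y \<omega> ^ b) \<le> norm (X \<omega> ^ (2 * a) + Y \<omega> ^ (2 * b))"
    by (intro AE_I2) (simp add: power_mult[symmetric] mult.commute, smt (verit) power_even_eq zero_le_power2)
qed measurable

lemma integrable_monomial: "integrable M (\<lambda>\<omega>. X \<omega> ^ a * Y \<omega> ^ b * L c d \<omega> ^ n)"
proof (induction n arbitrary: a b)
  case 0
  then show ?case using integrable_monomial2 by simp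
next
  case (Suc n)
  have "integrable M (\<lambda>\<omega>. c * (X \<omega> ^ Suc a * Y \<omega> ^ b * L c d \<omega> ^ n) + d * (X \<omega> ^ a * Y \<omega> ^ Suc b * L c d \<omega> ^ n))"
    using Suc[of "Suc a" b] Suc[of a "Suc b"]
    by (intro Bochner_Integration.integrable_add Bochner_Integration.integrable_mult_right)
  then show ?case by (simp add: algebra_simps)
qed

text \<open>The weights c and d stay variable because differentiating in c creates a factor X under
  the expectation.\<close>

definition "mom a b n c d = expectation (\<lambda>\<omega>. X \<omega> ^ a * Y \<omega> ^ b * L c d \<omega> ^ n)"

lemma mom_Suc: "mom a b (Suc n) c d = c * mom (Suc a) b n c d + d * mom a (Suc b) n c d"
proof -
  have "mom a b (Suc n) c d = expectation (\<lambda>\<omega>. c * (X \<omega> ^ Suc a * Y \<omega> ^ b * L c d \<omega> ^ n) + d * (X \<omega> ^ a * Y \<omega> ^ Suc b * L c d \<omega> ^ n))"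
    unfolding mom_def by (simp add: algebra_simps)
  also have "\<dots> = c * mom (Suc a) b n c d + d * mom a (Suc b) n c d"
    unfolding mom_def using integrable_monomial[of "Suc a" b c d n] integrable_monomial[of a "Suc b" c d n]
    by (subst Bochner_Integration.integral_add) simp_all
  finally show ?thesis .
qed

text \<open>By \<open>mom_Suc\<close> the moment is a polynomial in c, so the derivative is found by
  induction on n, without interchanging derivative and expectation.\<close>

lemma mom_deriv: "((\<lambda>c. mom a b n c d) has_real_derivative (real n * mom (Suc a) b (n - 1) c d)) (at c)"
proof (induction n arbitrary: a b)
  case 0
  then show ?case by (simp add: mom_def)
next
  case (Suc n)
  have "((\<lambda>c. c * mom (Suc a) b n c d + d * mom a (Suc b) n c d) has_real_derivative
      mom (Suc a) b n c d + c * (real n * mom (Suc (Suc a)) b (n - 1) c d) +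
      d * (real n * mom (Suc a) (Suc b) (n - 1) c d)) (at c)"
    by (auto intro!: derivative_eq_intros Suc)
  moreover have "mom (Suc a) b n c d + c * (real n * mom (Suc (Suc a)) b (n - 1) c d) +
      d * (real n * mom (Suc a) (Suc b) (n - 1) c d) = real (Suc n) * mom (Suc a) b n c d"
    using mom_Suc[of "Suc a" b "n - 1" c d] by (cases n) (simp_all add: algebra_simps)
  ultimately show ?case by (simp add: mom_Suc)
qed

text \<open>For n = 0 the weights c and d drop out, so the final zeros in these three constants are
  arbitrary.\<close>

definition "vX = mom 2 0 0 0 0"
definition "vY = mom 0 2 0 0 0"
definition "rho = mom 1 1 0 0 0"

lemma mom_second: "mom 0 0 2 c d = c\<^sup>2 * vX + 2 * c * d * rho + d\<^sup>2 * vY"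
proof -
  have z: "mom a b 0 c d = mom a b 0 0 0" for a b by (simp add: mom_def)
  show ?thesis
    unfolding vX_def vY_def rho_def
    by (simp add: numeral_2_eq_2 mom_Suc z[of _ _] power2_eq_square algebra_simps)
qed

lemma mom_step: "mom 0 0 (n + 2) c d = real (n + 1) * (c\<^sup>2 * vX + 2 * c * d * rho + d\<^sup>2 * vY) * mom 0 0 n c d"
  using centered_gaussian_moments(4)[OF gaussian[of c d], of n] mom_second[of c d]
  by (simp add: mom_def)

text \<open>The recursions for the moments of \<open>L = c X + d Y\<close> against powers of \<open>X\<close> are obtained from
  the moments of \<open>L\<close> alone by differentiating with respect to \<open>c\<close>.\<close>

lemma mom_stein_0: "mom 1 0 n c d = real n * (c * vX + d * rho) * mom 0 0 (n - 1) c d"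
proof (induction n rule: less_induct)
  case (less n)
  let ?s = "\<lambda>c. c\<^sup>2 * vX + 2 * c * d * rho + d\<^sup>2 * vY"
  show ?case
  proof (cases n)
    case 0
    then show ?thesis using centered_gaussian_moments(2)[OF gaussian[of 1 0]] by (simp add: mom_def)
  next
    case (Suc k)
    \<comment> \<open>Both sides of \<open>mom_step\<close> are differentiated in c; comparing the
      derivatives determines \<open>mom 1 0 n c d\<close>.\<close>
    have d1: "((\<lambda>c. mom 0 0 (k + 2) c d) has_real_derivative (real (k + 2) * mom 1 0 n c d)) (at c)"
      using mom_deriv[of 0 0 "k + 2" d c] Suc by simp
    have d2: "((\<lambda>c. real (k + 1) * ?s c * mom 0 0 k c d) has_real_derivative
        (real (k + 1) * ((2 * c * vX + 2 * d * rho) * mom 0 0 k c d + ?s c * (real k * mom 1 0 (k - 1) c d)))) (at c)"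
      using mom_deriv[of 0 0 k d c]
      by (auto intro!: derivative_eq_intros simp: algebra_simps)
    have "real (k + 2) * mom 1 0 n c d = real (k + 1) * ((2 * c * vX + 2 * d * rho) * mom 0 0 k c d + ?s c * (real k * mom 1 0 (k - 1) c d))"
      using d1 d2 unfolding mom_step by (rule DERIV_unique)
    \<comment> \<open>The induction hypothesis at k - 1 produces \<open>mom 0 0 (k - 2) c d\<close>,
      and the factor \<open>?s c\<close> raises this back to \<open>mom 0 0 k c d\<close> by
      \<open>mom_step\<close>. The two summands then add up to a multiple of k + 2, which
      cancels.\<close>
    also have "?s c * (real k * mom 1 0 (k - 1) c d) = real k * (c * vX + d * rho) * mom 0 0 k c d"
    proof (cases "k \<ge> 2")
      case True
      then obtain j where j: "k = j + 2" by (metis add.commute le_Suc_ex)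
      have "mom 1 0 (k - 1) c d = real (k - 1) * (c * vX + d * rho) * mom 0 0 j c d"
        using less[of "k - 1"] Suc j by simp
      then show ?thesis using mom_step[of j c d] j by (simp add: algebra_simps)
    next
      case False
      then consider "k = 0" | "k = 1" by linarith
      then show ?thesis
      proof cases
        case 2
        then show ?thesis using less[of 0] Suc centered_gaussian_moments(2)[OF gaussian[of c d]] by (simp add: mom_def)
      qed simp
    qed
    finally have "real (k + 2) * mom 1 0 n c d = real (k + 2) * (real n * (c * vX + d * rho) * mom 0 0 k c d)"
      using Suc by (simp add: algebra_simps)
    then show ?thesis using Suc by simp
  qed
qed


lemma mom_stein: "mom (Suc a) 0 n c d = real a * vX * mom (a - 1) 0 n c d + real n * (c * vX + d * rho) * mom a 0 (n - 1) c d"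
proof (induction a arbitrary: n c)
  case 0
  then show ?case using mom_stein_0[of n c d] by simp
next
  case (Suc a)
  \<comment> \<open>Differentiating the hypothesis at exponent n + 1 yields one more power of X
    together with a factor n + 1, which cancels in the end.\<close>
  have d1: "((\<lambda>c. mom (Suc a) 0 (Suc n) c d) has_real_derivative (real (Suc n) * mom (Suc (Suc a)) 0 n c d)) (at c)"
    using mom_deriv[of "Suc a" 0 "Suc n" d c] by simp
  have d2: "((\<lambda>c. real a * vX * mom (a - 1) 0 (Suc n) c d + real (Suc n) * (c * vX + d * rho) * mom a 0 n c d) has_real_derivative
      (real a * vX * (real (Suc n) * mom (Suc (a - 1)) 0 n c d) + real (Suc n) * (vX * mom a 0 n c d + (c * vX + d * rho) * (real n * mom (Suc a) 0 (n - 1) c d)))) (at c)"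
    using mom_deriv[of "a - 1" 0 "Suc n" d c] mom_deriv[of a 0 n d c]
    by (auto intro!: derivative_eq_intros simp: algebra_simps)
  have "real (Suc n) * mom (Suc (Suc a)) 0 n c d =
      real a * vX * (real (Suc n) * mom (Suc (a - 1)) 0 n c d) + real (Suc n) * (vX * mom a 0 n c d + (c * vX + d * rho) * (real n * mom (Suc a) 0 (n - 1) c d))"
    using d1 d2 unfolding Suc[of "Suc n"] by (intro DERIV_unique) simp_all
  also have "\<dots> = real (Suc n) * (real (Suc a) * vX * mom a 0 n c d + real n * (c * vX + d * rho) * mom (Suc a) 0 (n - 1) c d)"
    by (cases a) (simp_all add: algebra_simps)
  finally show ?case by simp
qed

text \<open>Gaussian integration by parts for monomials: the case c = 0, d = 1 of
  \<open>mom_stein\<close>, in which the linear combination is Y itself.\<close>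

lemma stein_monomial:
  "expectation (\<lambda>\<omega>. X \<omega> * (X \<omega> ^ a * Y \<omega> ^ b))
    = vX * real a * expectation (\<lambda>\<omega>. X \<omega> ^ (a - 1) * Y \<omega> ^ b)
    + rho * real b * expectation (\<lambda>\<omega>. X \<omega> ^ a * Y \<omega> ^ (b - 1))"
  using mom_stein[of a b 0 1] by (simp add: mom_def algebra_simps)

lemma integrable_poly2: "integrable M (\<lambda>\<omega>. X \<omega> ^ a * poly p (X \<omega>) * poly q (Y \<omega>))"
proof -
  have "integrable M (\<lambda>\<omega>. \<Sum>i\<le>degree p. \<Sum>j\<le>degree q. coeff p i * coeff q j * (X \<omega> ^ (a + i) * Y \<omega> ^ j))"
    by (intro Bochner_Integration.integrable_sum Bochner_Integration.integrable_mult_right integrable_monomial2)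
  then show ?thesis
    by (simp add: poly_altdef sum_product sum_distrib_left power_add algebra_simps)
qed

text \<open>Both sides are bilinear in p and q, so the monomial case suffices.\<close>

lemma stein_poly:
  "expectation (\<lambda>\<omega>. X \<omega> * (poly p (X \<omega>) * poly q (Y \<omega>)))
    = vX * expectation (\<lambda>\<omega>. poly (pderiv p) (X \<omega>) * poly q (Y \<omega>))
    + rho * expectation (\<lambda>\<omega>. poly p (X \<omega>) * poly (pderiv q) (Y \<omega>))" (is "?P p q")
proof -
  note int = integrable_poly2[of 0, simplified] integrable_poly2[of 1, simplified, unfolded mult.assoc]
  have add_p: "?P (p + p') q" if "?P p q" "?P p' q" for p p' q
    using that by (simp add: pderiv_add distrib_left distrib_right int Bochner_Integration.integral_add)
  have add_q: "?P p (q + q')" if "?P p q" "?P p q'" for p q q'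
    using that by (simp add: pderiv_add distrib_left distrib_right int Bochner_Integration.integral_add)
  have mon: "?P (monom a i) (monom b j)" for a b i j
  proof -
    have "expectation (\<lambda>\<omega>. X \<omega> * (poly (monom a i) (X \<omega>) * poly (monom b j) (Y \<omega>)))
      = a * b * expectation (\<lambda>\<omega>. X \<omega> * (X \<omega> ^ i * Y \<omega> ^ j))"
      by (subst Bochner_Integration.integral_mult_right_zero[symmetric]) (simp add: poly_monom algebra_simps)
    also have "\<dots> = vX * (a * real i * b * expectation (\<lambda>\<omega>. X \<omega> ^ (i - 1) * Y \<omega> ^ j))
        + rho * (a * (b * real j) * expectation (\<lambda>\<omega>. X \<omega> ^ i * Y \<omega> ^ (j - 1)))"
      unfolding stein_monomial by (simp add: algebra_simps)
    also have "a * real i * b * expectation (\<lambda>\<omega>. X \<omega> ^ (i - 1) * Y \<omega> ^ j)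
        = expectation (\<lambda>\<omega>. poly (pderiv (monom a i)) (X \<omega>) * poly (monom b j) (Y \<omega>))"
      by (subst Bochner_Integration.integral_mult_right_zero[symmetric]) (simp add: poly_monom pderiv_monom algebra_simps)
    also have "a * (b * real j) * expectation (\<lambda>\<omega>. X \<omega> ^ i * Y \<omega> ^ (j - 1))
        = expectation (\<lambda>\<omega>. poly (monom a i) (X \<omega>) * poly (pderiv (monom b j)) (Y \<omega>))"
      by (subst Bochner_Integration.integral_mult_right_zero[symmetric]) (simp add: poly_monom pderiv_monom algebra_simps)
    finally show ?thesis .
  qed
  have zero: "?P 0 q" "?P p 0" for p q by simp_all
  have "?P (monom a i) (\<Sum>j\<in>J. monom (coeff q j) j)" if "finite J" for a i J
    using that
  proof induction
    case (insert j J)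
    show ?case unfolding sum.insert[OF insert.hyps] by (rule add_q[OF mon insert.IH])
  qed (simp only: sum.empty zero)
  from this[OF finite_atMost[of "degree q"]] have mq: "?P (monom a i) q" for a i
    unfolding poly_as_sum_of_monoms .
  have "?P (\<Sum>j\<in>J. monom (coeff p j) j) q" if "finite J" for J
    using that
  proof induction
    case (insert j J)
    show ?case unfolding sum.insert[OF insert.hyps] by (rule add_p[OF mq insert.IH])
  qed (simp only: sum.empty zero)
  from this[OF finite_atMost[of "degree p"]] show ?thesis
    unfolding poly_as_sum_of_monoms .
qed

section \<open>Hermite polynomials as formal polynomials, and their expectations\<close>

fun hermite_poly :: "nat \<Rightarrow> real \<Rightarrow> real poly" where
  "hermite_poly 0 v = 1"
| "hermite_poly (Suc 0) v = [:0, 1:]"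
| "hermite_poly (Suc (Suc n)) v = [:0, 1:] * hermite_poly (Suc n) v - smult (real (Suc n) * v) (hermite_poly n v)"

lemma poly_hermite_poly: "poly (hermite_poly n v) x = hermite n v x"
  by (induction n v rule: hermite_poly.induct) auto

lemma pderiv_hermite_poly: "pderiv (hermite_poly (Suc n) v) = smult (real (Suc n)) (hermite_poly n v)"
proof (induction n rule: induct_nat_012)
  case 0
  then show ?case by (simp add: pderiv_pCons)
next
  case 1
  then show ?case by (simp add: pderiv_pCons pderiv_diff pderiv_mult)
next
  case (ge2 n)
  show ?case
    by (subst hermite_poly.simps(3), subst pderiv_diff, subst pderiv_mult, subst pderiv_smult, subst ge2(2), subst ge2(1))
      (rule iffD1[OF poly_eq_poly_eq_iff], simp add: pderiv_pCons fun_eq_iff algebra_simps)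
qed

text \<open>The three-term recursion says H_(n+1)(X) = X H_n(X) - vX H_n'(X). Integration by parts
  of the first term produces the second with opposite sign, so that only the derivative falling on
  the polynomial in Y survives. For this cancellation the first polynomial must carry the true
  variance of X, whereas v may be any number.\<close>

lemma expectation_hermite_Suc:
  "expectation (\<lambda>\<omega>. hermite (Suc n) vX (X \<omega>) * hermite (Suc m) v (Y \<omega>))
    = rho * real (Suc m) * expectation (\<lambda>\<omega>. hermite n vX (X \<omega>) * hermite m v (Y \<omega>))"
proof -
  define q where "q = hermite_poly (Suc m) v"
  note int = integrable_poly2[of 0, simplified] integrable_poly2[of 1, simplified, unfolded mult.assoc]
  have step: "expectation (\<lambda>\<omega>. poly (hermite_poly (Suc n) vX) (X \<omega>) * poly q (Y \<omega>))
      = expectation (\<lambda>\<omega>. X \<omega> * (poly (hermite_poly n vX) (X \<omega>) * poly q (Y \<omega>)))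
      - vX * expectation (\<lambda>\<omega>. poly (pderiv (hermite_poly n vX)) (X \<omega>) * poly q (Y \<omega>))"
  proof (cases n)
    case 0
    then show ?thesis by simp
  next
    case (Suc k)
    have "expectation (\<lambda>\<omega>. poly (hermite_poly (Suc n) vX) (X \<omega>) * poly q (Y \<omega>))
      = expectation (\<lambda>\<omega>. X \<omega> * (poly (hermite_poly n vX) (X \<omega>) * poly q (Y \<omega>))
          - vX * (poly (pderiv (hermite_poly n vX)) (X \<omega>) * poly q (Y \<omega>)))"
      unfolding Suc pderiv_hermite_poly by (simp add: algebra_simps)
    then show ?thesis by (simp add: int)
  qed
  have "expectation (\<lambda>\<omega>. poly (hermite_poly (Suc n) vX) (X \<omega>) * poly q (Y \<omega>))
      = rho * expectation (\<lambda>\<omega>. poly (hermite_poly n vX) (X \<omega>) * poly (pderiv q) (Y \<omega>))"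
    unfolding step stein_poly by simp
  also have "\<dots> = rho * real (Suc m) * expectation (\<lambda>\<omega>. poly (hermite_poly n vX) (X \<omega>) * poly (hermite_poly m v) (Y \<omega>))"
    unfolding q_def pderiv_hermite_poly
    by (simp add: mult.left_commute[of _ "real (Suc m)"] del: of_nat_Suc)
  finally show ?thesis by (simp add: q_def poly_hermite_poly del: of_nat_Suc)
qed

lemma expectation_hermite:
  "expectation (\<lambda>\<omega>. hermite n vX (X \<omega>) * hermite n v (Y \<omega>)) = fact n * rho ^ n"
proof (induction n)
  case 0
  then show ?case by (simp add: prob_space)
next
  case (Suc n)
  then show ?case unfolding expectation_hermite_Suc by simp
qed

lemma integrable_hermite: "integrable M (\<lambda>\<omega>. hermite n v (X \<omega>) * hermite m w (Y \<omega>))"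
  using integrable_poly2[of 0 "hermite_poly n v" "hermite_poly m w"] by (simp add: poly_hermite_poly)

lemma vX_eq: "vX = expectation (\<lambda>\<omega>. X \<omega> * X \<omega>)" and rho_eq: "rho = expectation (\<lambda>\<omega>. X \<omega> * Y \<omega>)"
  by (simp_all add: vX_def rho_def mom_def power2_eq_square)

end

subsection \<open>Kernels of product form\<close>

context sigma_finite_measure
begin

text \<open>For fixed p the integrand is a product over the coordinates of q, and what remains after
  integrating over q is a product over the coordinates of p. In this way n-fold covariance integrals
  reduce to a single pair.\<close>

lemma nn_integral_PiM_pair_prod:
  fixes F :: "'a \<times> 'a \<Rightarrow> ennreal"
  assumes F [measurable]: "F \<in> borel_measurable (M \<Otimes>\<^sub>M M)"
  shows "(\<integral>\<^sup>+(p, q). (\<Prod>i<n. F (p i, q i)) \<partial>(PiM {..<n::nat} (\<lambda>_. M) \<Otimes>\<^sub>M PiM {..<n} (\<lambda>_. M)))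
    = (\<integral>\<^sup>+z. F z \<partial>(M \<Otimes>\<^sub>M M)) ^ n"
proof -
  interpret P: product_sigma_finite "\<lambda>_::nat. M" by standard
  interpret Q: sigma_finite_measure "PiM {..<n} (\<lambda>_. M)" by (rule P.sigma_finite) simp
  have [measurable]: "(\<lambda>(p, q). \<Prod>i<n. F (p i, q i)) \<in> borel_measurable (PiM {..<n} (\<lambda>_. M) \<Otimes>\<^sub>M PiM {..<n} (\<lambda>_. M))"
    by measurable
  have "(\<integral>\<^sup>+(p, q). (\<Prod>i<n. F (p i, q i)) \<partial>(PiM {..<n} (\<lambda>_. M) \<Otimes>\<^sub>M PiM {..<n} (\<lambda>_. M)))
    = (\<integral>\<^sup>+p. (\<integral>\<^sup>+q. (\<Prod>i<n. F (p i, q i)) \<partial>PiM {..<n} (\<lambda>_. M)) \<partial>PiM {..<n} (\<lambda>_. M))"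
    by (subst Q.nn_integral_fst[symmetric]) simp_all
  also have "\<dots> = (\<integral>\<^sup>+p. (\<Prod>i<n. \<integral>\<^sup>+y. F (p i, y) \<partial>M) \<partial>PiM {..<n} (\<lambda>_. M))"
  proof (rule nn_integral_cong)
    fix p assume "p \<in> space (PiM {..<n} (\<lambda>_. M))"
    then have "p i \<in> space M" if "i < n" for i using that by (auto simp: space_PiM PiE_def)
    then show "(\<integral>\<^sup>+q. (\<Prod>i<n. F (p i, q i)) \<partial>PiM {..<n} (\<lambda>_. M)) = (\<Prod>i<n. \<integral>\<^sup>+y. F (p i, y) \<partial>M)"
      by (intro P.product_nn_integral_prod) auto
  qed
  also have "\<dots> = (\<Prod>i<n. \<integral>\<^sup>+x. (\<integral>\<^sup>+y. F (x, y) \<partial>M) \<partial>M)"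
    by (rule P.product_nn_integral_prod) auto
  also have "\<dots> = (\<integral>\<^sup>+z. F z \<partial>(M \<Otimes>\<^sub>M M)) ^ n"
    by (simp add: nn_integral_fst)
  finally show ?thesis .
qed

text \<open>The assumption \<open>slice\<close> asks for every x, because Fubini would give
  integrable slices only for almost every x while the inner product formula is applied at each
  p.\<close>

lemma integral_PiM_pair_prod:
  fixes F :: "'a \<times> 'a \<Rightarrow> real"
  assumes F: "integrable (M \<Otimes>\<^sub>M M) F" and slice: "\<And>x. x \<in> space M \<Longrightarrow> integrable M (\<lambda>y. F (x, y))"
  shows "integrable (PiM {..<n::nat} (\<lambda>_. M) \<Otimes>\<^sub>M PiM {..<n} (\<lambda>_. M)) (\<lambda>(p, q). \<Prod>i<n. F (p i, q i))"
    and "(LINT (p, q)|(PiM {..<n::nat} (\<lambda>_. M) \<Otimes>\<^sub>M PiM {..<n} (\<lambda>_. M)). (\<Prod>i<n. F (p i, q i)))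
    = (LINT z|(M \<Otimes>\<^sub>M M). F z) ^ n"
proof -
  interpret P: product_sigma_finite "\<lambda>_::nat. M" by standard
  interpret PM: pair_sigma_finite M M by standard
  interpret Q: sigma_finite_measure "PiM {..<n} (\<lambda>_. M)" by (rule P.sigma_finite) simp
  interpret QQ: pair_sigma_finite "PiM {..<n} (\<lambda>_. M)" "PiM {..<n} (\<lambda>_. M)" by standard
  have [measurable]: "F \<in> borel_measurable (M \<Otimes>\<^sub>M M)" using F by simp
  have "(\<integral>\<^sup>+z. norm (case z of (p, q) \<Rightarrow> \<Prod>i<n. F (p i, q i)) \<partial>(PiM {..<n} (\<lambda>_. M) \<Otimes>\<^sub>M PiM {..<n} (\<lambda>_. M)))
    = (\<integral>\<^sup>+(p, q). (\<Prod>i<n. ennreal (norm (F (p i, q i)))) \<partial>(PiM {..<n} (\<lambda>_. M) \<Otimes>\<^sub>M PiM {..<n} (\<lambda>_. M)))"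
    by (intro nn_integral_cong) (auto simp: abs_prod prod_ennreal)
  also have "\<dots> = (\<integral>\<^sup>+z. ennreal (norm (F z)) \<partial>(M \<Otimes>\<^sub>M M)) ^ n"
    by (rule nn_integral_PiM_pair_prod) measurable
  also have "\<dots> < \<infinity>"
    using F by (simp add: integrable_iff_bounded power_less_top_ennreal)
  finally show int: "integrable (PiM {..<n} (\<lambda>_. M) \<Otimes>\<^sub>M PiM {..<n} (\<lambda>_. M)) (\<lambda>(p, q). \<Prod>i<n. F (p i, q i))"
    by (intro integrableI_bounded) measurable
  have "(LINT (p, q)|(PiM {..<n} (\<lambda>_. M) \<Otimes>\<^sub>M PiM {..<n} (\<lambda>_. M)). (\<Prod>i<n. F (p i, q i)))
    = (LINT p|PiM {..<n} (\<lambda>_. M). LINT q|PiM {..<n} (\<lambda>_. M). (\<Prod>i<n. F (p i, q i)))"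
    using QQ.integral_fst'[OF int] by simp
  also have "\<dots> = (LINT p|PiM {..<n} (\<lambda>_. M). (\<Prod>i<n. LINT y|M. F (p i, y)))"
  proof (rule Bochner_Integration.integral_cong)
    fix p assume "p \<in> space (PiM {..<n} (\<lambda>_. M))"
    then have "p i \<in> space M" if "i < n" for i using that by (auto simp: space_PiM PiE_def)
    then show "(LINT q|PiM {..<n} (\<lambda>_. M). (\<Prod>i<n. F (p i, q i))) = (\<Prod>i<n. LINT y|M. F (p i, y))"
      by (intro P.product_integral_prod slice) auto
  qed simp
  also have "\<dots> = (\<Prod>i<n. LINT x|M. LINT y|M. F (x, y))"
    using PM.integrable_fst'[OF F] by (intro P.product_integral_prod) auto
  also have "\<dots> = (LINT z|(M \<Otimes>\<^sub>M M). F z) ^ n"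
    using PM.integral_fst'[OF F] by simp
  finally show "(LINT (p, q)|(PiM {..<n::nat} (\<lambda>_. M) \<Otimes>\<^sub>M PiM {..<n} (\<lambda>_. M)). (\<Prod>i<n. F (p i, q i)))
    = (LINT z|(M \<Otimes>\<^sub>M M). F z) ^ n" .
qed

end

subsection \<open>Gaussian regularization of a covariance function\<close>

text \<open>Raise y \<le> exp y, for y = x / n, to the n-th power.\<close>

lemma power_le_exp:
  fixes x :: real
  assumes "x \<ge> 0"
  shows "x ^ n \<le> real n ^ n * exp x"
proof (cases "n = 0")
  case False
  have "x / real n \<le> exp (x / real n)" using exp_ge_add_one_self[of "x / real n"] by linarith
  then have "(x / real n) ^ n \<le> exp (x / real n) ^ n"
    using assms by (intro power_mono) auto
  also have "\<dots> = exp x" using False by (simp add: exp_of_nat_mult[symmetric])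
  finally show ?thesis using False by (simp add: power_divide field_simps)
qed (use assms in simp)

lemma normal_density_has_derivative:
  assumes "\<sigma> > 0"
  shows "(normal_density m \<sigma> has_real_derivative (- (x - m) / \<sigma>\<^sup>2 * normal_density m \<sigma> x)) (at x)"
  unfolding normal_density_def
  by (rule derivative_eq_intros refl | use assms in \<open>simp add: field_simps power2_eq_square\<close>)+

text \<open>Polynomial multiples of the density are closed under differentiation.\<close>

lemma iter_dir_deriv_normal_density:
  assumes "\<sigma> > 0"
  shows "\<exists>P. iter_dir_deriv vs (\<lambda>x. complex_of_real (normal_density m \<sigma> x))
    = (\<lambda>x. of_real (poly P x * normal_density m \<sigma> x))"
proof (induction vs)
  case Nil
  show ?case by (rule exI[of _ 1]) (simp add: iter_dir_deriv_def)
next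
  case (Cons v vs)
  then obtain P where P: "iter_dir_deriv vs (\<lambda>x. complex_of_real (normal_density m \<sigma> x))
    = (\<lambda>x. of_real (poly P x * normal_density m \<sigma> x))" by blast
  define Q where "Q = smult v (pderiv P - smult (1 / \<sigma>\<^sup>2) ([:-m, 1:] * P))"
  have "((\<lambda>x. poly P x * normal_density m \<sigma> x) has_real_derivative
      (poly (pderiv P) x * normal_density m \<sigma> x + - (x - m) / \<sigma>\<^sup>2 * normal_density m \<sigma> x * poly P x)) (at x)" for x
    by (rule DERIV_mult poly_DERIV normal_density_has_derivative assms)+
  then have "((\<lambda>x. complex_of_real (poly P x * normal_density m \<sigma> x)) has_derivative
      (\<lambda>h. of_real (h * (poly (pderiv P) x * normal_density m \<sigma> x + - (x - m) / \<sigma>\<^sup>2 * normal_density m \<sigma> x * poly P x)))) (at x)" for x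
    by (intro has_derivative_of_real) (simp add: has_field_derivative_def mult_commute_abs)
  note d = frechet_derivative_at[OF this, symmetric]
  have "iter_dir_deriv (v # vs) (\<lambda>x. complex_of_real (normal_density m \<sigma> x))
      = (\<lambda>x. frechet_derivative (iter_dir_deriv vs (\<lambda>x. complex_of_real (normal_density m \<sigma> x))) (at x) v)"
    by (simp add: iter_dir_deriv_def)
  also have "\<dots> = (\<lambda>x. of_real (poly Q x * normal_density m \<sigma> x))"
    unfolding P d by (rule ext, rule arg_cong[of _ _ of_real]) (simp add: Q_def algebra_simps diff_divide_distrib)
  finally have "iter_dir_deriv (v # vs) (\<lambda>x. complex_of_real (normal_density m \<sigma> x)) = (\<lambda>x. of_real (poly Q x * normal_density m \<sigma> x))" .
  then show ?case by blast
qed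

text \<open>The power is at most a multiple of exp |x|, and the inequality between arithmetic and
  geometric mean absorbs |x| into the quadratic exponent of the density up to a constant.\<close>

lemma monomial_normal_density_bound:
  assumes "\<sigma> > 0"
  obtains B where "\<And>x. \<bar>x\<bar> ^ k * normal_density m \<sigma> x \<le> B"
proof
  fix x :: real
  have "a * b \<le> a\<^sup>2 / 2 + b * b / 2" for a b :: real
    using zero_le_power2[of "a - b"] by (simp add: power2_eq_square algebra_simps)
  from this[of "\<bar>x - m\<bar>" "\<sigma>\<^sup>2"] have "\<bar>x - m\<bar> * \<sigma>\<^sup>2 \<le> (x - m)\<^sup>2 / 2 + \<sigma>\<^sup>2 * \<sigma>\<^sup>2 / 2"
    by simp
  then have "\<bar>x - m\<bar> \<le> (x - m)\<^sup>2 / (2 * \<sigma>\<^sup>2) + \<sigma>\<^sup>2 / 2"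
    using assms by (simp add: field_simps)
  then have le: "\<bar>x\<bar> - (x - m)\<^sup>2 / (2 * \<sigma>\<^sup>2) \<le> \<bar>m\<bar> + \<sigma>\<^sup>2 / 2" by linarith
  have "\<bar>x\<bar> ^ k * normal_density m \<sigma> x \<le> real k ^ k * exp \<bar>x\<bar> * normal_density m \<sigma> x"
    by (intro mult_right_mono power_le_exp) (auto simp: normal_density_nonneg)
  also have "\<dots> = real k ^ k / sqrt (2 * pi * \<sigma>\<^sup>2) * exp (\<bar>x\<bar> - (x - m)\<^sup>2 / (2 * \<sigma>\<^sup>2))"
    by (simp add: normal_density_def exp_diff exp_minus field_simps)
  also have "\<dots> \<le> real k ^ k / sqrt (2 * pi * \<sigma>\<^sup>2) * exp (\<bar>m\<bar> + \<sigma>\<^sup>2 / 2)"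
    using le by (intro mult_left_mono) auto
  finally show "\<bar>x\<bar> ^ k * normal_density m \<sigma> x \<le> real k ^ k / sqrt (2 * pi * \<sigma>\<^sup>2) * exp (\<bar>m\<bar> + \<sigma>\<^sup>2 / 2)" .
qed

text \<open>This admits Gaussian densities as test objects in \<open>is_fourier_of_measure\<close>,
  which is the only way in which the spectral measures enter.\<close>

lemma schwartz_normal_density:
  assumes "\<sigma> > 0"
  shows "schwartz (\<lambda>x. complex_of_real (normal_density m \<sigma> x))"
  unfolding schwartz_def smooth_def
proof (intro conjI allI)
  fix vs
  obtain P where P: "iter_dir_deriv vs (\<lambda>x. complex_of_real (normal_density m \<sigma> x))
    = (\<lambda>x. of_real (poly P x * normal_density m \<sigma> x))" using iter_dir_deriv_normal_density[OF assms] by blast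
  have "(\<lambda>x. complex_of_real (poly P x * normal_density m \<sigma> x)) differentiable at x" for x
  proof -
    have "((\<lambda>x. poly P x * normal_density m \<sigma> x) has_real_derivative
      (poly (pderiv P) x * normal_density m \<sigma> x + - (x - m) / \<sigma>\<^sup>2 * normal_density m \<sigma> x * poly P x)) (at x)"
      by (rule DERIV_mult poly_DERIV normal_density_has_derivative assms)+
    then show ?thesis
      unfolding has_field_derivative_def by (intro differentiableI[OF has_derivative_of_real])
  qed
  then show "iter_dir_deriv vs (\<lambda>x. complex_of_real (normal_density m \<sigma> x)) differentiable_on UNIV"
    unfolding P by (simp add: differentiable_on_def)
  fix k :: nat
  have "\<exists>B. \<forall>x. \<bar>x\<bar> ^ j * normal_density m \<sigma> x \<le> B" for j
    using monomial_normal_density_bound[OF assms] by metis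
  then obtain B where B: "\<And>j x. \<bar>x\<bar> ^ j * normal_density m \<sigma> x \<le> B j" by metis
  have "norm (\<bar>x\<bar> ^ k *\<^sub>R complex_of_real (poly P x * normal_density m \<sigma> x)) \<le> (\<Sum>i\<le>degree P. \<bar>coeff P i\<bar> * B (k + i))" for x
  proof -
    have "norm (\<bar>x\<bar> ^ k *\<^sub>R complex_of_real (poly P x * normal_density m \<sigma> x)) = \<bar>x\<bar> ^ k * \<bar>poly P x\<bar> * normal_density m \<sigma> x"
      by (simp add: abs_mult normal_density_nonneg norm_mult)
    also have "\<dots> \<le> \<bar>x\<bar> ^ k * (\<Sum>i\<le>degree P. \<bar>coeff P i\<bar> * \<bar>x\<bar> ^ i) * normal_density m \<sigma> x"
      unfolding poly_altdef
      by (intro mult_right_mono mult_left_mono order_trans[OF sum_abs] sum_mono)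
         (auto simp: abs_mult power_abs normal_density_nonneg)
    also have "\<dots> = (\<Sum>i\<le>degree P. \<bar>coeff P i\<bar> * (\<bar>x\<bar> ^ (k + i) * normal_density m \<sigma> x))"
      by (simp add: sum_distrib_left sum_distrib_right power_add algebra_simps)
    also have "\<dots> \<le> (\<Sum>i\<le>degree P. \<bar>coeff P i\<bar> * B (k + i))"
      by (intro sum_mono mult_left_mono B) auto
    finally show ?thesis .
  qed
  then show "bounded (range (\<lambda>x. \<bar>x\<bar> ^ k *\<^sub>R iter_dir_deriv vs (\<lambda>x. complex_of_real (normal_density m \<sigma> x)) x))"
    unfolding P bounded_iff by blast
qed

text \<open>The substitution x = t + \<sigma> y leaves the phase of the shift by t and the
  characteristic function of the standard normal law.\<close>

lemma fourier_normal_density: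
  assumes "\<sigma> > 0"
  shows "fourier (\<lambda>x. complex_of_real (normal_density t \<sigma> x)) \<xi>
    = exp (- (\<i> * of_real (\<xi> * t))) * of_real (exp (- (\<sigma>\<^sup>2 * \<xi>\<^sup>2 / 2)))"
proof -
  have std: "normal_density t \<sigma> (t + \<sigma> * y) = std_normal_density y / \<sigma>" for y
    using assms by (simp add: normal_density_def real_sqrt_mult power_mult_distrib)
  have "fourier (\<lambda>x. complex_of_real (normal_density t \<sigma> x)) \<xi>
    = \<bar>\<sigma>\<bar> *\<^sub>R (LINT y|lborel. exp (- (\<i> * of_real (\<xi> * (t + \<sigma> * y)))) * complex_of_real (normal_density t \<sigma> (t + \<sigma> * y)))"
    unfolding fourier_def using assms
    by (intro lborel_integral_real_affine) auto
  also have "\<dots> = (LINT y|lborel. exp (- (\<i> * of_real (\<xi> * t))) * (std_normal_density y *\<^sub>R iexp ((- \<xi> * \<sigma>) * y)))"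
    unfolding std using assms
    by (subst integral_scaleR_right[symmetric])
       (auto intro!: Bochner_Integration.integral_cong simp: scaleR_conv_of_real exp_add[symmetric] algebra_simps simp flip: exp_add)
  also have "\<dots> = exp (- (\<i> * of_real (\<xi> * t))) * (LINT y|lborel. (std_normal_density y *\<^sub>R iexp ((- \<xi> * \<sigma>) * y)))"
    by (rule integral_mult_right_zero)
  also have "(LINT y|lborel. (std_normal_density y *\<^sub>R iexp ((- \<xi> * \<sigma>) * y))) = char std_normal_distribution (- \<xi> * \<sigma>)"
    unfolding char_def by (subst integral_density) (auto simp: normal_density_nonneg)
  also have "\<dots> = of_real (exp (- (\<sigma>\<^sup>2 * \<xi>\<^sup>2 / 2)))"
    unfolding char_std_normal_distribution by (simp add: power_mult_distrib algebra_simps)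
  finally show ?thesis .
qed

lemma tempered_measure_integrable_gaussian:
  assumes "tempered_measure \<nu>" "\<sigma> > 0"
  shows "integrable \<nu> (\<lambda>\<xi>. exp (- (\<sigma>\<^sup>2 * \<xi>\<^sup>2 / 2)))"
proof -
  from assms(1) obtain k where s [measurable_cong]: "sets \<nu> = sets borel"
    and k: "(\<integral>\<^sup>+\<xi>. ennreal (1 / (1 + \<xi>\<^sup>2) ^ k) \<partial>\<nu>) < \<infinity>"
    unfolding tempered_measure_def by auto
  \<comment> \<open>The constant is what \<open>power_le_exp\<close> gives for the argument
    \<open>(1 + \<xi>\<^sup>2) * (\<sigma>\<^sup>2 / 2)\<close>.\<close>
  define C where "C = real k ^ k * exp (\<sigma>\<^sup>2 / 2) / (\<sigma>\<^sup>2 / 2) ^ k"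
  have le: "exp (- (\<sigma>\<^sup>2 * \<xi>\<^sup>2 / 2)) \<le> C * (1 / (1 + \<xi>\<^sup>2) ^ k)" for \<xi>
  proof -
    have p: "0 < 1 + \<xi>\<^sup>2" by (smt (verit) zero_le_power2)
    have e: "exp ((1 + \<xi>\<^sup>2) * (\<sigma>\<^sup>2 / 2)) = exp (\<sigma>\<^sup>2 / 2) * exp (\<sigma>\<^sup>2 * \<xi>\<^sup>2 / 2)"
      by (simp add: exp_add[symmetric] algebra_simps)
    have "((1 + \<xi>\<^sup>2) * (\<sigma>\<^sup>2 / 2)) ^ k \<le> real k ^ k * exp ((1 + \<xi>\<^sup>2) * (\<sigma>\<^sup>2 / 2))"
      by (intro power_le_exp) auto
    then have "(1 + \<xi>\<^sup>2) ^ k * (\<sigma>\<^sup>2 / 2) ^ k \<le> real k ^ k * (exp (\<sigma>\<^sup>2 / 2) * exp (\<sigma>\<^sup>2 * \<xi>\<^sup>2 / 2))"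
      unfolding e power_mult_distrib .
    moreover have "a * b \<le> c * (d * e) \<Longrightarrow> 0 < a \<Longrightarrow> 0 < b \<Longrightarrow> 0 < e \<Longrightarrow> inverse e \<le> c * d / b * (1 / a)" for a b c d e :: real
      by (simp add: field_simps)
    ultimately show ?thesis
      unfolding C_def exp_minus using p assms(2) by simp
  qed
  have "integrable \<nu> (\<lambda>\<xi>. 1 / (1 + \<xi>\<^sup>2) ^ k)"
    using k by (intro integrableI_bounded) auto
  then have "integrable \<nu> (\<lambda>\<xi>. C * (1 / (1 + \<xi>\<^sup>2) ^ k))" by (rule integrable_mult_right)
  then show ?thesis
  proof (rule Bochner_Integration.integrable_bound)
    have "norm (exp (- (\<sigma>\<^sup>2 * \<xi>\<^sup>2 / 2))) \<le> norm (C * (1 / (1 + \<xi>\<^sup>2) ^ k))" for \<xi>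
      using order_trans[OF le[of \<xi>] abs_ge_self] by (simp only: real_norm_def abs_exp_cancel)
    then show "AE \<xi> in \<nu>. norm (exp (- (\<sigma>\<^sup>2 * \<xi>\<^sup>2 / 2))) \<le> norm (C * (1 / (1 + \<xi>\<^sup>2) ^ k))"
      by (rule AE_I2)
  qed measurable
qed

text \<open>Half of the exponent gives smallness through exp (- a) \<le> 1 / a, and the other half
  is at least the exponent of the density with standard deviation 1. Dividing by the normalization e
  leaves one power of e, so away from v the narrow density is a vanishing multiple of a fixed
  one.\<close>

lemma normal_density_concentration:
  assumes "0 < e" "e\<^sup>2 \<le> 1 / 2" "\<delta> > 0" "\<delta> \<le> \<bar>x - v\<bar>"
  shows "normal_density v e x \<le> 4 * e / \<delta>\<^sup>2 * normal_density v 1 x"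
proof -
  define y where "y = x - v"
  have y: "\<delta>\<^sup>2 \<le> y\<^sup>2" using assms by (simp add: y_def abs_le_square_iff[symmetric])
  have d: "\<delta>\<^sup>2 > 0" using assms by simp
  have "y\<^sup>2 / (4 * e\<^sup>2) \<le> exp (y\<^sup>2 / (4 * e\<^sup>2))" using exp_ge_add_one_self[of "y\<^sup>2 / (4 * e\<^sup>2)"] by linarith
  moreover have "\<delta>\<^sup>2 / (4 * e\<^sup>2) \<le> y\<^sup>2 / (4 * e\<^sup>2)" using y assms by (simp add: divide_right_mono)
  ultimately have "\<delta>\<^sup>2 / (4 * e\<^sup>2) \<le> exp (y\<^sup>2 / (4 * e\<^sup>2))" by simp
  then have 1: "exp (- (y\<^sup>2 / (4 * e\<^sup>2))) \<le> 4 * e\<^sup>2 / \<delta>\<^sup>2"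
    using assms d by (simp add: exp_minus field_simps)
  have "y\<^sup>2 * (2 * e\<^sup>2) \<le> y\<^sup>2 * 1" using assms(2) by (intro mult_left_mono) auto
  then have 2: "exp (- (y\<^sup>2 / (4 * e\<^sup>2))) \<le> exp (- (y\<^sup>2 / 2))"
    using assms by (simp add: field_simps)
  have "y\<^sup>2 / (2 * e\<^sup>2) = y\<^sup>2 / (4 * e\<^sup>2) + y\<^sup>2 / (4 * e\<^sup>2)" using assms by (simp add: field_simps)
  then have "exp (- (y\<^sup>2 / (2 * e\<^sup>2))) = exp (- (y\<^sup>2 / (4 * e\<^sup>2))) * exp (- (y\<^sup>2 / (4 * e\<^sup>2)))"
    by (simp add: exp_add[symmetric])
  also have "\<dots> \<le> (4 * e\<^sup>2 / \<delta>\<^sup>2) * exp (- (y\<^sup>2 / 2))"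
    using 1 2 by (intro mult_mono) auto
  finally have "exp (- (y\<^sup>2 / (2 * e\<^sup>2))) / (sqrt (2 * pi) * e) \<le> (4 * e\<^sup>2 / \<delta>\<^sup>2) * exp (- (y\<^sup>2 / 2)) / (sqrt (2 * pi) * e)"
    using assms by (intro divide_right_mono) auto
  then show ?thesis
    using assms by (simp add: normal_density_def y_def[symmetric] real_sqrt_mult power2_eq_square[of e] field_simps)
qed


section \<open>Spectral formula and convergence of a smoothed covariance function\<close>

locale covariance_spectrum =
  fixes \<gamma> :: "real \<Rightarrow> ennreal" and \<nu> :: "real measure"
  assumes cov: "covariance_function \<gamma>"
    and temp: "tempered_measure \<nu>"
    and four: "is_fourier_of_measure \<gamma> \<nu>"
begin

abbreviation g :: "real \<Rightarrow> real" where "g x \<equiv> enn2real (\<gamma> x)"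

definition smooth_g :: "real \<Rightarrow> real \<Rightarrow> real"
  where "smooth_g \<sigma> t = (LINT x|lborel. g x * normal_density t \<sigma> x)"

lemma sets_\<nu> [measurable_cong]: "sets \<nu> = sets borel"
  using temp by (simp add: tempered_measure_def)

lemma gamma_measurable [measurable]: "\<gamma> \<in> borel_measurable borel"
  using cov by (intro borel_measurable_continuous_onI) (simp add: covariance_function_def)

text \<open>A covariance function is assumed only locally integrable; integrability on the whole
  line against Gaussian densities is part of the Fourier identity.\<close>

lemma integrable_g_normal:
  assumes "\<sigma> > 0"
  shows "integrable lborel (\<lambda>x. g x * normal_density t \<sigma> x)"
proof -
  have "integrable lborel (\<lambda>x. of_real (g x) * complex_of_real (normal_density t \<sigma> x))"
    using four schwartz_normal_density[OF assms, of t] unfolding is_fourier_of_measure_def by blast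
  then have "integrable lborel (\<lambda>x. complex_of_real (g x * normal_density t \<sigma> x))" by simp
  from integrable_Re[OF this] show ?thesis by simp
qed

text \<open>The smoothed function is the distribution tested on a shifted Gaussian. As the result is
  real, only the cosine part of the phase remains.\<close>

lemma smooth_g_spectral:
  assumes "\<sigma> > 0"
  shows "smooth_g \<sigma> t = (LINT \<xi>|\<nu>. cos (\<xi> * t) * exp (- (\<sigma>\<^sup>2 * \<xi>\<^sup>2 / 2)))"
proof -
  have "complex_of_real (smooth_g \<sigma> t) = (LINT x|lborel. of_real (g x) * complex_of_real (normal_density t \<sigma> x))"
    unfolding smooth_g_def by (subst integral_complex_of_real[symmetric]) simp
  also have "\<dots> = (LINT \<xi>|\<nu>. exp (- (\<i> * of_real (\<xi> * t))) * of_real (exp (- (\<sigma>\<^sup>2 * \<xi>\<^sup>2 / 2))))"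
    using four schwartz_normal_density[OF assms, of t]
    unfolding is_fourier_of_measure_def fourier_normal_density[OF assms, symmetric] by blast
  finally have "smooth_g \<sigma> t = Re (LINT \<xi>|\<nu>. exp (- (\<i> * of_real (\<xi> * t))) * of_real (exp (- (\<sigma>\<^sup>2 * \<xi>\<^sup>2 / 2))))"
    by (metis Re_complex_of_real)
  also have "\<dots> = (LINT \<xi>|\<nu>. Re (exp (- (\<i> * of_real (\<xi> * t))) * of_real (exp (- (\<sigma>\<^sup>2 * \<xi>\<^sup>2 / 2)))))"
  proof (rule integral_Re[symmetric])
    show "integrable \<nu> (\<lambda>\<xi>. exp (- (\<i> * of_real (\<xi> * t))) * complex_of_real (exp (- (\<sigma>\<^sup>2 * \<xi>\<^sup>2 / 2))))"
      by (rule Bochner_Integration.integrable_bound[OF tempered_measure_integrable_gaussian[OF temp assms]])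
         (auto simp: norm_mult)
  qed
  also have "\<dots> = (LINT \<xi>|\<nu>. cos (\<xi> * t) * exp (- (\<sigma>\<^sup>2 * \<xi>\<^sup>2 / 2)))"
    by (simp add: Re_exp)
  finally show ?thesis .
qed

lemma integrable_gaussian_\<nu>: "\<sigma> > 0 \<Longrightarrow> integrable \<nu> (\<lambda>\<xi>. exp (- (\<sigma>\<^sup>2 * \<xi>\<^sup>2 / 2)))"
  by (rule tempered_measure_integrable_gaussian[OF temp])

lemma smooth_g_nonneg: "0 \<le> smooth_g \<sigma> t"
  unfolding smooth_g_def by (intro integral_nonneg_AE AE_I2) (simp add: normal_density_nonneg)

lemma normal_density_measurable2 [measurable]: "(\<lambda>(t, x). normal_density t \<sigma> x) \<in> borel_measurable (borel \<Otimes>\<^sub>M borel)"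
  unfolding normal_density_def by measurable

lemma smooth_g_measurable [measurable]: "smooth_g \<sigma> \<in> borel_measurable borel"
  unfolding smooth_g_def by measurable

text \<open>An approximate identity at a point of continuity: near v the oscillation of
  \<open>g\<close> is small, and away from v the narrow densities are small multiples of one density
  against which \<open>g\<close> is integrable.\<close>

lemma smooth_g_tendsto:
  assumes "v \<noteq> 0"
  shows "(\<lambda>n. smooth_g (1 / real (n + 2)) v) \<longlonglongrightarrow> g v"
proof (rule LIMSEQ_I)
  have fin: "\<gamma> v < \<infinity>" using cov assms by (simp add: covariance_function_def)
  have "isCont \<gamma> v" using cov unfolding covariance_function_def by (metis continuous_on_eq_continuous_at open_UNIV UNIV_I)
  then have "(g \<longlongrightarrow> g v) (at v)"
    using fin unfolding isCont_def by (intro tendsto_enn2real) (auto simp: ennreal_enn2real_if)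
  then have cont: "isCont g v" by (simp add: isCont_def)
  define K where "K = (LINT x|lborel. \<bar>g x - g v\<bar> * normal_density v 1 x)"
  have int: "integrable lborel (\<lambda>x. (g x - g v) * normal_density v \<sigma> x)" if "\<sigma> > 0" for \<sigma>
    using that integrable_g_normal[of \<sigma> v] by (simp add: left_diff_distrib)
  have intK: "integrable lborel (\<lambda>x. \<bar>g x - g v\<bar> * normal_density v 1 x)"
    using integrable_abs[OF int[of 1]] by (simp add: abs_mult normal_density_nonneg)
  fix r :: real assume r: "0 < r"
  obtain \<delta> where \<delta>: "\<delta> > 0" "\<And>x. \<bar>x - v\<bar> < \<delta> \<Longrightarrow> \<bar>g x - g v\<bar> < r / 2"
    using cont r unfolding continuous_at_eps_delta by (metis half_gt_zero real_norm_def dist_real_def)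
  have bound: "\<bar>smooth_g e v - g v\<bar> \<le> r / 2 + 4 * e / \<delta>\<^sup>2 * K" if e: "0 < e" "e\<^sup>2 \<le> 1 / 2" for e
  proof -
    have "smooth_g e v - g v = (LINT x|lborel. (g x - g v) * normal_density v e x)"
      unfolding smooth_g_def using e integrable_g_normal[of e v]
      by (simp add: left_diff_distrib integral_normal_density)
    also have "\<bar>\<dots>\<bar> \<le> (LINT x|lborel. \<bar>(g x - g v) * normal_density v e x\<bar>)"
      by (rule integral_abs_bound)
    also have "\<dots> \<le> (LINT x|lborel. r / 2 * normal_density v e x + 4 * e / \<delta>\<^sup>2 * (\<bar>g x - g v\<bar> * normal_density v 1 x))"
    proof (rule integral_mono)
      show "integrable lborel (\<lambda>x. \<bar>(g x - g v) * normal_density v e x\<bar>)" using int e by auto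
      show "integrable lborel (\<lambda>x. r / 2 * normal_density v e x + 4 * e / \<delta>\<^sup>2 * (\<bar>g x - g v\<bar> * normal_density v 1 x))"
        using intK e by (intro Bochner_Integration.integrable_add integrable_mult_right) auto
      fix x
      show "\<bar>(g x - g v) * normal_density v e x\<bar> \<le> r / 2 * normal_density v e x + 4 * e / \<delta>\<^sup>2 * (\<bar>g x - g v\<bar> * normal_density v 1 x)"
      proof (cases "\<bar>x - v\<bar> < \<delta>")
        case True
        then have "\<bar>g x - g v\<bar> * normal_density v e x \<le> r / 2 * normal_density v e x"
          using \<delta>(2) by (intro mult_right_mono) (auto simp: normal_density_nonneg less_imp_le)
        moreover have "0 \<le> 4 * e / \<delta>\<^sup>2 * (\<bar>g x - g v\<bar> * normal_density v 1 x)"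
          using e by (simp add: normal_density_nonneg)
        ultimately show ?thesis by (simp add: abs_mult normal_density_nonneg)
      next
        case False
        then have "\<bar>g x - g v\<bar> * normal_density v e x \<le> \<bar>g x - g v\<bar> * (4 * e / \<delta>\<^sup>2 * normal_density v 1 x)"
          using e \<delta> by (intro mult_left_mono normal_density_concentration) auto
        moreover have "0 \<le> r / 2 * normal_density v e x" using r by (simp add: normal_density_nonneg)
        moreover have "\<bar>(g x - g v) * normal_density v e x\<bar> = \<bar>g x - g v\<bar> * normal_density v e x"
          by (simp add: abs_mult normal_density_nonneg)
        ultimately show ?thesis by (simp add: mult.left_commute)
      qed
    qed
    also have "\<dots> = r / 2 + 4 * e / \<delta>\<^sup>2 * K"
      using e intK unfolding K_def by (subst Bochner_Integration.integral_add) (auto simp: integral_normal_density)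
    finally show ?thesis .
  qed
  have "(\<lambda>n. 4 * (1 / real (n + 2)) / \<delta>\<^sup>2 * K) \<longlonglongrightarrow> 4 * 0 / \<delta>\<^sup>2 * K"
    by (intro tendsto_intros LIMSEQ_ignore_initial_segment lim_1_over_n) (use \<delta>(1) in simp)
  then have "eventually (\<lambda>n. 4 * (1 / real (n + 2)) / \<delta>\<^sup>2 * K < r / 2) sequentially"
    using r by (intro order_tendstoD(2)) auto
  then obtain N where N: "\<And>n. n \<ge> N \<Longrightarrow> 4 * (1 / real (n + 2)) / \<delta>\<^sup>2 * K < r / 2"
    unfolding eventually_sequentially by blast
  have "norm (smooth_g (1 / real (n + 2)) v - g v) < r" if "n \<ge> N" for n
  proof -
    \<comment> \<open>The shift by 2 ensures that the squared standard deviation is at most 1 / 2,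
      as \<open>normal_density_concentration\<close> requires.\<close>
    have "(real (n + 2))\<^sup>2 \<ge> 2\<^sup>2" by (intro power_mono) auto
    then have "(1 / real (n + 2))\<^sup>2 \<le> 1 / 2" by (simp add: power_divide divide_simps)
    then show ?thesis using bound[of "1 / real (n + 2)"] N[OF that] by simp
  qed
  then show "\<exists>N. \<forall>n\<ge>N. norm (smooth_g (1 / real (n + 2)) v - g v) < r" by blast
qed

end

section \<open>Gaussian-weighted integrals of functions of a difference\<close>

lemma std_normal_minus: "std_normal_density (- x) = std_normal_density x"
  by (simp add: normal_density_def)

text \<open>The difference of two independent standard normal variables is normal with variance
  2.\<close>

lemma nn_integral_std_normal_difference:
  assumes [measurable]: "k \<in> borel_measurable borel"
  shows "(\<integral>\<^sup>+s. \<integral>\<^sup>+t. k (t - s) * ennreal (std_normal_density t) * ennreal (std_normal_density s) \<partial>lborel \<partial>lborel)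
    = (\<integral>\<^sup>+v. k v * ennreal (normal_density 0 (sqrt 2) v) \<partial>lborel)"
proof -
  have conv: "(\<integral>\<^sup>+s. ennreal (std_normal_density (s + v) * std_normal_density s) \<partial>lborel) = normal_density 0 (sqrt 2) v" for v
  proof -
    have "(\<integral>\<^sup>+s. ennreal (std_normal_density (s + v) * std_normal_density s) \<partial>lborel)
      = (\<integral>\<^sup>+s. ennreal (std_normal_density (0 + -1 * s + v) * std_normal_density (0 + -1 * s)) \<partial>lborel)"
      by (subst nn_integral_real_affine[where c = "-1" and t = 0]) auto
    also have "\<dots> = (\<integral>\<^sup>+s. ennreal (std_normal_density (v - s) * std_normal_density s) \<partial>lborel)"
      by (simp add: std_normal_minus)
    also have "\<dots> = normal_density 0 (sqrt 2) v" using conv_std_normal_density by metis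
    finally show ?thesis .
  qed
  have "(\<integral>\<^sup>+s. \<integral>\<^sup>+t. k (t - s) * ennreal (std_normal_density t) * ennreal (std_normal_density s) \<partial>lborel \<partial>lborel)
    = (\<integral>\<^sup>+s. \<integral>\<^sup>+v. k v * ennreal (std_normal_density (s + v) * std_normal_density s) \<partial>lborel \<partial>lborel)"
  proof (rule nn_integral_cong)
    fix s
    have "(\<integral>\<^sup>+t. k (t - s) * ennreal (std_normal_density t) * ennreal (std_normal_density s) \<partial>lborel)
      = (\<integral>\<^sup>+t. k (s + 1 * t - s) * ennreal (std_normal_density (s + 1 * t)) * ennreal (std_normal_density s) \<partial>lborel)"
      by (subst nn_integral_real_affine[where c = 1 and t = s]) auto
    then show "(\<integral>\<^sup>+t. k (t - s) * ennreal (std_normal_density t) * ennreal (std_normal_density s) \<partial>lborel)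
      = (\<integral>\<^sup>+v. k v * ennreal (std_normal_density (s + v) * std_normal_density s) \<partial>lborel)"
      by (simp add: ennreal_mult normal_density_nonneg mult.assoc)
  qed
  also have "\<dots> = (\<integral>\<^sup>+v. \<integral>\<^sup>+s. k v * ennreal (std_normal_density (s + v) * std_normal_density s) \<partial>lborel \<partial>lborel)"
    by (rule lborel_pair.Fubini') (unfold normal_density_def, measurable)
  also have "\<dots> = (\<integral>\<^sup>+v. k v * (\<integral>\<^sup>+s. ennreal (std_normal_density (s + v) * std_normal_density s) \<partial>lborel) \<partial>lborel)"
    by (intro nn_integral_cong nn_integral_cmult) measurable
  finally show ?thesis unfolding conv .
qed

text \<open>The common majorant: it is strictly positive, hence dominates continuous functions on
  compact sets, and its integrals against the covariance and its smoothed versions can be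
  computed.\<close>

definition normal_weight :: "real \<times> real \<Rightarrow> real"
  where "normal_weight p = std_normal_density (fst p) * std_normal_density (snd p)"

lemma normal_weight_pos: "0 < normal_weight p" and normal_weight_nonneg: "0 \<le> normal_weight p"
  by (simp_all add: normal_weight_def normal_density_pos normal_density_nonneg)

lemma normal_weight_measurable [measurable]: "normal_weight \<in> borel_measurable (borel \<Otimes>\<^sub>M borel)"
  "normal_weight \<in> borel_measurable borel"
  unfolding normal_weight_def borel_prod[symmetric] by measurable

text \<open>Under the Gaussian weights the time coordinates are independent of the space
  coordinates, so the integral factors into two of the form treated above.\<close>

lemma nn_integral_normal_weight_difference:
  fixes k l :: "real \<Rightarrow> ennreal"
  assumes [measurable]: "k \<in> borel_measurable borel" "l \<in> borel_measurable borel"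
  shows "(\<integral>\<^sup>+(p, q). k (fst p - fst q) * l (snd p - snd q) * ennreal (normal_weight p) * ennreal (normal_weight q) \<partial>(lborel \<Otimes>\<^sub>M lborel))
    = (\<integral>\<^sup>+v. k v * ennreal (normal_density 0 (sqrt 2) v) \<partial>lborel) * (\<integral>\<^sup>+v. l v * ennreal (normal_density 0 (sqrt 2) v) \<partial>lborel)"
proof -
  let ?n = "\<lambda>x. ennreal (std_normal_density x)"
  have [measurable]: "(\<lambda>(t, s). k (t - s) * ?n t * ?n s) \<in> borel_measurable (borel \<Otimes>\<^sub>M borel)"
    "(\<lambda>(t, s). l (t - s) * ?n t * ?n s) \<in> borel_measurable (borel \<Otimes>\<^sub>M borel)"
    by measurable
  have "(\<integral>\<^sup>+(p, q). k (fst p - fst q) * l (snd p - snd q) * ennreal (normal_weight p) * ennreal (normal_weight q) \<partial>(lborel \<Otimes>\<^sub>M lborel))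
    = (\<integral>\<^sup>+q. \<integral>\<^sup>+p. k (fst p - fst q) * l (snd p - snd q) * ennreal (normal_weight p) * ennreal (normal_weight q) \<partial>lborel \<partial>lborel)"
    by (subst lborel_pair.nn_integral_snd[symmetric]) (simp_all add: lborel_prod[symmetric])
  also have "\<dots> = (\<integral>\<^sup>+q. (\<integral>\<^sup>+t. k (t - fst q) * ?n t * ?n (fst q) \<partial>lborel) * (\<integral>\<^sup>+x. l (x - snd q) * ?n x * ?n (snd q) \<partial>lborel) \<partial>lborel)"
  proof (rule nn_integral_cong)
    fix q :: "real \<times> real"
    have "(\<integral>\<^sup>+p. k (fst p - fst q) * l (snd p - snd q) * ennreal (normal_weight p) * ennreal (normal_weight q) \<partial>lborel)
      = (\<integral>\<^sup>+p. (k (fst p - fst q) * ?n (fst p) * ?n (fst q)) * (l (snd p - snd q) * ?n (snd p) * ?n (snd q)) \<partial>lborel)"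
      by (intro nn_integral_cong) (simp add: normal_weight_def ennreal_mult normal_density_nonneg ac_simps)
    also have "\<dots> = (\<integral>\<^sup>+t. \<integral>\<^sup>+x. (k (t - fst q) * ?n t * ?n (fst q)) * (l (x - snd q) * ?n x * ?n (snd q)) \<partial>lborel \<partial>lborel)"
      unfolding lborel_prod[symmetric] by (subst lborel.nn_integral_fst[symmetric]) simp_all
    also have "\<dots> = (\<integral>\<^sup>+t. (k (t - fst q) * ?n t * ?n (fst q)) * (\<integral>\<^sup>+x. l (x - snd q) * ?n x * ?n (snd q) \<partial>lborel) \<partial>lborel)"
      by (intro nn_integral_cong nn_integral_cmult) measurable
    also have "\<dots> = (\<integral>\<^sup>+t. k (t - fst q) * ?n t * ?n (fst q) \<partial>lborel) * (\<integral>\<^sup>+x. l (x - snd q) * ?n x * ?n (snd q) \<partial>lborel)"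
      by (intro nn_integral_multc) measurable
    finally show "(\<integral>\<^sup>+p. k (fst p - fst q) * l (snd p - snd q) * ennreal (normal_weight p) * ennreal (normal_weight q) \<partial>lborel) = \<dots>" .
  qed
  also have "\<dots> = (\<integral>\<^sup>+s. \<integral>\<^sup>+y. (\<integral>\<^sup>+t. k (t - s) * ?n t * ?n s \<partial>lborel) * (\<integral>\<^sup>+x. l (x - y) * ?n x * ?n y \<partial>lborel) \<partial>lborel \<partial>lborel)"
    unfolding lborel_prod[symmetric] by (subst lborel.nn_integral_fst[symmetric]) simp_all
  also have "\<dots> = (\<integral>\<^sup>+s. (\<integral>\<^sup>+t. k (t - s) * ?n t * ?n s \<partial>lborel) * (\<integral>\<^sup>+y. \<integral>\<^sup>+x. l (x - y) * ?n x * ?n y \<partial>lborel \<partial>lborel) \<partial>lborel)"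
    by (intro nn_integral_cong nn_integral_cmult) measurable
  also have "\<dots> = (\<integral>\<^sup>+s. \<integral>\<^sup>+t. k (t - s) * ?n t * ?n s \<partial>lborel \<partial>lborel) * (\<integral>\<^sup>+y. \<integral>\<^sup>+x. l (x - y) * ?n x * ?n y \<partial>lborel \<partial>lborel)"
    by (intro nn_integral_multc) measurable
  finally show ?thesis by (simp add: nn_integral_std_normal_difference)
qed

section \<open>Gaussian mass of a covariance function and convergence of the smoothed masses\<close>

context covariance_spectrum
begin

definition mass :: ennreal
  where "mass = (\<integral>\<^sup>+v. ennreal (g v) * ennreal (normal_density 0 (sqrt 2) v) \<partial>lborel)"

definition smooth_mass :: "real \<Rightarrow> ennreal"
  where "smooth_mass \<sigma> = (\<integral>\<^sup>+v. ennreal (smooth_g \<sigma> v) * ennreal (normal_density 0 (sqrt 2) v) \<partial>lborel)"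

lemma nn_integral_g_normal:
  assumes "\<sigma> > 0"
  shows "(\<integral>\<^sup>+x. ennreal (g x) * ennreal (normal_density t \<sigma> x) \<partial>lborel) = ennreal (LINT x|lborel. g x * normal_density t \<sigma> x)"
  by (subst nn_integral_eq_integral[OF integrable_g_normal[OF assms], symmetric])
     (auto simp: normal_density_nonneg ennreal_mult)

lemma mass_eq: "mass = ennreal (LINT x|lborel. g x * normal_density 0 (sqrt 2) x)"
  unfolding mass_def by (rule nn_integral_g_normal) simp

text \<open>By Fubini the smoothing is moved from \<open>g\<close> to the Gaussian weight, where it
  only adds variances. The limit of the masses then concerns a family of densities against the fixed
  function \<open>g\<close>.\<close>

lemma smooth_mass_eq:
  assumes "\<sigma> > 0"
  shows "smooth_mass \<sigma> = ennreal (LINT x|lborel. g x * normal_density 0 (sqrt (\<sigma>\<^sup>2 + 2)) x)"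
proof -
  have "smooth_mass \<sigma> = (\<integral>\<^sup>+v. \<integral>\<^sup>+x. ennreal (g x) * ennreal (normal_density v \<sigma> x) * ennreal (normal_density 0 (sqrt 2) v) \<partial>lborel \<partial>lborel)"
    unfolding smooth_mass_def smooth_g_def
    by (subst nn_integral_g_normal[OF assms, symmetric], subst nn_integral_multc) simp_all
  also have "\<dots> = (\<integral>\<^sup>+x. \<integral>\<^sup>+v. ennreal (g x) * ennreal (normal_density v \<sigma> x) * ennreal (normal_density 0 (sqrt 2) v) \<partial>lborel \<partial>lborel)"
    by (rule lborel_pair.Fubini') measurable
  also have "\<dots> = (\<integral>\<^sup>+x. \<integral>\<^sup>+v. ennreal (g x) * ennreal (normal_density 0 \<sigma> (x - v) * normal_density 0 (sqrt 2) v) \<partial>lborel \<partial>lborel)"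
    by (intro nn_integral_cong) (simp add: ennreal_mult normal_density_nonneg mult.assoc, simp add: normal_density_def)
  also have "\<dots> = (\<integral>\<^sup>+x. ennreal (g x) * (\<integral>\<^sup>+v. ennreal (normal_density 0 \<sigma> (x - v) * normal_density 0 (sqrt 2) v) \<partial>lborel) \<partial>lborel)"
    by (intro nn_integral_cong nn_integral_cmult) measurable
  also have "\<dots> = (\<integral>\<^sup>+x. ennreal (g x) * ennreal (normal_density 0 (sqrt (\<sigma>\<^sup>2 + 2)) x) \<partial>lborel)"
    using conv_normal_density_zero_mean[OF assms, of "sqrt 2"] by (simp add: fun_eq_iff)
  also have "\<dots> = ennreal (LINT x|lborel. g x * normal_density 0 (sqrt (\<sigma>\<^sup>2 + 2)) x)"
    using assms by (intro nn_integral_g_normal) (simp add: add_pos_pos)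
  finally show ?thesis .
qed

lemma smooth_mass_tendsto: "(\<lambda>n. smooth_mass (1 / real (n + 2))) \<longlonglongrightarrow> mass"
proof -
  define s where "s n = sqrt ((1 / real (n + 2))\<^sup>2 + 2)" for n
  have "(\<lambda>n. (1 / real (n + 2))\<^sup>2 + 2) \<longlonglongrightarrow> 0\<^sup>2 + 2"
    by (intro tendsto_intros LIMSEQ_ignore_initial_segment lim_1_over_n)
  then have s: "s \<longlonglongrightarrow> sqrt 2" unfolding s_def by (intro tendsto_real_sqrt) simp
  have "(1 / real (n + 2))\<^sup>2 \<le> 1" for n by (simp add: power_divide divide_simps)
  then have le: "sqrt 2 \<le> s n" "s n \<le> sqrt 3" for n unfolding s_def by simp_all
  have pos: "0 < s n" for n using le(1)[of n] by (smt (verit) real_sqrt_gt_0_iff)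
  \<comment> \<open>The variances lie between 2 and 3: the upper bound controls the exponent and the
    lower bound the normalization, which gives a majorant of variance 3 independent of n.\<close>
  have bound: "normal_density 0 (s n) x \<le> sqrt 3 / sqrt 2 * normal_density 0 (sqrt 3) x" for n x
  proof -
    have "2 \<le> (s n)\<^sup>2" "(s n)\<^sup>2 \<le> 3"
      using power_mono[OF le(1)[of n], of 2] power_mono[OF le(2)[of n], of 2] pos[of n] by auto
    then have "x\<^sup>2 / (2 * 3) \<le> x\<^sup>2 / (2 * (s n)\<^sup>2)"
      by (intro divide_left_mono) auto
    then have "exp (- (x\<^sup>2 / (2 * (s n)\<^sup>2))) \<le> exp (- (x\<^sup>2 / (2 * 3)))" by simp
    moreover have "1 / (sqrt (2 * pi) * s n) \<le> 1 / (sqrt (2 * pi) * sqrt 2)"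
      using le(1)[of n] pos[of n] by (intro divide_left_mono mult_left_mono mult_pos_pos) auto
    ultimately have "1 / (sqrt (2 * pi) * s n) * exp (- (x\<^sup>2 / (2 * (s n)\<^sup>2))) \<le> 1 / (sqrt (2 * pi) * sqrt 2) * exp (- (x\<^sup>2 / (2 * 3)))"
      by (intro mult_mono) auto
    also have "\<dots> = sqrt 3 / sqrt 2 * (1 / (sqrt (2 * pi) * sqrt 3) * exp (- (x\<^sup>2 / (2 * 3))))" by simp
    finally show ?thesis
      using pos[of n] real_sqrt_mult[of "2 * pi" 3] real_sqrt_mult[of "2 * pi" "(s n)\<^sup>2"]
      by (simp add: normal_density_def)
  qed
  have "(\<lambda>n. LINT x|lborel. g x * normal_density 0 (s n) x) \<longlonglongrightarrow> (LINT x|lborel. g x * normal_density 0 (sqrt 2) x)"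
  proof (rule integral_dominated_convergence)
    show "integrable lborel (\<lambda>x. sqrt 3 / sqrt 2 * (g x * normal_density 0 (sqrt 3) x))"
      by (intro integrable_mult_right integrable_g_normal) simp
    show "AE x in lborel. (\<lambda>n. g x * normal_density 0 (s n) x) \<longlonglongrightarrow> g x * normal_density 0 (sqrt 2) x"
      unfolding normal_density_def by (intro AE_I2 tendsto_intros s) auto
    show "AE x in lborel. norm (g x * normal_density 0 (s n) x) \<le> sqrt 3 / sqrt 2 * (g x * normal_density 0 (sqrt 3) x)" for n
    proof (rule AE_I2)
      fix x show "norm (g x * normal_density 0 (s n) x) \<le> sqrt 3 / sqrt 2 * (g x * normal_density 0 (sqrt 3) x)"
        using mult_left_mono[OF bound[of n x], of "g x"] by (simp add: abs_mult normal_density_nonneg mult.left_commute)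
    qed
  qed measurable
  then show ?thesis
    unfolding mass_eq by (subst smooth_mass_eq) (auto simp: s_def intro!: tendsto_ennrealI)
qed

end

subsection \<open>Positive kernels\<close>

text \<open>Boundedness makes the quadratic form converge for every integrable k. The noise
  covariance is unbounded near the diagonals and is reached only as a limit of such kernels.\<close>

definition positive_kernel :: "'a measure \<Rightarrow> ('a \<times> 'a \<Rightarrow> real) \<Rightarrow> bool"
  where "positive_kernel M K \<longleftrightarrow> K \<in> borel_measurable (M \<Otimes>\<^sub>M M) \<and> bounded (range K) \<and>
    (\<forall>k. integrable M k \<longrightarrow> 0 \<le> (LINT (p, q)|(M \<Otimes>\<^sub>M M). K (p, q) * (k p * k q)))"

context sigma_finite_measure
begin

lemma integrable_tensor_square:
  fixes k :: "'a \<Rightarrow> real"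
  assumes "integrable M k"
  shows "integrable (M \<Otimes>\<^sub>M M) (\<lambda>(p, q). k p * k q)"
proof -
  interpret P: pair_sigma_finite M M by standard
  show ?thesis
    by (rule P.Fubini_integrable) (use assms in \<open>auto simp: abs_mult\<close>)
qed

lemma integrable_bounded_kernel:
  fixes k :: "'a \<Rightarrow> real"
  assumes "K \<in> borel_measurable (M \<Otimes>\<^sub>M M)" "bounded (range K)" "integrable M k"
  shows "integrable (M \<Otimes>\<^sub>M M) (\<lambda>(p, q). K (p, q) * (k p * k q))"
proof -
  obtain B where B: "\<And>z. \<bar>K z\<bar> \<le> B" using assms(2) unfolding bounded_iff by auto
  have [measurable]: "k \<in> borel_measurable M" using assms(3) by simp
  have "integrable (M \<Otimes>\<^sub>M M) (\<lambda>z. B * (case z of (p, q) \<Rightarrow> k p * k q))"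
    by (intro integrable_mult_right integrable_tensor_square assms)
  then show ?thesis
  proof (rule Bochner_Integration.integrable_bound)
    show "AE z in M \<Otimes>\<^sub>M M. norm (case z of (p, q) \<Rightarrow> K (p, q) * (k p * k q)) \<le> norm (B * (case z of (p, q) \<Rightarrow> k p * k q))"
    proof (rule AE_I2)
      fix z
      have "\<bar>K z\<bar> \<le> \<bar>B\<bar>" using B[of z] by linarith
      then show "norm (case z of (p, q) \<Rightarrow> K (p, q) * (k p * k q)) \<le> norm (B * (case z of (p, q) \<Rightarrow> k p * k q))"
        by (cases z) (auto simp: abs_mult intro: mult_right_mono)
    qed
  qed (use assms(1) in measurable)
qed

lemma positive_kernel_one: "positive_kernel M (\<lambda>_. 1)"
proof -
  interpret P: pair_sigma_finite M M by standard
  have "(LINT (p, q)|(M \<Otimes>\<^sub>M M). k p * k q) = (LINT p|M. k p) * (LINT p|M. k p)" if "integrable M k" for k :: "'a \<Rightarrow> real"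
    using P.integral_fst'[OF integrable_tensor_square[OF that]] by simp
  then show ?thesis by (auto simp: positive_kernel_def bounded_iff intro: exI[of _ 1])
qed

text \<open>The form at k is the sum of the forms of K at k cos \<theta> and at k sin
  \<theta>.\<close>

lemma positive_kernel_cos:
  assumes K: "positive_kernel M K" and [measurable]: "\<theta> \<in> borel_measurable M"
  shows "positive_kernel M (\<lambda>(p, q). K (p, q) * cos (\<theta> p - \<theta> q))"
  unfolding positive_kernel_def
proof (intro conjI allI impI)
  have [measurable]: "K \<in> borel_measurable (M \<Otimes>\<^sub>M M)" and bK: "bounded (range K)"
    using K by (auto simp: positive_kernel_def)
  show "(\<lambda>(p, q). K (p, q) * cos (\<theta> p - \<theta> q)) \<in> borel_measurable (M \<Otimes>\<^sub>M M)" by measurable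
  obtain B where B: "\<And>z. \<bar>K z\<bar> \<le> B" using bK unfolding bounded_iff by auto
  have "\<bar>K (p, q) * cos (\<theta> p - \<theta> q)\<bar> \<le> B" for p q
    using mult_mono[OF B[of "(p, q)"] abs_cos_le_one[of "\<theta> p - \<theta> q"]] B[of "(p, q)"] by (simp add: abs_mult)
  then show "bounded (range (\<lambda>(p, q). K (p, q) * cos (\<theta> p - \<theta> q)))"
    unfolding bounded_iff by (intro exI[of _ B]) auto
  fix k :: "'a \<Rightarrow> real" assume k: "integrable M k"
  then have [measurable]: "k \<in> borel_measurable M" by simp
  have c: "integrable M (\<lambda>p. k p * cos (\<theta> p))" "integrable M (\<lambda>p. k p * sin (\<theta> p))"
    by (rule Bochner_Integration.integrable_bound[OF k]; auto simp: abs_mult intro!: mult_left_le)+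
  have i: "integrable (M \<Otimes>\<^sub>M M) (\<lambda>z. case z of (p, q) \<Rightarrow> K (p, q) * ((k p * cos (\<theta> p)) * (k q * cos (\<theta> q))))"
    "integrable (M \<Otimes>\<^sub>M M) (\<lambda>z. case z of (p, q) \<Rightarrow> K (p, q) * ((k p * sin (\<theta> p)) * (k q * sin (\<theta> q))))"
    by (rule integrable_bounded_kernel[OF _ bK c(1)] integrable_bounded_kernel[OF _ bK c(2)]; measurable)+
  have "(LINT (p, q)|(M \<Otimes>\<^sub>M M). (case (p, q) of (p, q) \<Rightarrow> K (p, q) * cos (\<theta> p - \<theta> q)) * (k p * k q))
    = (LINT z|(M \<Otimes>\<^sub>M M). (case z of (p, q) \<Rightarrow> K (p, q) * ((k p * cos (\<theta> p)) * (k q * cos (\<theta> q))))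
      + (case z of (p, q) \<Rightarrow> K (p, q) * ((k p * sin (\<theta> p)) * (k q * sin (\<theta> q)))))"
    by (intro Bochner_Integration.integral_cong) (auto simp: cos_diff algebra_simps)
  also have "\<dots> \<ge> 0"
    using K c unfolding positive_kernel_def by (subst Bochner_Integration.integral_add[OF i]) (intro add_nonneg_nonneg; blast)
  finally show "0 \<le> (LINT (p, q)|(M \<Otimes>\<^sub>M M). (case (p, q) of (p, q) \<Rightarrow> K (p, q) * cos (\<theta> p - \<theta> q)) * (k p * k q))" .
qed

text \<open>The form is non-negative for each frequency, and finiteness of N allows the integration
  over frequencies to be moved outside.\<close>

lemma positive_kernel_cos_mixture:
  assumes K: "positive_kernel M K" and [measurable]: "\<theta> \<in> borel_measurable M"
    and N: "finite_measure N" and [measurable_cong]: "sets N = sets borel"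
  shows "positive_kernel M (\<lambda>(p, q). K (p, q) * (LINT \<xi>|N. cos (\<xi> * (\<theta> p - \<theta> q))))"
  unfolding positive_kernel_def
proof (intro conjI allI impI)
  interpret N: finite_measure N by fact
  interpret P: pair_sigma_finite M M by standard
  interpret T: pair_sigma_finite "M \<Otimes>\<^sub>M M" N by standard
  have [measurable]: "K \<in> borel_measurable (M \<Otimes>\<^sub>M M)" and bK: "bounded (range K)"
    using K by (auto simp: positive_kernel_def)
  show "(\<lambda>(p, q). K (p, q) * (LINT \<xi>|N. cos (\<xi> * (\<theta> p - \<theta> q)))) \<in> borel_measurable (M \<Otimes>\<^sub>M M)" by measurable
  obtain B where B: "\<And>z. \<bar>K z\<bar> \<le> B" using bK unfolding bounded_iff by auto
  have le: "\<bar>LINT \<xi>|N. cos (\<xi> * a)\<bar> \<le> measure N (space N)" for a :: real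
  proof -
    have "\<bar>LINT \<xi>|N. cos (\<xi> * a)\<bar> \<le> (LINT \<xi>|N. \<bar>cos (\<xi> * a)\<bar>)" by (rule integral_abs_bound)
    also have "\<dots> \<le> (LINT \<xi>|N. 1)"
      by (rule integral_mono) (auto intro!: N.integrable_const_bound[where B = 1])
    finally show ?thesis by simp
  qed
  have "\<bar>K (p, q) * (LINT \<xi>|N. cos (\<xi> * (\<theta> p - \<theta> q)))\<bar> \<le> B * measure N (space N)" for p q
    using mult_mono[OF B[of "(p, q)"] le[of "\<theta> p - \<theta> q"]] order_trans[OF abs_ge_zero B[of "(p, q)"]] by (simp add: abs_mult)
  then show "bounded (range (\<lambda>(p, q). K (p, q) * (LINT \<xi>|N. cos (\<xi> * (\<theta> p - \<theta> q)))))"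
    unfolding bounded_iff by (intro exI[of _ "B * measure N (space N)"]) auto
  fix k :: "'a \<Rightarrow> real" assume k: "integrable M k"
  then have [measurable]: "k \<in> borel_measurable M" by simp
  let ?F = "\<lambda>(p, q) \<xi>. K (p, q) * cos (\<xi> * (\<theta> p - \<theta> q)) * (k p * k q)"
  have meas: "(\<lambda>x. K (fst x) * cos (snd x * (\<theta> (fst (fst x)) - \<theta> (snd (fst x)))) * (k (fst (fst x)) * k (snd (fst x))))
      \<in> borel_measurable ((M \<Otimes>\<^sub>M M) \<Otimes>\<^sub>M N)" by measurable
  have int: "integrable ((M \<Otimes>\<^sub>M M) \<Otimes>\<^sub>M N) (\<lambda>(z, \<xi>). ?F z \<xi>)"
  proof (rule Bochner_Integration.integrable_bound)
    have i: "integrable (M \<Otimes>\<^sub>M M) (\<lambda>(p, q). K (p, q) * (k p * k q))"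
      by (rule integrable_bounded_kernel[OF _ bK k]) measurable
    show "integrable ((M \<Otimes>\<^sub>M M) \<Otimes>\<^sub>M N) (\<lambda>(z, \<xi>). (\<lambda>(p, q). K (p, q) * (k p * k q)) z)"
      by (rule T.Fubini_integrable) (use i in \<open>auto intro!: integrable_mult_left\<close>)
    show "AE x in (M \<Otimes>\<^sub>M M) \<Otimes>\<^sub>M N. norm (case x of (z, \<xi>) \<Rightarrow> ?F z \<xi>) \<le> norm (case x of (z, \<xi>) \<Rightarrow> (\<lambda>(p, q). K (p, q) * (k p * k q)) z)"
    proof (rule AE_I2)
      fix x :: "('a \<times> 'a) \<times> real"
      obtain p q \<xi> where x: "x = ((p, q), \<xi>)" by (metis prod.exhaust)
      have "\<bar>K (p, q)\<bar> * \<bar>cos (\<xi> * (\<theta> p - \<theta> q))\<bar> \<le> \<bar>K (p, q)\<bar>" by (intro mult_left_le) auto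
      then show "norm (case x of (z, \<xi>) \<Rightarrow> ?F z \<xi>) \<le> norm (case x of (z, \<xi>) \<Rightarrow> (\<lambda>(p, q). K (p, q) * (k p * k q)) z)"
        by (auto simp: x abs_mult mult.assoc[symmetric] intro!: mult_right_mono)
    qed
  qed (use meas in \<open>simp add: case_prod_unfold\<close>)
  have "(LINT (p, q)|(M \<Otimes>\<^sub>M M). (case (p, q) of (p, q) \<Rightarrow> K (p, q) * (LINT \<xi>|N. cos (\<xi> * (\<theta> p - \<theta> q)))) * (k p * k q))
    = (LINT z|(M \<Otimes>\<^sub>M M). LINT \<xi>|N. ?F z \<xi>)"
    by (intro Bochner_Integration.integral_cong) (auto simp: algebra_simps)
  also have "\<dots> = (LINT \<xi>|N. LINT z|(M \<Otimes>\<^sub>M M). ?F z \<xi>)"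
    using T.Fubini_integral[OF int] by simp
  also have "\<dots> \<ge> 0"
  proof (rule integral_nonneg_AE, rule AE_I2)
    fix \<xi>
    have "positive_kernel M (\<lambda>(p, q). K (p, q) * cos ((\<lambda>p. \<xi> * \<theta> p) p - (\<lambda>p. \<xi> * \<theta> p) q))"
      by (rule positive_kernel_cos[OF K]) measurable
    with k have "0 \<le> (LINT (p, q)|(M \<Otimes>\<^sub>M M). (case (p, q) of (p, q) \<Rightarrow> K (p, q) * cos (\<xi> * \<theta> p - \<xi> * \<theta> q)) * (k p * k q))"
      unfolding positive_kernel_def by blast
    then show "0 \<le> (LINT z|(M \<Otimes>\<^sub>M M). (case z of (p, q) \<Rightarrow> \<lambda>\<xi>. K (p, q) * cos (\<xi> * (\<theta> p - \<theta> q)) * (k p * k q)) \<xi>)"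
      by (simp add: case_prod_unfold right_diff_distrib)
  qed
  finally show "0 \<le> (LINT (p, q)|(M \<Otimes>\<^sub>M M). (case (p, q) of (p, q) \<Rightarrow> K (p, q) * (LINT \<xi>|N. cos (\<xi> * (\<theta> p - \<theta> q)))) * (k p * k q))" .
qed

end

context covariance_spectrum
begin

lemma positive_kernel_smooth_g:
  assumes "sigma_finite_measure M" "positive_kernel M K" "\<theta> \<in> borel_measurable M" "\<sigma> > 0"
  shows "positive_kernel M (\<lambda>(p, q). K (p, q) * smooth_g \<sigma> (\<theta> p - \<theta> q))"
proof -
  interpret sigma_finite_measure M by fact
  \<comment> \<open>The Gaussian factor in \<open>smooth_g_spectral\<close> is absorbed into the
    measure, which becomes finite.\<close>
  define N where "N = density \<nu> (\<lambda>\<xi>. ennreal (exp (- (\<sigma>\<^sup>2 * \<xi>\<^sup>2 / 2))))"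
  have "emeasure N (space N) = (\<integral>\<^sup>+\<xi>. ennreal (exp (- (\<sigma>\<^sup>2 * \<xi>\<^sup>2 / 2))) \<partial>\<nu>)"
    unfolding N_def by (simp add: emeasure_density)
  also have "\<dots> < \<infinity>" using integrable_gaussian_\<nu>[OF assms(4)] by (simp add: integrable_iff_bounded)
  finally have "finite_measure N" by (intro finite_measureI) auto
  moreover have "sets N = sets borel" by (simp add: N_def sets_\<nu>)
  ultimately have "positive_kernel M (\<lambda>(p, q). K (p, q) * (LINT \<xi>|N. cos (\<xi> * (\<theta> p - \<theta> q))))"
    by (rule positive_kernel_cos_mixture[OF assms(2,3)])
  moreover have "(LINT \<xi>|N. cos (\<xi> * a)) = smooth_g \<sigma> a" for a
    unfolding N_def smooth_g_spectral[OF assms(4)] by (subst integral_density) (auto simp: mult.commute)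
  ultimately show ?thesis by simp
qed

end

subsection \<open>Non-negativity of the norm of the noise\<close>

text \<open>A class of kernels closed under linear combinations on which \<open>norm2_H\<close>
  converges absolutely; tensors of test functions and the symmetrized derivative kernels belong to
  it.\<close>

definition gaussian_dominated :: "nat \<Rightarrow> ((nat \<Rightarrow> real \<times> real) \<Rightarrow> real) \<Rightarrow> bool"
  where "gaussian_dominated n k \<longleftrightarrow> k \<in> borel_measurable (pairs_measure n) \<and>
    (\<exists>C. \<forall>p\<in>space (pairs_measure n). \<bar>k p\<bar> \<le> C * (\<Prod>i<n. normal_weight (p i)))"

lemma gaussian_dominated_measurable: "gaussian_dominated n k \<Longrightarrow> k \<in> borel_measurable (pairs_measure n)"
  by (simp add: gaussian_dominated_def)

lemma gaussian_dominated_linear: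
  assumes "gaussian_dominated n a" "gaussian_dominated n b"
  shows "gaussian_dominated n (\<lambda>p. c * a p + d * b p)"
proof -
  obtain A B where AB: "\<And>p. p \<in> space (pairs_measure n) \<Longrightarrow> \<bar>a p\<bar> \<le> A * (\<Prod>i<n. normal_weight (p i))"
    "\<And>p. p \<in> space (pairs_measure n) \<Longrightarrow> \<bar>b p\<bar> \<le> B * (\<Prod>i<n. normal_weight (p i))"
    using assms unfolding gaussian_dominated_def by blast
  have "\<bar>c * a p + d * b p\<bar> \<le> (\<bar>c\<bar> * A + \<bar>d\<bar> * B) * (\<Prod>i<n. normal_weight (p i))" if "p \<in> space (pairs_measure n)" for p
  proof -
    have "\<bar>c * a p + d * b p\<bar> \<le> \<bar>c\<bar> * \<bar>a p\<bar> + \<bar>d\<bar> * \<bar>b p\<bar>" by (metis abs_mult abs_triangle_ineq)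
    also have "\<dots> \<le> \<bar>c\<bar> * (A * (\<Prod>i<n. normal_weight (p i))) + \<bar>d\<bar> * (B * (\<Prod>i<n. normal_weight (p i)))"
      using AB[OF that] by (intro add_mono mult_left_mono) auto
    finally show ?thesis by (simp add: algebra_simps)
  qed
  moreover have "(\<lambda>p. c * a p + d * b p) \<in> borel_measurable (pairs_measure n)"
    using assms unfolding gaussian_dominated_def by auto
  ultimately show ?thesis
    unfolding gaussian_dominated_def by (intro conjI exI[of _ "\<bar>c\<bar> * A + \<bar>d\<bar> * B"]) auto
qed

lemma gaussian_dominated_diff:
  assumes "gaussian_dominated n a" "gaussian_dominated n b"
  shows "gaussian_dominated n (\<lambda>p. a p - b p)"
  using gaussian_dominated_linear[OF assms, of 1 "-1"] by simp

section \<open>The product covariance in time and space and its smoothed versions\<close>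

locale noise_spectrum = G: covariance_spectrum \<gamma> \<nu> + F: covariance_spectrum f \<mu>
  for \<gamma> \<nu> f \<mu>
begin

definition cov :: "(real \<times> real) \<times> (real \<times> real) \<Rightarrow> real"
  where "cov z = G.g (fst (fst z) - fst (snd z)) * F.g (snd (fst z) - snd (snd z))"

definition smooth_cov :: "real \<Rightarrow> (real \<times> real) \<times> (real \<times> real) \<Rightarrow> real"
  where "smooth_cov e z = G.smooth_g e (fst (fst z) - fst (snd z)) * F.smooth_g e (snd (fst z) - snd (snd z))"

lemma enn2real_noise_cov: "enn2real (noise_cov \<gamma> f p q) = cov (p, q)"
  by (simp add: noise_cov_def cov_def enn2real_mult)

lemma cov_nonneg: "0 \<le> cov z" and smooth_cov_nonneg: "0 \<le> smooth_cov e z"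
  by (simp_all add: cov_def smooth_cov_def G.smooth_g_nonneg F.smooth_g_nonneg)

lemma cov_measurable [measurable]: "cov \<in> borel_measurable (lborel \<Otimes>\<^sub>M lborel)"
  and smooth_cov_measurable [measurable]: "smooth_cov e \<in> borel_measurable (lborel \<Otimes>\<^sub>M lborel)"
  unfolding cov_def smooth_cov_def lborel_prod[symmetric] by measurable

lemma norm2_H_eq: "norm2_H \<gamma> f n k = (LINT (p, q)|(pairs_measure n \<Otimes>\<^sub>M pairs_measure n). (\<Prod>i<n. cov (p i, q i)) * (k p * k q))"
  unfolding norm2_H_def enn2real_noise_cov by (simp add: mult.assoc)

lemma nn_integral_cov_weight:
  "(\<integral>\<^sup>+(p, q). (\<Prod>i<n. ennreal (cov (p i, q i) * (normal_weight (p i) * normal_weight (q i)))) \<partial>(pairs_measure n \<Otimes>\<^sub>M pairs_measure n))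
    = (G.mass * F.mass) ^ n"
proof -
  have "(\<integral>\<^sup>+z. ennreal (cov z * (normal_weight (fst z) * normal_weight (snd z))) \<partial>(lborel \<Otimes>\<^sub>M lborel)) = G.mass * F.mass"
    unfolding G.mass_def F.mass_def
    by (subst nn_integral_normal_weight_difference[symmetric])
       (auto intro!: nn_integral_cong simp: cov_def ennreal_mult normal_weight_nonneg mult.assoc)
  then show ?thesis
    using lborel.nn_integral_PiM_pair_prod[of "\<lambda>z. ennreal (cov z * (normal_weight (fst z) * normal_weight (snd z)))" n] by simp
qed

lemma nn_integral_smooth_cov_weight:
  "(\<integral>\<^sup>+(p, q). (\<Prod>i<n. ennreal (smooth_cov e (p i, q i) * (normal_weight (p i) * normal_weight (q i)))) \<partial>(pairs_measure n \<Otimes>\<^sub>M pairs_measure n))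
    = (G.smooth_mass e * F.smooth_mass e) ^ n"
proof -
  have "(\<integral>\<^sup>+z. ennreal (smooth_cov e z * (normal_weight (fst z) * normal_weight (snd z))) \<partial>(lborel \<Otimes>\<^sub>M lborel)) = G.smooth_mass e * F.smooth_mass e"
    unfolding G.smooth_mass_def F.smooth_mass_def
    by (subst nn_integral_normal_weight_difference[symmetric])
       (auto intro!: nn_integral_cong simp: smooth_cov_def ennreal_mult normal_weight_nonneg mult.assoc G.smooth_g_nonneg F.smooth_g_nonneg)
  then show ?thesis
    using lborel.nn_integral_PiM_pair_prod[of "\<lambda>z. ennreal (smooth_cov e z * (normal_weight (fst z) * normal_weight (snd z)))" n] by simp
qed

lemma smooth_cov_tendsto:
  assumes "fst p \<noteq> fst q" "snd p \<noteq> snd q"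
  shows "(\<lambda>n. smooth_cov (1 / real (n + 2)) (p, q)) \<longlonglongrightarrow> cov (p, q)"
  unfolding smooth_cov_def cov_def
  by (intro tendsto_mult G.smooth_g_tendsto F.smooth_g_tendsto) (use assms in auto)

text \<open>The induction is on the number of factors, over the fixed measure on all n pairs; each
  step multiplies by one smoothed kernel in a time coordinate and one in a space coordinate.\<close>

lemma positive_kernel_smooth_cov:
  assumes "e > 0"
  shows "positive_kernel (pairs_measure n) (\<lambda>(p, q). \<Prod>i<n. smooth_cov e (p i, q i))"
proof -
  interpret P: product_sigma_finite "\<lambda>_::nat. lborel :: (real \<times> real) measure" by standard
  have sf: "sigma_finite_measure (pairs_measure n)" by (rule P.sigma_finite) simp
  have "positive_kernel (pairs_measure n) (\<lambda>(p, q). \<Prod>i<m. smooth_cov e (p i, q i))" if "m \<le> n" for m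
    using that
  proof (induction m)
    case 0
    then show ?case using sigma_finite_measure.positive_kernel_one[OF sf] by (simp add: case_prod_unfold)
  next
    case (Suc m)
    then have [measurable]: "(\<lambda>p. p m) \<in> pairs_measure n \<rightarrow>\<^sub>M (borel \<Otimes>\<^sub>M borel)"
      using measurable_component_singleton[of m "{..<n}" "\<lambda>_. lborel :: (real \<times> real) measure"] by (simp add: borel_prod)
    have "positive_kernel (pairs_measure n) (\<lambda>(p, q). (case (p, q) of (p, q) \<Rightarrow> (case (p, q) of (p, q) \<Rightarrow> \<Prod>i<m. smooth_cov e (p i, q i)) *
      G.smooth_g e ((\<lambda>p. fst (p m)) p - (\<lambda>p. fst (p m)) q)) * F.smooth_g e ((\<lambda>p. snd (p m)) p - (\<lambda>p. snd (p m)) q))"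
      using Suc by (intro F.positive_kernel_smooth_g G.positive_kernel_smooth_g sf assms) (auto simp: measurable_comp)
    then show ?case by (simp add: smooth_cov_def mult.assoc)
  qed
  then show ?thesis by simp
qed

lemma integrable_cov_dominated:
  assumes "gaussian_dominated n a" "gaussian_dominated n b"
  shows "integrable (pairs_measure n \<Otimes>\<^sub>M pairs_measure n) (\<lambda>(p, q). (\<Prod>i<n. cov (p i, q i)) * (a p * b q))"
proof -
  obtain A B where A: "\<And>p. p \<in> space (pairs_measure n) \<Longrightarrow> \<bar>a p\<bar> \<le> A * (\<Prod>i<n. normal_weight (p i))"
    and B: "\<And>p. p \<in> space (pairs_measure n) \<Longrightarrow> \<bar>b p\<bar> \<le> B * (\<Prod>i<n. normal_weight (p i))"
    using assms unfolding gaussian_dominated_def by blast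
  have [measurable]: "a \<in> borel_measurable (pairs_measure n)" "b \<in> borel_measurable (pairs_measure n)"
    using assms by (auto simp: gaussian_dominated_def)
  let ?w = "\<lambda>(p, q). \<Prod>i<n. cov (p i, q i) * (normal_weight (p i) * normal_weight (q i))"
  have "(\<integral>\<^sup>+z. ennreal (norm (?w z)) \<partial>(pairs_measure n \<Otimes>\<^sub>M pairs_measure n)) = (G.mass * F.mass) ^ n"
    unfolding nn_integral_cov_weight[symmetric]
    by (intro nn_integral_cong)
       (auto simp: abs_prod abs_mult cov_nonneg normal_weight_nonneg prod_ennreal)
  also have "\<dots> < \<infinity>" by (simp add: G.mass_eq F.mass_eq power_less_top_ennreal ennreal_mult_less_top)
  finally have "integrable (pairs_measure n \<Otimes>\<^sub>M pairs_measure n) ?w"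
    by (intro integrableI_bounded) auto
  then have "integrable (pairs_measure n \<Otimes>\<^sub>M pairs_measure n) (\<lambda>z. (A * B) * ?w z)"
    by (rule integrable_mult_right)
  then show ?thesis
  proof (rule Bochner_Integration.integrable_bound)
    show "AE z in pairs_measure n \<Otimes>\<^sub>M pairs_measure n.
      norm (case z of (p, q) \<Rightarrow> (\<Prod>i<n. cov (p i, q i)) * (a p * b q)) \<le> norm ((A * B) * ?w z)"
    proof (rule AE_I2)
      fix z assume z: "z \<in> space (pairs_measure n \<Otimes>\<^sub>M pairs_measure n)"
      obtain p q where zpq: "z = (p, q)" by (cases z)
      with z have pq: "p \<in> space (pairs_measure n)" "q \<in> space (pairs_measure n)" by (auto simp: space_pair_measure)
      have "\<bar>a p\<bar> * \<bar>b q\<bar> \<le> (A * (\<Prod>i<n. normal_weight (p i))) * (B * (\<Prod>i<n. normal_weight (q i)))"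
        using A[OF pq(1)] B[OF pq(2)] by (intro mult_mono order_trans[OF abs_ge_zero A[OF pq(1)]]) auto
      then have "(\<Prod>i<n. cov (p i, q i)) * (\<bar>a p\<bar> * \<bar>b q\<bar>) \<le> (\<Prod>i<n. cov (p i, q i)) * ((A * (\<Prod>i<n. normal_weight (p i))) * (B * (\<Prod>i<n. normal_weight (q i))))"
        by (intro mult_left_mono prod_nonneg) (auto simp: cov_nonneg)
      also have "\<dots> = (A * B) * ?w (p, q)" by (simp add: prod.distrib)
      also have "\<dots> \<le> norm ((A * B) * ?w (p, q))" by simp
      finally show "norm (case z of (p, q) \<Rightarrow> (\<Prod>i<n. cov (p i, q i)) * (a p * b q)) \<le> norm ((A * B) * ?w z)"
        by (simp add: zpq abs_mult abs_prod cov_nonneg)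
    qed
  qed measurable
qed

lemma integrable_normal_weight: "integrable (pairs_measure n) (\<lambda>p. \<Prod>i<n. normal_weight (p i))"
proof -
  interpret P: product_sigma_finite "\<lambda>_::nat. lborel :: (real \<times> real) measure" by standard
  have "integrable (lborel \<Otimes>\<^sub>M lborel) (\<lambda>(t, x). std_normal_density t * std_normal_density x)"
    by (rule lborel_pair.Fubini_integrable) (auto simp: abs_mult)
  then have "integrable lborel normal_weight"
    by (simp add: lborel_prod normal_weight_def[abs_def] case_prod_unfold)
  then show ?thesis by (intro P.product_integrable_prod) auto
qed

lemma gaussian_dominated_integrable:
  assumes "gaussian_dominated n k"
  shows "integrable (pairs_measure n) k"
proof -
  obtain C where C: "\<And>p. p \<in> space (pairs_measure n) \<Longrightarrow> \<bar>k p\<bar> \<le> C * (\<Prod>i<n. normal_weight (p i))"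
    using assms unfolding gaussian_dominated_def by blast
  show ?thesis
  proof (rule Bochner_Integration.integrable_bound)
    show "integrable (pairs_measure n) (\<lambda>p. C * (\<Prod>i<n. normal_weight (p i)))"
      by (intro integrable_mult_right integrable_normal_weight)
    show "AE p in pairs_measure n. norm (k p) \<le> norm (C * (\<Prod>i<n. normal_weight (p i)))"
    proof (rule AE_I2)
      fix p assume "p \<in> space (pairs_measure n)"
      from order_trans[OF C[OF this] abs_ge_self]
      show "norm (k p) \<le> norm (C * (\<Prod>i<n. normal_weight (p i)))" by simp
    qed
  qed (use assms in \<open>simp add: gaussian_dominated_def\<close>)
qed

text \<open>The smoothed kernels are positive and converge pointwise off the diagonals, and the integrals of
  the Gaussian majorants converge; Fatou's lemma for majorant minus integrand gives the claim. On the
  diagonals the integrand vanishes because \<open>enn2real \<infinity> = 0\<close>.\<close>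

lemma norm2_H_nonneg:
  assumes k: "gaussian_dominated n k"
  shows "0 \<le> norm2_H \<gamma> f n k"
proof -
  interpret P: product_sigma_finite "\<lambda>_::nat. lborel :: (real \<times> real) measure" by standard
  interpret S: sigma_finite_measure "pairs_measure n" by (rule P.sigma_finite) simp
  let ?M = "pairs_measure n \<Otimes>\<^sub>M pairs_measure n"
  obtain C where C: "\<And>p. p \<in> space (pairs_measure n) \<Longrightarrow> \<bar>k p\<bar> \<le> C * (\<Prod>i<n. normal_weight (p i))"
    using k unfolding gaussian_dominated_def by blast
  have [measurable]: "k \<in> borel_measurable (pairs_measure n)"
    using k by (rule gaussian_dominated_measurable)
  define w where "w p = C * (\<Prod>i<n. normal_weight (p i))" for p :: "nat \<Rightarrow> real \<times> real"
  have wm [measurable]: "w \<in> borel_measurable (pairs_measure n)" unfolding w_def by measurable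
  have iw: "integrable (pairs_measure n) w" unfolding w_def by (intro integrable_mult_right integrable_normal_weight)
  have dw: "gaussian_dominated n w"
    unfolding gaussian_dominated_def using wm
    by (auto simp: w_def abs_mult abs_prod normal_weight_nonneg intro!: exI[of _ "\<bar>C\<bar>"])
  define K where "K z = (\<Prod>i<n. cov (fst z i, snd z i))" for z :: "(nat \<Rightarrow> real \<times> real) \<times> (nat \<Rightarrow> real \<times> real)"
  define K' where "K' j z = (\<Prod>i<n. smooth_cov (1 / real (j + 2)) (fst z i, snd z i))" for j and z :: "(nat \<Rightarrow> real \<times> real) \<times> (nat \<Rightarrow> real \<times> real)"
  define u where "u = (\<lambda>z. k (fst z) * k (snd z))"
  define v where "v = (\<lambda>z. w (fst z) * w (snd z))"
  have m [measurable]: "u \<in> borel_measurable ?M" "v \<in> borel_measurable ?M" "K \<in> borel_measurable ?M" "K' j \<in> borel_measurable ?M" for j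
    unfolding u_def v_def K_def K'_def by measurable
  have uv: "\<bar>u z\<bar> \<le> v z" if "z \<in> space ?M" for z
  proof -
    have z: "fst z \<in> space (pairs_measure n)" "snd z \<in> space (pairs_measure n)" using that by (auto simp: space_pair_measure)
    show ?thesis
      using C[OF z(1)] C[OF z(2)] unfolding u_def v_def w_def abs_mult
      by (intro mult_mono order_trans[OF abs_ge_zero C[OF z(1)]]) auto
  qed
  have K0: "0 \<le> K z" and K'0: "0 \<le> K' j z" for j z
    by (auto simp: K_def K'_def cov_nonneg smooth_cov_nonneg intro!: prod_nonneg)
  have pos: "positive_kernel (pairs_measure n) (K' j)" for j
    using positive_kernel_smooth_cov[of "1 / real (j + 2)" n] unfolding K'_def by (simp add: case_prod_unfold)
  have iK: "integrable ?M (\<lambda>z. K z * u z)" "integrable ?M (\<lambda>z. K z * v z)"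
    using integrable_cov_dominated[OF k k] integrable_cov_dominated[OF dw dw]
    by (simp_all add: K_def u_def v_def case_prod_unfold)
  have iK': "integrable ?M (\<lambda>z. K' j z * u z)" "integrable ?M (\<lambda>z. K' j z * v z)" for j
    using S.integrable_bounded_kernel[OF _ _ gaussian_dominated_integrable[OF k], of "K' j"] S.integrable_bounded_kernel[OF _ _ iw, of "K' j"] pos[of j]
    by (simp_all add: positive_kernel_def u_def v_def case_prod_unfold)
  have vK: "(\<integral>\<^sup>+z. ennreal (K z * v z) \<partial>?M) = ennreal (C\<^sup>2) * (G.mass * F.mass) ^ n"
    unfolding nn_integral_cov_weight[symmetric]
    by (subst nn_integral_cmult[symmetric])
       (auto intro!: nn_integral_cong simp: K_def v_def w_def prod_ennreal cov_nonneg normal_weight_nonneg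
         ennreal_mult[symmetric] prod_nonneg prod.distrib power2_eq_square ac_simps)
  have vK': "(\<integral>\<^sup>+z. ennreal (K' j z * v z) \<partial>?M) = ennreal (C\<^sup>2) * (G.smooth_mass (1 / real (j + 2)) * F.smooth_mass (1 / real (j + 2))) ^ n" for j
    unfolding nn_integral_smooth_cov_weight[symmetric]
    by (subst nn_integral_cmult[symmetric])
       (auto intro!: nn_integral_cong simp: K'_def v_def w_def prod_ennreal smooth_cov_nonneg normal_weight_nonneg
         ennreal_mult[symmetric] prod_nonneg prod.distrib power2_eq_square ac_simps)
  have fin: "G.mass < \<top>" "F.mass < \<top>" by (simp_all add: G.mass_eq F.mass_eq)
  have lim1: "(\<lambda>j. G.smooth_mass (1 / real (j + 2)) * F.smooth_mass (1 / real (j + 2))) \<longlonglongrightarrow> G.mass * F.mass"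
    using fin by (intro tendsto_mult_ennreal G.smooth_mass_tendsto F.smooth_mass_tendsto) auto
  have "(\<lambda>j. (G.smooth_mass (1 / real (j + 2)) * F.smooth_mass (1 / real (j + 2))) ^ m) \<longlonglongrightarrow> (G.mass * F.mass) ^ m" for m
  proof (induction m)
    case (Suc m)
    show ?case
      unfolding power_Suc
      by (rule tendsto_mult_ennreal[OF lim1 Suc]) (use fin in \<open>auto simp: power_eq_top_ennreal ennreal_mult_eq_top_iff\<close>)
  qed simp
  then have lim: "(\<lambda>j. \<integral>\<^sup>+z. ennreal (K' j z * v z) \<partial>?M) \<longlonglongrightarrow> (\<integral>\<^sup>+z. ennreal (K z * v z) \<partial>?M)"
    unfolding vK vK' using fin
    by (intro tendsto_mult_ennreal tendsto_const) (auto simp: power_eq_top_ennreal ennreal_mult_eq_top_iff)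
  have "(\<integral>\<^sup>+z. ennreal (K z * v z - K z * u z) \<partial>?M) \<le> (\<integral>\<^sup>+z. liminf (\<lambda>j. ennreal (K' j z * v z - K' j z * u z)) \<partial>?M)"
  proof (rule nn_integral_mono)
    fix z assume z: "z \<in> space ?M"
    show "ennreal (K z * v z - K z * u z) \<le> liminf (\<lambda>j. ennreal (K' j z * v z - K' j z * u z))"
    proof (cases "\<forall>i<n. fst (fst z i) \<noteq> fst (snd z i) \<and> snd (fst z i) \<noteq> snd (snd z i)")
      case True
      then have "(\<lambda>j. K' j z) \<longlonglongrightarrow> K z"
        unfolding K_def K'_def by (intro tendsto_prod smooth_cov_tendsto) auto
      then have "(\<lambda>j. ennreal (K' j z * v z - K' j z * u z)) \<longlonglongrightarrow> ennreal (K z * v z - K z * u z)"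
        by (intro tendsto_ennrealI tendsto_intros)
      then show ?thesis by (simp add: lim_imp_Liminf)
    next
      case False
      then obtain i where i: "i < n" "fst (fst z i) = fst (snd z i) \<or> snd (fst z i) = snd (snd z i)" by blast
      have inf: "\<gamma> 0 = \<top>" "f 0 = \<top>"
        using G.cov F.cov unfolding covariance_function_def by (metis infinity_ennreal_def less_top)+
      have "cov (fst z i, snd z i) = 0" using i(2) by (auto simp: cov_def inf)
      then have "K z = 0" unfolding K_def using i(1) by (intro prod_zero) auto
      then show ?thesis by simp
    qed
  qed
  also have "\<dots> \<le> liminf (\<lambda>j. \<integral>\<^sup>+z. ennreal (K' j z * v z - K' j z * u z) \<partial>?M)"
    by (rule nn_integral_liminf) measurable
  \<comment> \<open>Positivity of the smoothed form enters here: dropping the term with u only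
    increases the integral.\<close>
  also have "\<dots> \<le> liminf (\<lambda>j. \<integral>\<^sup>+z. ennreal (K' j z * v z) \<partial>?M)"
  proof (rule Liminf_mono, rule always_eventually, rule allI)
    fix j
    have d: "0 \<le> K' j z * v z - K' j z * u z" "0 \<le> K' j z * v z" if "z \<in> space ?M" for z
      using uv[OF that] mult_left_mono[of "u z" "v z" "K' j z"] K'0[of j z] by auto
    have "(\<integral>\<^sup>+z. ennreal (K' j z * v z - K' j z * u z) \<partial>?M) = ennreal (LINT z|?M. K' j z * v z - K' j z * u z)"
      by (rule nn_integral_eq_integral) (use iK' d in auto)
    also have "(LINT z|?M. K' j z * v z - K' j z * u z) \<le> (LINT z|?M. K' j z * v z)"
    proof -
      have "0 \<le> (LINT (p, q)|?M. K' j (p, q) * (k p * k q))"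
        using pos[of j] gaussian_dominated_integrable[OF k] unfolding positive_kernel_def by blast
      then have "0 \<le> (LINT z|?M. K' j z * u z)" by (simp add: u_def case_prod_unfold)
      then show ?thesis by (simp add: iK')
    qed
    also have "ennreal (LINT z|?M. K' j z * v z) = (\<integral>\<^sup>+z. ennreal (K' j z * v z) \<partial>?M)"
      by (rule nn_integral_eq_integral[symmetric]) (use iK' d in auto)
    finally show "(\<integral>\<^sup>+z. ennreal (K' j z * v z - K' j z * u z) \<partial>?M) \<le> (\<integral>\<^sup>+z. ennreal (K' j z * v z) \<partial>?M)"
      by (simp add: ennreal_leI)
  qed
  also have "\<dots> = (\<integral>\<^sup>+z. ennreal (K z * v z) \<partial>?M)"
    by (rule lim_imp_Liminf[OF _ lim]) simp
  finally have le: "(\<integral>\<^sup>+z. ennreal (K z * v z - K z * u z) \<partial>?M) \<le> (\<integral>\<^sup>+z. ennreal (K z * v z) \<partial>?M)" .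
  have d: "0 \<le> K z * v z - K z * u z" "0 \<le> K z * v z" if "z \<in> space ?M" for z
    using uv[OF that] mult_left_mono[of "u z" "v z" "K z"] K0[of z] by auto
  \<comment> \<open>The integral of the majorant is finite, so it cancels and leaves the sign of the
    integral of K u.\<close>
  have "ennreal (LINT z|?M. K z * v z - K z * u z) \<le> ennreal (LINT z|?M. K z * v z)"
    using le iK d
    by (subst (asm) (1 2) nn_integral_eq_integral) auto
  moreover have "0 \<le> (LINT z|?M. K z * v z)" by (intro integral_nonneg_AE AE_I2 d)
  ultimately have "(LINT z|?M. K z * v z - K z * u z) \<le> (LINT z|?M. K z * v z)" by simp
  then have "0 \<le> (LINT z|?M. K z * u z)" by (simp add: iK)
  then show ?thesis by (simp add: norm2_H_eq K_def u_def case_prod_unfold)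
qed

text \<open>Write N for the quadratic form. The parallelogram identity N(a) + N(a - 2 s) = 2 N(a -
  s) + 2 N(s) is pointwise under the integral, and N(a - 2 s) \<ge> 0 may be dropped.\<close>

lemma norm2_H_le:
  assumes a: "gaussian_dominated n a" and s: "gaussian_dominated n s"
  shows "norm2_H \<gamma> f n a \<le> 2 * norm2_H \<gamma> f n (\<lambda>p. a p - s p) + 2 * norm2_H \<gamma> f n s"
proof -
  let ?M = "pairs_measure n \<Otimes>\<^sub>M pairs_measure n"
  let ?J = "\<lambda>k z. case z of (p, q) \<Rightarrow> (\<Prod>i<n. cov (p i, q i)) * (k p * k q)"
  have d1: "gaussian_dominated n (\<lambda>p. a p - s p)" by (rule gaussian_dominated_diff[OF a s])
  have d2: "gaussian_dominated n (\<lambda>p. a p - s p - s p)" by (rule gaussian_dominated_diff[OF d1 s])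
  note int = integrable_cov_dominated[OF a a] integrable_cov_dominated[OF s s] integrable_cov_dominated[OF d1 d1] integrable_cov_dominated[OF d2 d2]
  have "norm2_H \<gamma> f n a + norm2_H \<gamma> f n (\<lambda>p. a p - s p - s p) = (LINT z|?M. ?J a z + ?J (\<lambda>p. a p - s p - s p) z)"
    unfolding norm2_H_eq using int by simp
  also have "\<dots> = (LINT z|?M. 2 * ?J (\<lambda>p. a p - s p) z + 2 * ?J s z)"
    by (rule Bochner_Integration.integral_cong) (auto simp: algebra_simps)
  also have "\<dots> = 2 * norm2_H \<gamma> f n (\<lambda>p. a p - s p) + 2 * norm2_H \<gamma> f n s"
    unfolding norm2_H_eq using int by simp
  finally show ?thesis using norm2_H_nonneg[OF d2] by simp
qed

end

subsection \<open>Second moments of multiple Wiener integrals\<close>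

definition normal_dominated :: "(real \<times> real \<Rightarrow> real) \<Rightarrow> bool"
  where "normal_dominated \<phi> \<longleftrightarrow> \<phi> \<in> borel_measurable borel \<and> (\<exists>C. \<forall>p. \<bar>\<phi> p\<bar> \<le> C * normal_weight p)"

text \<open>The quotient by the positive continuous weight is continuous, hence bounded on the
  compact support.\<close>

lemma test_function_normal_dominated:
  assumes "test_function \<phi>"
  shows "normal_dominated \<phi>"
proof -
  let ?S = "closure {x. \<phi> x \<noteq> 0}"
  from assms have S: "compact ?S" and sm: "smooth \<phi>" by (auto simp: test_function_def)
  have "iter_dir_deriv [] \<phi> differentiable_on UNIV" using sm unfolding smooth_def by blast
  then have cont: "continuous_on UNIV \<phi>"
    by (simp add: iter_dir_deriv_def differentiable_imp_continuous_on)
  have "continuous_on UNIV (\<lambda>p. \<phi> p / normal_weight p)"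
    unfolding normal_weight_def normal_density_def
    by (intro continuous_intros cont) auto
  then have "compact ((\<lambda>p. \<phi> p / normal_weight p) ` ?S)"
    by (intro compact_continuous_image S) (auto intro: continuous_on_subset)
  then have "bounded ((\<lambda>p. \<phi> p / normal_weight p) ` ?S)" by (rule compact_imp_bounded)
  then obtain C where C: "\<And>p. p \<in> ?S \<Longrightarrow> \<bar>\<phi> p / normal_weight p\<bar> \<le> C"
    unfolding bounded_iff by auto
  have "\<bar>\<phi> p\<bar> \<le> \<bar>C\<bar> * normal_weight p" for p
  proof (cases "\<phi> p = 0")
    case False
    then have "p \<in> ?S" using closure_subset[of "{x. \<phi> x \<noteq> 0}"] by blast
    then have "\<bar>\<phi> p\<bar> / normal_weight p \<le> \<bar>C\<bar>" using C[of p] normal_weight_pos[of p] by (simp add: abs_divide)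
    then show ?thesis using normal_weight_pos[of p] by (simp add: pos_divide_le_eq)
  qed (simp add: normal_weight_nonneg)
  then show ?thesis
    using borel_measurable_continuous_onI[OF cont] unfolding normal_dominated_def by blast
qed

lemma gaussian_dominated_tensor:
  assumes "normal_dominated \<phi>"
  shows "gaussian_dominated n (\<lambda>p. \<Prod>i<n. \<phi> (p i))"
proof -
  obtain C where C: "\<And>p. \<bar>\<phi> p\<bar> \<le> C * normal_weight p" and [measurable]: "\<phi> \<in> borel_measurable borel"
    using assms unfolding normal_dominated_def by blast
  have "\<bar>\<Prod>i<n. \<phi> (p i)\<bar> \<le> C ^ n * (\<Prod>i<n. normal_weight (p i))" for p :: "nat \<Rightarrow> real \<times> real"
  proof -
    have "\<bar>\<Prod>i<n. \<phi> (p i)\<bar> = (\<Prod>i<n. \<bar>\<phi> (p i)\<bar>)" by (rule abs_prod)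
    also have "\<dots> \<le> (\<Prod>i<n. C * normal_weight (p i))" by (intro prod_mono) (simp add: C)
    finally show ?thesis by (simp add: prod.distrib)
  qed
  then show ?thesis unfolding gaussian_dominated_def by (intro conjI exI[of _ "C ^ n"]) (auto, measurable)
qed

lemma gaussian_dominated_power_tensor:
  assumes "\<forall>(c, \<phi>)\<in>set cs. test_function \<phi>"
  shows "gaussian_dominated n (power_tensor n cs)"
  using assms
proof (induction cs)
  case Nil
  show ?case unfolding gaussian_dominated_def by (auto simp: power_tensor_def[abs_def] intro!: exI[of _ 0])
next
  case (Cons x cs)
  obtain c \<phi> where x: "x = (c, \<phi>)" by (cases x)
  have "gaussian_dominated n (\<lambda>p. c * (\<Prod>i<n. \<phi> (p i)) + 1 * power_tensor n cs p)"
    using Cons x by (intro gaussian_dominated_linear gaussian_dominated_tensor test_function_normal_dominated) auto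
  then show ?case by (simp add: power_tensor_def[abs_def] x)
qed

section \<open>The Wiener isometry on tensors of test functions and its extension to an
  inequality\<close>

context noise_spectrum
begin

lemma inner_H_eq: "inner_H \<gamma> f \<phi> \<psi> = (LINT z|(lborel \<Otimes>\<^sub>M lborel). cov z * (\<phi> (fst z) * \<psi> (snd z)))"
  unfolding inner_H_def enn2real_noise_cov by (simp add: case_prod_unfold mult.assoc)

lemma integrable_cov_weight: "integrable (lborel \<Otimes>\<^sub>M lborel) (\<lambda>z. cov z * (normal_weight (fst z) * normal_weight (snd z)))"
proof (rule integrableI_bounded)
  have "(\<integral>\<^sup>+z. ennreal (norm (cov z * (normal_weight (fst z) * normal_weight (snd z)))) \<partial>(lborel \<Otimes>\<^sub>M lborel)) = G.mass * F.mass"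
    unfolding G.mass_def F.mass_def
    by (subst nn_integral_normal_weight_difference[symmetric])
       (auto intro!: nn_integral_cong simp: cov_def abs_mult ennreal_mult normal_weight_nonneg mult.assoc)
  then show "(\<integral>\<^sup>+z. ennreal (norm (cov z * (normal_weight (fst z) * normal_weight (snd z)))) \<partial>(lborel \<Otimes>\<^sub>M lborel)) < \<infinity>"
    by (simp add: G.mass_eq F.mass_eq ennreal_mult_less_top)
qed measurable

text \<open>Reflection and translation turn the slice at p into integrals of \<open>g\<close>
  against Gaussian densities centred at the coordinates of p. This works for every p, as the slice
  hypothesis of \<open>integral_PiM_pair_prod\<close> demands.\<close>

lemma integrable_cov_slice: "integrable lborel (\<lambda>q. cov (p, q) * normal_weight q)"
proof -
  have "integrable lborel (\<lambda>s. G.g (fst p - s) * std_normal_density s)"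
    using lborel_integrable_real_affine[OF G.integrable_g_normal[of 1 "fst p"], of "-1" "fst p"]
    by (simp add: normal_density_def)
  moreover have "integrable lborel (\<lambda>s. F.g (snd p - s) * std_normal_density s)"
    using lborel_integrable_real_affine[OF F.integrable_g_normal[of 1 "snd p"], of "-1" "snd p"]
    by (simp add: normal_density_def)
  ultimately have "integrable (lborel \<Otimes>\<^sub>M lborel) (\<lambda>(s, y). (G.g (fst p - s) * std_normal_density s) * (F.g (snd p - y) * std_normal_density y))"
    by (intro lborel_pair.Fubini_integrable) (auto simp: abs_mult)
  then show ?thesis
    by (simp add: lborel_prod cov_def normal_weight_def case_prod_unfold ac_simps)
qed

lemma integrable_cov_pair:
  assumes \<phi>: "normal_dominated \<phi>" and \<psi>: "normal_dominated \<psi>"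
  shows "integrable (lborel \<Otimes>\<^sub>M lborel) (\<lambda>z. cov z * (\<phi> (fst z) * \<psi> (snd z)))" (is "integrable _ ?F")
proof -
  obtain A B where A: "\<And>p. \<bar>\<phi> p\<bar> \<le> A * normal_weight p" and B: "\<And>p. \<bar>\<psi> p\<bar> \<le> B * normal_weight p"
    and [measurable]: "\<phi> \<in> borel_measurable borel" "\<psi> \<in> borel_measurable borel"
    using assms unfolding normal_dominated_def by blast
  show ?thesis
  proof (rule Bochner_Integration.integrable_bound[OF integrable_mult_right[OF integrable_cov_weight, of "A * B"]])
    show "AE z in lborel \<Otimes>\<^sub>M lborel. norm (?F z) \<le> norm (A * B * (cov z * (normal_weight (fst z) * normal_weight (snd z))))"
    proof (rule AE_I2)
      fix z
      have "\<bar>\<phi> (fst z)\<bar> * \<bar>\<psi> (snd z)\<bar> \<le> (A * normal_weight (fst z)) * (B * normal_weight (snd z))"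
        by (intro mult_mono A B order_trans[OF abs_ge_zero A]) auto
      then have "cov z * (\<bar>\<phi> (fst z)\<bar> * \<bar>\<psi> (snd z)\<bar>) \<le> cov z * ((A * normal_weight (fst z)) * (B * normal_weight (snd z)))"
        by (intro mult_left_mono cov_nonneg)
      also have "\<dots> = A * B * (cov z * (normal_weight (fst z) * normal_weight (snd z)))" by simp
      also have "\<dots> \<le> norm \<dots>" by simp
      finally show "norm (?F z) \<le> norm (A * B * (cov z * (normal_weight (fst z) * normal_weight (snd z))))"
        by (simp add: abs_mult cov_nonneg)
    qed
  qed measurable
qed

lemma cov_tensor_integral:
  assumes \<phi>: "normal_dominated \<phi>" and \<psi>: "normal_dominated \<psi>"
  shows "integrable (pairs_measure n \<Otimes>\<^sub>M pairs_measure n) (\<lambda>(p, q). \<Prod>i<n. cov (p i, q i) * (\<phi> (p i) * \<psi> (q i)))"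
    and "(LINT (p, q)|(pairs_measure n \<Otimes>\<^sub>M pairs_measure n). (\<Prod>i<n. cov (p i, q i) * (\<phi> (p i) * \<psi> (q i)))) = inner_H \<gamma> f \<phi> \<psi> ^ n"
proof -
  obtain A B where A: "\<And>p. \<bar>\<phi> p\<bar> \<le> A * normal_weight p" and B: "\<And>p. \<bar>\<psi> p\<bar> \<le> B * normal_weight p"
    and [measurable]: "\<phi> \<in> borel_measurable borel" "\<psi> \<in> borel_measurable borel"
    using assms unfolding normal_dominated_def by blast
  let ?F = "\<lambda>z. cov z * (\<phi> (fst z) * \<psi> (snd z))"
  note int = integrable_cov_pair[OF assms]
  have slice: "integrable lborel (\<lambda>y. ?F (x, y))" for x
  proof -
    have "integrable lborel (\<lambda>y. cov (x, y) * \<psi> y)"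
    proof (rule Bochner_Integration.integrable_bound[OF integrable_mult_right[OF integrable_cov_slice, of B x]])
      show "AE y in lborel. norm (cov (x, y) * \<psi> y) \<le> norm (B * (cov (x, y) * normal_weight y))"
      proof (rule AE_I2)
        fix y
        have "cov (x, y) * \<bar>\<psi> y\<bar> \<le> cov (x, y) * (B * normal_weight y)" by (intro mult_left_mono B cov_nonneg)
        also have "\<dots> = B * (cov (x, y) * normal_weight y)" by simp
        also have "\<dots> \<le> norm \<dots>" by simp
        finally show "norm (cov (x, y) * \<psi> y) \<le> norm (B * (cov (x, y) * normal_weight y))"
          by (simp add: abs_mult cov_nonneg)
      qed
    qed measurable
    from integrable_mult_right[OF this, of "\<phi> x"] show ?thesis by (simp add: ac_simps)
  qed
  show "integrable (pairs_measure n \<Otimes>\<^sub>M pairs_measure n) (\<lambda>(p, q). \<Prod>i<n. cov (p i, q i) * (\<phi> (p i) * \<psi> (q i)))"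
    and "(LINT (p, q)|(pairs_measure n \<Otimes>\<^sub>M pairs_measure n). (\<Prod>i<n. cov (p i, q i) * (\<phi> (p i) * \<psi> (q i)))) = inner_H \<gamma> f \<phi> \<psi> ^ n"
    using lborel.integral_PiM_pair_prod[OF int slice, of n] by (simp_all add: inner_H_eq)
qed

text \<open>The double sum runs over positions because the list may contain an entry more than
  once.\<close>

lemma norm2_H_power_tensor:
  assumes "\<forall>(c, \<phi>)\<in>set cs. test_function \<phi>"
  shows "norm2_H \<gamma> f n (power_tensor n cs) = (\<Sum>i<length cs. \<Sum>j<length cs.
    fst (cs ! i) * fst (cs ! j) * inner_H \<gamma> f (snd (cs ! i)) (snd (cs ! j)) ^ n)"
proof -
  let ?M = "pairs_measure n \<Otimes>\<^sub>M pairs_measure n"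
  let ?l = "length cs"
  define c where "c i = fst (cs ! i)" for i
  define \<phi> where "\<phi> i = snd (cs ! i)" for i
  have \<phi>: "normal_dominated (\<phi> i)" if "i < ?l" for i
    using assms that unfolding \<phi>_def by (intro test_function_normal_dominated) (metis case_prodE nth_mem snd_conv)
  have pt: "power_tensor n cs p = (\<Sum>i<?l. c i * (\<Prod>l<n. \<phi> i (p l)))" for p
    by (simp add: power_tensor_def sum_list_sum_nth c_def \<phi>_def case_prod_unfold atLeast0LessThan)
  let ?J = "\<lambda>i j z. (case z of (p, q) \<Rightarrow> \<Prod>l<n. cov (p l, q l) * (\<phi> i (p l) * \<phi> j (q l)))"
  have "norm2_H \<gamma> f n (power_tensor n cs) = (LINT z|?M. (\<Sum>i<?l. \<Sum>j<?l. c i * c j * ?J i j z))"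
  proof -
    have "(\<Prod>l<n. cov (p l, q l)) * (power_tensor n cs p * power_tensor n cs q) = (\<Sum>i<?l. \<Sum>j<?l. c i * c j * ?J i j (p, q))" for p q
      unfolding pt unfolding sum_product unfolding sum_distrib_left
      by (intro sum.cong refl) (simp add: prod.distrib ac_simps)
    then show ?thesis unfolding norm2_H_eq by (simp add: case_prod_unfold)
  qed
  also have "\<dots> = (\<Sum>i<?l. \<Sum>j<?l. c i * c j * inner_H \<gamma> f (\<phi> i) (\<phi> j) ^ n)"
    using cov_tensor_integral[OF \<phi> \<phi>, of _ _ n]
    by (subst Bochner_Integration.integral_sum, force intro!: Bochner_Integration.integrable_sum integrable_mult_right)
       (auto intro!: sum.cong simp: Bochner_Integration.integral_sum)
  finally show ?thesis by (simp add: c_def \<phi>_def)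
qed

lemma gaussian_noise_pair:
  assumes "prob_space M" "gaussian_noise \<gamma> f M W" "test_function \<phi>" "test_function \<psi>"
  shows "gaussian_pair M (W \<phi>) (W \<psi>)"
proof -
  interpret prob_space M by fact
  have "centered_gaussian M (\<lambda>\<omega>. c * W \<phi> \<omega> + d * W \<psi> \<omega>)" for c d
  proof -
    have "\<forall>(c, \<phi>)\<in>set [(c, \<phi>), (d, \<psi>)]. test_function \<phi>" using assms by simp
    then have "centered_gaussian M (\<lambda>\<omega>. \<Sum>(c, \<phi>)\<leftarrow>[(c, \<phi>), (d, \<psi>)]. c * W \<phi> \<omega>)"
      using assms(2) unfolding gaussian_noise_def by blast
    then show ?thesis by simp
  qed
  then show ?thesis by unfold_locales
qed

lemma expectation_hermite_noise:
  assumes "prob_space M" "gaussian_noise \<gamma> f M W" "test_function \<phi>" "test_function \<psi>"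
  shows "integrable M (\<lambda>\<omega>. hermite n (inner_H \<gamma> f \<phi> \<phi>) (W \<phi> \<omega>) * hermite n (inner_H \<gamma> f \<psi> \<psi>) (W \<psi> \<omega>))"
    and "(LINT \<omega>|M. hermite n (inner_H \<gamma> f \<phi> \<phi>) (W \<phi> \<omega>) * hermite n (inner_H \<gamma> f \<psi> \<psi>) (W \<psi> \<omega>)) = fact n * inner_H \<gamma> f \<phi> \<psi> ^ n"
proof -
  interpret gaussian_pair M "W \<phi>" "W \<psi>" by (rule gaussian_noise_pair[OF assms])
  have "vX = inner_H \<gamma> f \<phi> \<phi>" "rho = inner_H \<gamma> f \<phi> \<psi>"
    using assms unfolding vX_eq rho_eq gaussian_noise_def by blast+
  then show "integrable M (\<lambda>\<omega>. hermite n (inner_H \<gamma> f \<phi> \<phi>) (W \<phi> \<omega>) * hermite n (inner_H \<gamma> f \<psi> \<psi>) (W \<psi> \<omega>))"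
    and "(LINT \<omega>|M. hermite n (inner_H \<gamma> f \<phi> \<phi>) (W \<phi> \<omega>) * hermite n (inner_H \<gamma> f \<psi> \<psi>) (W \<psi> \<omega>)) = fact n * inner_H \<gamma> f \<phi> \<psi> ^ n"
    using integrable_hermite expectation_hermite[of n "inner_H \<gamma> f \<psi> \<psi>"] by auto
qed

text \<open>Both sides expand into the same double sum of powers of inner products; the factorial is
  that of the Hermite expectation.\<close>

lemma second_moment_wiener_power_tensor:
  assumes "prob_space M" "gaussian_noise \<gamma> f M W" "\<forall>(c, \<phi>)\<in>set cs. test_function \<phi>"
  shows "(LINT \<omega>|M. (wiener_power_tensor \<gamma> f W n cs \<omega>)\<^sup>2) = fact n * norm2_H \<gamma> f n (power_tensor n cs)"
proof -
  let ?l = "length cs"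
  define c where "c i = fst (cs ! i)" for i
  define \<phi> where "\<phi> i = snd (cs ! i)" for i
  have \<phi>: "test_function (\<phi> i)" if "i < ?l" for i
    using assms(3) that unfolding \<phi>_def by (metis case_prodE nth_mem snd_conv)
  let ?H = "\<lambda>i \<omega>. hermite n (inner_H \<gamma> f (\<phi> i) (\<phi> i)) (W (\<phi> i) \<omega>)"
  note h = expectation_hermite_noise[OF assms(1,2) \<phi> \<phi>, of _ _ n]
  have "wiener_power_tensor \<gamma> f W n cs \<omega> = (\<Sum>i<?l. c i * ?H i \<omega>)" for \<omega>
    by (simp add: wiener_power_tensor_def sum_list_sum_nth c_def \<phi>_def case_prod_unfold atLeast0LessThan)
  then have "(LINT \<omega>|M. (wiener_power_tensor \<gamma> f W n cs \<omega>)\<^sup>2) = (LINT \<omega>|M. (\<Sum>i<?l. \<Sum>j<?l. c i * c j * (?H i \<omega> * ?H j \<omega>)))"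
    by (intro Bochner_Integration.integral_cong) (auto simp: power2_eq_square sum_product ac_simps)
  also have "\<dots> = (\<Sum>i<?l. \<Sum>j<?l. c i * c j * (fact n * inner_H \<gamma> f (\<phi> i) (\<phi> j) ^ n))"
    using h
    by (subst Bochner_Integration.integral_sum, force intro!: Bochner_Integration.integrable_sum integrable_mult_right)
       (auto intro!: sum.cong simp: Bochner_Integration.integral_sum)
  also have "\<dots> = fact n * norm2_H \<gamma> f n (power_tensor n cs)"
    unfolding norm2_H_power_tensor[OF assms(3)] by (simp add: sum_distrib_left c_def \<phi>_def ac_simps)
  finally show ?thesis .
qed

text \<open>The factor 4 is made of a factor 2 from comparing X with its approximations in mean
  square and a factor 2 from \<open>norm2_H_le\<close>; both error terms vanish in the
  limit.\<close>

lemma wiener_integral_second_moment_le: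
  assumes "prob_space M" "gaussian_noise \<gamma> f M W" "is_wiener_integral \<gamma> f M W n k X"
    and s: "gaussian_dominated n (symmetrization n k)"
  shows "(LINT \<omega>|M. (X \<omega>)\<^sup>2) \<le> 4 * fact n * norm2_H \<gamma> f n (symmetrization n k)"
proof -
  obtain cs where test: "\<And>j. \<forall>(c, \<phi>)\<in>set (cs j). test_function \<phi>"
    and lim: "(\<lambda>j. norm2_H \<gamma> f n (\<lambda>p. power_tensor n (cs j) p - symmetrization n k p)) \<longlonglongrightarrow> 0"
    and L2: "L2_tendsto M (\<lambda>j. wiener_power_tensor \<gamma> f W n (cs j)) X"
    using assms(3) unfolding is_wiener_integral_def by blast
  define Z where "Z j = wiener_power_tensor \<gamma> f W n (cs j)" for j
  define Q where "Q j = norm2_H \<gamma> f n (\<lambda>p. power_tensor n (cs j) p - symmetrization n k p)" for j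
  have [measurable]: "Z j \<in> borel_measurable M" "X \<in> borel_measurable M"
    and i: "integrable M (\<lambda>\<omega>. (Z j \<omega>)\<^sup>2)" "integrable M (\<lambda>\<omega>. (X \<omega>)\<^sup>2)" for j
    using L2 by (auto simp: L2_tendsto_def Z_def)
  have lim2: "(\<lambda>j. LINT \<omega>|M. (Z j \<omega> - X \<omega>)\<^sup>2) \<longlonglongrightarrow> 0"
    using L2 by (simp add: L2_tendsto_def Z_def)
  have sq: "(a - b)\<^sup>2 \<le> 2 * a\<^sup>2 + 2 * b\<^sup>2" for a b :: real
    using zero_le_power2[of "a + b"] by (simp add: power2_eq_square algebra_simps)
  have "(LINT \<omega>|M. (X \<omega>)\<^sup>2) \<le> 2 * (LINT \<omega>|M. (Z j \<omega> - X \<omega>)\<^sup>2) + 2 * (fact n * (2 * Q j + 2 * norm2_H \<gamma> f n (symmetrization n k)))" for j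
  proof -
    have d: "integrable M (\<lambda>\<omega>. (Z j \<omega> - X \<omega>)\<^sup>2)"
    proof (rule Bochner_Integration.integrable_bound)
      show "integrable M (\<lambda>\<omega>. 2 * (Z j \<omega>)\<^sup>2 + 2 * (X \<omega>)\<^sup>2)" using i by auto
      show "AE \<omega> in M. norm ((Z j \<omega> - X \<omega>)\<^sup>2) \<le> norm (2 * (Z j \<omega>)\<^sup>2 + 2 * (X \<omega>)\<^sup>2)"
        using sq by (intro AE_I2) simp
    qed measurable
    have "(LINT \<omega>|M. (X \<omega>)\<^sup>2) \<le> (LINT \<omega>|M. 2 * (Z j \<omega> - X \<omega>)\<^sup>2 + 2 * (Z j \<omega>)\<^sup>2)"
    proof (rule integral_mono)
      show "(X \<omega>)\<^sup>2 \<le> 2 * (Z j \<omega> - X \<omega>)\<^sup>2 + 2 * (Z j \<omega>)\<^sup>2" for \<omega>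
        using sq[of "Z j \<omega> - X \<omega>" "Z j \<omega>"] by simp
    qed (use d i in auto)
    also have "\<dots> = 2 * (LINT \<omega>|M. (Z j \<omega> - X \<omega>)\<^sup>2) + 2 * (LINT \<omega>|M. (Z j \<omega>)\<^sup>2)" using d i by simp
    also have "(LINT \<omega>|M. (Z j \<omega>)\<^sup>2) = fact n * norm2_H \<gamma> f n (power_tensor n (cs j))"
      unfolding Z_def by (rule second_moment_wiener_power_tensor[OF assms(1,2) test])
    also have "\<dots> \<le> fact n * (2 * Q j + 2 * norm2_H \<gamma> f n (symmetrization n k))"
      unfolding Q_def by (intro mult_left_mono norm2_H_le gaussian_dominated_power_tensor test s) simp
    finally show ?thesis by simp
  qed
  moreover have "(\<lambda>j. 2 * (LINT \<omega>|M. (Z j \<omega> - X \<omega>)\<^sup>2) + 2 * (fact n * (2 * Q j + 2 * norm2_H \<gamma> f n (symmetrization n k))))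
    \<longlonglongrightarrow> 2 * 0 + 2 * (fact n * (2 * 0 + 2 * norm2_H \<gamma> f n (symmetrization n k)))"
    using lim lim2 unfolding Q_def[symmetric] by (intro tendsto_intros)
  ultimately have "(LINT \<omega>|M. (X \<omega>)\<^sup>2) \<le> 2 * 0 + 2 * (fact n * (2 * 0 + 2 * norm2_H \<gamma> f n (symmetrization n k)))"
    by (intro LIMSEQ_le_const) auto
  then show ?thesis by simp
qed

end

subsection \<open>The kernels of the wave equation\<close>

text \<open>A strictly increasing list is determined by its set of values, so \<open>a\<close> takes
  the same values along both permutations. As it increases strictly along one of them, it is
  injective, and the indices agree.\<close>

lemma strict_increasing_arrangement_unique:
  fixes a :: "nat \<Rightarrow> 'a::linorder"
  assumes \<pi>: "\<pi> permutes {..<n}" and \<sigma>: "\<sigma> permutes {..<n}"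
    and inc: "\<And>i j. i < j \<Longrightarrow> j < n \<Longrightarrow> a (\<pi> i) < a (\<pi> j)" "\<And>i j. i < j \<Longrightarrow> j < n \<Longrightarrow> a (\<sigma> i) < a (\<sigma> j)"
  shows "\<pi> = \<sigma>"
proof -
  have sorted: "sorted_wrt (<) (map (\<lambda>i. a (\<tau> i)) [0..<n])" if "\<And>i j. i < j \<Longrightarrow> j < n \<Longrightarrow> a (\<tau> i) < a (\<tau> j)" for \<tau>
    using that by (auto simp: sorted_wrt_iff_nth_less)
  have set: "set (map (\<lambda>i. a (\<tau> i)) [0..<n]) = a ` {..<n}" if "\<tau> permutes {..<n}" for \<tau>
    using permutes_image[OF that] by (simp add: atLeast0LessThan image_image[symmetric, of a \<tau>])
  have "map (\<lambda>i. a (\<pi> i)) [0..<n] = map (\<lambda>i. a (\<sigma> i)) [0..<n]"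
    by (intro strict_sorted_equal sorted inc) (simp_all only: set[OF \<pi>] set[OF \<sigma>])
  then have eq: "a (\<pi> i) = a (\<sigma> i)" if "i < n" for i
    using that by simp
  have inj: "inj_on a {..<n}"
  proof (rule inj_onI)
    fix x y assume xy: "x \<in> {..<n}" "y \<in> {..<n}" "a x = a y"
    then obtain i j where ij: "x = \<pi> i" "y = \<pi> j" "i < n" "j < n"
      using permutes_image[OF \<pi>] by (metis imageE lessThan_iff)
    then show "x = y" using xy(3) inc(1)[of i j] inc(1)[of j i] by (cases i j rule: linorder_cases) auto
  qed
  show ?thesis
  proof
    fix i show "\<pi> i = \<sigma> i"
    proof (cases "i < n")
      case True
      then show ?thesis
        using inj_onD[OF inj eq[OF True]] permutes_in_image[OF \<pi>, of i] permutes_in_image[OF \<sigma>, of i] by auto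
    next
      case False
      then show ?thesis using \<pi> \<sigma> by (auto simp: permutes_def)
    qed
  qed
qed

text \<open>A rectangle around the part of the backward light cone of (T, x) at positive times.
  Being a product set, it lets the covariance integral split into time and space.\<close>

definition light_box :: "real \<Rightarrow> real \<Rightarrow> (real \<times> real) set"
  where "light_box T x = {0<..<T} \<times> {x - T<..<x + T}"

text \<open>Each factor places a point in the backward cone of the next one. By the triangle
  inequality the cone conditions compose along the chain, up to the apex (t, x), which is stored at
  index n.\<close>

lemma wave_kernel_nonzero:
  assumes "wave_kernel t x n p \<noteq> 0"
  shows "i < j \<Longrightarrow> j < n \<Longrightarrow> fst (p i) < fst (p j)"
    and "i < n \<Longrightarrow> p i \<in> light_box t x"
proof -
  define q where "q = p(n := (t, x))"
  have q: "\<forall>i<n. 0 < fst (q i) \<and> fst (q i) < fst (q (Suc i))"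
    and pr: "(\<Prod>i<n. wave_fundamental (fst (q (Suc i)) - fst (q i)) (snd (q (Suc i)) - snd (q i))) \<noteq> 0"
    using assms by (auto simp: wave_kernel_def Let_def q_def[symmetric] split: if_splits)
  have cone: "\<bar>snd (q (Suc i)) - snd (q i)\<bar> < fst (q (Suc i)) - fst (q i)" if "i < n" for i
    using pr that by (auto simp: wave_fundamental_def prod_zero_iff split: if_splits)
  have step: "fst (q i) < fst (q j) \<and> \<bar>snd (q j) - snd (q i)\<bar> < fst (q j) - fst (q i)" if "i < j" "j \<le> n" for i j
    using that
  proof (induction j)
    case (Suc j)
    show ?case
    proof (cases "i = j")
      case True
      then show ?thesis using q cone[of j] Suc by auto
    next
      case False
      then have "fst (q i) < fst (q j) \<and> \<bar>snd (q j) - snd (q i)\<bar> < fst (q j) - fst (q i)"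
        using Suc by auto
      moreover have "fst (q j) < fst (q (Suc j))" "\<bar>snd (q (Suc j)) - snd (q j)\<bar> < fst (q (Suc j)) - fst (q j)"
        using q cone[of j] Suc by auto
      ultimately show ?thesis by linarith
    qed
  qed simp
  show "fst (p i) < fst (p j)" if "i < j" "j < n"
    using step[of i j] that by (simp add: q_def)
  show "p i \<in> light_box t x" if "i < n"
  proof -
    have "fst (p i) < t" "\<bar>x - snd (p i)\<bar> < t - fst (p i)"
      using step[of i n] that by (simp_all add: q_def)
    moreover have "0 < fst (p i)" using q that by (auto simp: q_def split: if_splits)
    ultimately show ?thesis by (cases "p i") (auto simp: light_box_def)
  qed
qed

lemma wave_kernel_bound: "0 \<le> wave_kernel t x n p" "wave_kernel t x n p \<le> (1 / 2) ^ n"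
proof -
  have "0 \<le> (\<Prod>i<n. wave_fundamental (a i) (b i))" "(\<Prod>i<n. wave_fundamental (a i) (b i)) \<le> (\<Prod>i<n. 1 / 2)" for a b
    by (rule prod_nonneg prod_mono; simp add: wave_fundamental_def)+
  then show "0 \<le> wave_kernel t x n p" "wave_kernel t x n p \<le> (1 / 2) ^ n"
    by (auto simp: wave_kernel_def Let_def)
qed

lemma symmetrization_nonzero:
  assumes "symmetrization n k p \<noteq> 0"
  obtains \<pi> where "\<pi> permutes {..<n}" "k (p \<circ> \<pi>) \<noteq> 0"
  using assms unfolding symmetrization_def by (metis (mono_tags, lifting) div_0 mem_Collect_eq sum.neutral)

lemma abs_symmetrization_le:
  assumes "\<And>p. \<bar>k p\<bar> \<le> B"
  shows "\<bar>symmetrization n k p\<bar> \<le> B"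
proof -
  have "\<bar>\<Sum>\<pi> | \<pi> permutes {..<n}. k (p \<circ> \<pi>)\<bar> \<le> (\<Sum>\<pi> | \<pi> permutes {..<n}. B)"
    by (intro order_trans[OF sum_abs] sum_mono assms)
  also have "\<dots> = fact n * B" by (simp add: card_permutations)
  finally show ?thesis by (simp add: symmetrization_def abs_divide field_simps)
qed

text \<open>Only the permutation that sorts the times contributes to the symmetrization.\<close>

lemma abs_symmetrization_wave_kernel_le:
  "\<bar>symmetrization n (wave_kernel t x n) p\<bar> \<le> (1 / 2) ^ n / fact n"
proof (cases "symmetrization n (wave_kernel t x n) p = 0")
  case False
  then obtain \<pi> where \<pi>: "\<pi> permutes {..<n}" "wave_kernel t x n (p \<circ> \<pi>) \<noteq> 0"
    by (rule symmetrization_nonzero)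
  have "wave_kernel t x n (p \<circ> \<sigma>) = 0" if "\<sigma> permutes {..<n}" "\<sigma> \<noteq> \<pi>" for \<sigma>
  proof (rule ccontr)
    assume "wave_kernel t x n (p \<circ> \<sigma>) \<noteq> 0"
    then have "\<sigma> = \<pi>"
      using wave_kernel_nonzero(1)[of t x n "p \<circ> \<sigma>"] wave_kernel_nonzero(1)[OF \<pi>(2)]
      by (intro strict_increasing_arrangement_unique[OF that(1) \<pi>(1), of "\<lambda>i. fst (p i)"]) auto
    with that(2) show False by simp
  qed
  then have "(\<Sum>\<sigma> | \<sigma> permutes {..<n}. wave_kernel t x n (p \<circ> \<sigma>)) = (\<Sum>\<sigma>\<in>{\<pi>}. wave_kernel t x n (p \<circ> \<sigma>))"
    using \<pi> by (intro sum.mono_neutral_right) (auto simp: finite_permutations)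
  then show ?thesis
    using wave_kernel_bound[of t x n "p \<circ> \<pi>"] by (simp add: symmetrization_def divide_right_mono)
qed simp

lemma symmetrization_wave_kernel_nonzero:
  assumes "symmetrization n (wave_kernel t x n) p \<noteq> 0" "i < n"
  shows "p i \<in> light_box t x"
proof -
  obtain \<pi> where \<pi>: "\<pi> permutes {..<n}" "wave_kernel t x n (p \<circ> \<pi>) \<noteq> 0"
    using assms(1) by (rule symmetrization_nonzero)
  obtain j where "j < n" "i = \<pi> j" using permutes_image[OF \<pi>(1)] assms(2) by (metis imageE lessThan_iff)
  then show ?thesis using wave_kernel_nonzero(2)[OF \<pi>(2), of j] by simp
qed

section \<open>Bounds and measurability of the derivative kernels\<close>

abbreviation derivative_kernel :: "real \<Rightarrow> real \<Rightarrow> real \<times> real \<Rightarrow> nat \<Rightarrow> (nat \<Rightarrow> real \<times> real) \<Rightarrow> real"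
  where "derivative_kernel t x rz m \<equiv> (\<lambda>p. symmetrization (Suc m) (wave_kernel t x (Suc m)) (p(m := rz)))"

text \<open>The outer symmetrization over m pairs is the one built into
  \<open>is_wiener_integral\<close>. As an average it preserves the bound of the inner
  symmetrization over m + 1 pairs, and lying in the box does not depend on the order. The point
  \<open>rz\<close> at index m is one of these pairs, hence the zero outside the box.\<close>

lemma abs_symmetrization_derivative_kernel_le:
  "\<bar>symmetrization m (derivative_kernel t x rz m) p\<bar>
    \<le> (if rz \<in> light_box t x then (1 / 2) ^ Suc m / fact (Suc m) * (\<Prod>i<m. indicator (light_box t x) (p i)) else 0)"
proof (cases "symmetrization m (derivative_kernel t x rz m) p = 0")
  case True
  show ?thesis unfolding True by (auto intro!: prod_nonneg divide_nonneg_nonneg mult_nonneg_nonneg)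
next
  case False
  then obtain \<pi> where \<pi>: "\<pi> permutes {..<m}" "derivative_kernel t x rz m (p \<circ> \<pi>) \<noteq> 0"
    by (rule symmetrization_nonzero)
  note box = symmetrization_wave_kernel_nonzero[OF \<pi>(2)]
  have rz: "rz \<in> light_box t x" using box[of m] by simp
  have "p i \<in> light_box t x" if "i < m" for i
  proof -
    obtain j where j: "j < m" "i = \<pi> j" using permutes_image[OF \<pi>(1)] \<open>i < m\<close> by (metis imageE lessThan_iff)
    then show ?thesis using box[of j] by simp
  qed
  then have "(\<Prod>i<m. indicator (light_box t x) (p i) :: real) = 1" by (intro prod.neutral) auto
  moreover have "\<bar>symmetrization m (derivative_kernel t x rz m) p\<bar> \<le> (1 / 2) ^ Suc m / fact (Suc m)"
    by (rule abs_symmetrization_le) (rule abs_symmetrization_wave_kernel_le)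
  ultimately show ?thesis using rz by simp
qed

lemma permute_measurable [measurable]:
  assumes "\<pi> permutes {..<n}"
  shows "(\<lambda>p. p \<circ> \<pi>) \<in> pairs_measure n \<rightarrow>\<^sub>M pairs_measure n"
proof (rule measurable_PiM_single')
  show "(\<lambda>p. (p \<circ> \<pi>) i) \<in> pairs_measure n \<rightarrow>\<^sub>M lborel" if "i \<in> {..<n}" for i
    using permutes_in_image[OF assms, of i] that by (auto intro!: measurable_component_singleton)
  show "(\<lambda>p i. (p \<circ> \<pi>) i) \<in> space (pairs_measure n) \<rightarrow> {..<n} \<rightarrow>\<^sub>E space lborel"
    using assms by (auto simp: space_PiM PiE_def extensional_def permutes_def)
qed

lemma symmetrization_measurable:
  assumes [measurable]: "k \<in> borel_measurable (pairs_measure n)"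
  shows "symmetrization n k \<in> borel_measurable (pairs_measure n)"
proof -
  have "(\<lambda>p. k (p \<circ> \<pi>)) \<in> borel_measurable (pairs_measure n)" if "\<pi> permutes {..<n}" for \<pi>
    using permute_measurable[OF that] by measurable
  then show ?thesis unfolding symmetrization_def[abs_def] by (intro borel_measurable_divide borel_measurable_sum) auto
qed

lemma light_box_measurable [measurable]: "light_box T x \<in> sets borel"
  unfolding light_box_def by (intro borel_open open_Times) auto

lemma light_box_mono: "t \<le> T \<Longrightarrow> light_box t x \<subseteq> light_box T x"
  by (auto simp: light_box_def)

text \<open>On the box both coordinates have modulus at most R, where the standard density is at
  least its value at R. The constant grows with |x|, so it serves integrability; the bound uniform
  in x is \<open>box_bound\<close>.\<close>

lemma normal_dominated_light_box: "normal_dominated (indicator (light_box T x))"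
proof -
  define R where "R = \<bar>x\<bar> + \<bar>T\<bar>"
  have mono: "std_normal_density R \<le> std_normal_density y" if "\<bar>y\<bar> \<le> R" for y
  proof -
    have "y\<^sup>2 \<le> R\<^sup>2" using that abs_le_square_iff[of y R] by (simp add: R_def)
    then show ?thesis by (simp add: normal_density_def divide_right_mono)
  qed
  have pos: "0 < std_normal_density R" by (simp add: normal_density_pos)
  have "\<bar>indicator (light_box T x) p\<bar> \<le> 1 / (std_normal_density R)\<^sup>2 * normal_weight p" for p
  proof (cases "p \<in> light_box T x")
    case True
    then have "\<bar>fst p\<bar> \<le> R" "\<bar>snd p\<bar> \<le> R" by (auto simp: light_box_def R_def)
    then have "(std_normal_density R)\<^sup>2 \<le> normal_weight p"
      using pos unfolding power2_eq_square normal_weight_def by (intro mult_mono mono) auto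
    then show ?thesis using True pos by simp
  next
    case False
    then show ?thesis using normal_weight_nonneg[of p] by simp
  qed
  then show ?thesis unfolding normal_dominated_def by (auto intro!: exI[of _ "1 / (std_normal_density R)\<^sup>2"])
qed

section \<open>Norms of the derivative kernels, uniformly in the space variable\<close>

context noise_spectrum
begin

text \<open>The factor T * (2 * T) is the area of the box. For two points of the box the time
  difference lies in [-T, T] and the space difference in [-2 T, 2 T]; these intervals do not depend
  on x.\<close>

definition box_bound :: "real \<Rightarrow> ennreal"
  where "box_bound T = ennreal (T * (2 * T)) * ((\<integral>\<^sup>+v\<in>{-T..T}. \<gamma> v \<partial>lborel) * (\<integral>\<^sup>+v\<in>{-(2 * T)..2 * T}. f v \<partial>lborel))"

lemma box_bound_finite: "box_bound T < \<infinity>"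
  using G.cov F.cov unfolding box_bound_def covariance_function_def
  by (simp add: ennreal_mult_less_top)

lemma nn_integral_interval_shift_le:
  fixes k :: "real \<Rightarrow> ennreal"
  assumes [measurable]: "k \<in> borel_measurable borel" and "s \<in> {a<..<b}"
  shows "(\<integral>\<^sup>+t. ennreal (enn2real (k (t - s))) * indicator {a<..<b} t \<partial>lborel) \<le> (\<integral>\<^sup>+v\<in>{-(b - a)..b - a}. k v \<partial>lborel)"
proof -
  have "(\<integral>\<^sup>+t. ennreal (enn2real (k (t - s))) * indicator {a<..<b} t \<partial>lborel)
    = (\<integral>\<^sup>+v. ennreal (enn2real (k (s + 1 * v - s))) * indicator {a<..<b} (s + 1 * v) \<partial>lborel)"
    by (subst nn_integral_real_affine[where c = 1 and t = s]) auto
  also have "\<dots> \<le> (\<integral>\<^sup>+v. k v * indicator {-(b - a)..b - a} v \<partial>lborel)"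
  proof (rule nn_integral_mono)
    fix v
    show "ennreal (enn2real (k (s + 1 * v - s))) * indicator {a<..<b} (s + 1 * v) \<le> k v * indicator {-(b - a)..b - a} v"
      using assms(2) by (cases "k v") (auto simp: indicator_def)
  qed
  finally show ?thesis .
qed

lemma inner_H_light_box_le:
  assumes "T > 0"
  shows "ennreal (inner_H \<gamma> f (indicator (light_box T x)) (indicator (light_box T x))) \<le> box_bound T"
proof -
  let ?b = "indicator (light_box T x) :: real \<times> real \<Rightarrow> real"
  let ?e = "indicator (light_box T x) :: real \<times> real \<Rightarrow> ennreal"
  let ?c = "(\<integral>\<^sup>+v\<in>{-T..T}. \<gamma> v \<partial>lborel) * (\<integral>\<^sup>+v\<in>{-(2 * T)..2 * T}. f v \<partial>lborel)"
  have "ennreal (inner_H \<gamma> f ?b ?b) \<le> (\<integral>\<^sup>+z. ennreal (cov z * (?b (fst z) * ?b (snd z))) \<partial>(lborel \<Otimes>\<^sub>M lborel))"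
    unfolding inner_H_eq
    by (subst nn_integral_eq_integral)
       (use integrable_cov_pair[OF normal_dominated_light_box normal_dominated_light_box, of T x T x] in
         \<open>auto simp: cov_nonneg\<close>)
  also have "\<dots> = (\<integral>\<^sup>+q. \<integral>\<^sup>+p. ennreal (cov (p, q)) * (?e p * ?e q) \<partial>lborel \<partial>lborel)"
    by (subst lborel_pair.nn_integral_snd[symmetric])
       (auto intro!: nn_integral_cong simp: indicator_def)
  also have "\<dots> \<le> (\<integral>\<^sup>+q. ?c * ?e q \<partial>lborel)"
  proof (rule nn_integral_mono)
    fix q :: "real \<times> real"
    show "(\<integral>\<^sup>+p. ennreal (cov (p, q)) * (?e p * ?e q) \<partial>lborel) \<le> ?c * ?e q"
    proof (cases "q \<in> light_box T x")
      case True
      have "(\<integral>\<^sup>+p. ennreal (cov (p, q)) * (?e p * ?e q) \<partial>lborel)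
        = (\<integral>\<^sup>+t. \<integral>\<^sup>+y. (ennreal (G.g (t - fst q)) * indicator {0<..<T} t) * (ennreal (F.g (y - snd q)) * indicator {x - T<..<x + T} y) \<partial>lborel \<partial>lborel)"
        unfolding lborel_prod[symmetric] using True
        by (subst lborel.nn_integral_fst[symmetric])
           (auto intro!: nn_integral_cong simp: cov_def light_box_def indicator_times ennreal_mult ac_simps)
      also have "\<dots> = (\<integral>\<^sup>+t. ennreal (G.g (t - fst q)) * indicator {0<..<T} t \<partial>lborel) * (\<integral>\<^sup>+y. ennreal (F.g (y - snd q)) * indicator {x - T<..<x + T} y \<partial>lborel)"
        by (subst nn_integral_cmult) (auto intro!: nn_integral_multc)
      also have "\<dots> \<le> (\<integral>\<^sup>+v\<in>{-(T - 0)..T - 0}. \<gamma> v \<partial>lborel) * (\<integral>\<^sup>+v\<in>{-((x + T) - (x - T))..(x + T) - (x - T)}. f v \<partial>lborel)"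
        using True by (intro mult_mono nn_integral_interval_shift_le) (auto simp: light_box_def)
      also have "\<dots> = ?c * ?e q" using True by simp
      finally show ?thesis .
    qed simp
  qed
  also have "\<dots> = ?c * emeasure lborel (light_box T x)" by (subst nn_integral_cmult) auto
  also have "emeasure lborel (light_box T x) = ennreal (T * (2 * T))"
    unfolding light_box_def lborel_prod[symmetric] using assms
    by (subst lborel.emeasure_pair_measure_Times) (auto simp: ennreal_mult)
  finally show ?thesis by (simp add: box_bound_def mult.commute)
qed

lemma symmetrization_derivative_kernel_dominated:
  assumes "derivative_kernel t x rz m \<in> borel_measurable (pairs_measure m)"
  shows "gaussian_dominated m (symmetrization m (derivative_kernel t x rz m))"
proof -
  let ?B = "(1 / 2) ^ Suc m / fact (Suc m) :: real"
  obtain C where C: "\<And>p. p \<in> space (pairs_measure m) \<Longrightarrow> \<bar>\<Prod>i<m. indicator (light_box t x) (p i)\<bar> \<le> C * (\<Prod>i<m. normal_weight (p i))"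
    using gaussian_dominated_tensor[OF normal_dominated_light_box] unfolding gaussian_dominated_def by blast
  have "\<bar>symmetrization m (derivative_kernel t x rz m) p\<bar> \<le> (?B * C) * (\<Prod>i<m. normal_weight (p i))"
    if "p \<in> space (pairs_measure m)" for p
  proof -
    have "0 \<le> (\<Prod>i<m. indicator (light_box t x) (p i) :: real)" by (intro prod_nonneg) auto
    then have "\<bar>symmetrization m (derivative_kernel t x rz m) p\<bar> \<le> ?B * \<bar>\<Prod>i<m. indicator (light_box t x) (p i)\<bar>"
      using abs_symmetrization_derivative_kernel_le[of m t x rz p] by (auto split: if_splits)
    also have "\<dots> \<le> ?B * (C * (\<Prod>i<m. normal_weight (p i)))"
      by (intro mult_left_mono C that) simp
    finally show ?thesis by simp
  qed
  then show ?thesis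
    using symmetrization_measurable[OF assms] unfolding gaussian_dominated_def by blast
qed

text \<open>Since the covariance is non-negative, the kernel may be replaced by its majorant, a
  multiple of the m-fold tensor power of the indicator of the box, whose form is the m-th power of a
  single inner product.\<close>

lemma norm2_H_derivative_kernel_le:
  assumes meas: "derivative_kernel t x rz m \<in> borel_measurable (pairs_measure m)" and "0 < T" "t \<le> T"
  shows "norm2_H \<gamma> f m (symmetrization m (derivative_kernel t x rz m))
    \<le> indicator (light_box T x) rz * ((1 / 2) ^ Suc m / fact (Suc m))\<^sup>2 * enn2real (box_bound T) ^ m"
proof -
  let ?M = "pairs_measure m \<Otimes>\<^sub>M pairs_measure m"
  let ?s = "symmetrization m (derivative_kernel t x rz m)"
  let ?b = "indicator (light_box T x) :: real \<times> real \<Rightarrow> real"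
  define B where "B = ?b rz * ((1 / 2) ^ Suc m / fact (Suc m))"
  \<comment> \<open>An indicator equals its square, so the indicator of \<open>rz\<close> survives
    squaring unchanged.\<close>
  have B2: "B\<^sup>2 = ?b rz * ((1 / 2) ^ Suc m / fact (Suc m))\<^sup>2"
    unfolding B_def by (cases "rz \<in> light_box T x") simp_all
  have le: "\<bar>?s p\<bar> \<le> B * (\<Prod>i<m. ?b (p i))" for p
  proof -
    have "(\<Prod>i<m. indicator (light_box t x) (p i)) \<le> (\<Prod>i<m. ?b (p i))"
      using light_box_mono[OF \<open>t \<le> T\<close>, of x] by (intro prod_mono) (auto simp: indicator_def)
    then have 1: "(1 / 2) ^ Suc m / fact (Suc m) * (\<Prod>i<m. indicator (light_box t x) (p i)) \<le> (1 / 2) ^ Suc m / fact (Suc m) * (\<Prod>i<m. ?b (p i))"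
      by (intro mult_left_mono) auto
    show ?thesis
    proof (cases "rz \<in> light_box t x")
      case True
      then have "?b rz = 1" using light_box_mono[OF \<open>t \<le> T\<close>, of x] by auto
      then show ?thesis
        using abs_symmetrization_derivative_kernel_le[of m t x rz p] 1
        unfolding B_def by (simp only: True if_True mult_1)
    next
      case False
      have "0 \<le> B * (\<Prod>i<m. ?b (p i))"
        unfolding B_def by (intro mult_nonneg_nonneg divide_nonneg_nonneg prod_nonneg) auto
      then show ?thesis
        using abs_symmetrization_derivative_kernel_le[of m t x rz p] by (simp only: False if_False)
    qed
  qed
  note dom = symmetrization_derivative_kernel_dominated[OF meas]
  note tensor = cov_tensor_integral[OF normal_dominated_light_box normal_dominated_light_box, of m T x T x]
  have "norm2_H \<gamma> f m ?s \<le> (LINT z|?M. B\<^sup>2 * (case z of (p, q) \<Rightarrow> \<Prod>i<m. cov (p i, q i) * (?b (p i) * ?b (q i))))"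
    unfolding norm2_H_eq
  proof (rule integral_mono)
    show "integrable ?M (\<lambda>(p, q). (\<Prod>i<m. cov (p i, q i)) * (?s p * ?s q))"
      by (rule integrable_cov_dominated[OF dom dom])
    show "integrable ?M (\<lambda>z. B\<^sup>2 * (case z of (p, q) \<Rightarrow> \<Prod>i<m. cov (p i, q i) * (?b (p i) * ?b (q i))))"
      by (intro integrable_mult_right tensor)
    fix z :: "(nat \<Rightarrow> real \<times> real) \<times> (nat \<Rightarrow> real \<times> real)"
    obtain p q where z: "z = (p, q)" by (cases z)
    have "?s p * ?s q \<le> \<bar>?s p\<bar> * \<bar>?s q\<bar>" using abs_ge_self[of "?s p * ?s q"] by (simp only: abs_mult)
    also have "\<dots> \<le> (B * (\<Prod>i<m. ?b (p i))) * (B * (\<Prod>i<m. ?b (q i)))"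
      by (intro mult_mono le order_trans[OF abs_ge_zero le]) auto
    finally have "(\<Prod>i<m. cov (p i, q i)) * (?s p * ?s q) \<le> (\<Prod>i<m. cov (p i, q i)) * ((B * (\<Prod>i<m. ?b (p i))) * (B * (\<Prod>i<m. ?b (q i))))"
      by (intro mult_left_mono prod_nonneg) (auto simp: cov_nonneg)
    also have "\<dots> = B\<^sup>2 * (\<Prod>i<m. cov (p i, q i) * (?b (p i) * ?b (q i)))"
      unfolding prod.distrib power2_eq_square by (simp only: ac_simps)
    finally show "(case z of (p, q) \<Rightarrow> (\<Prod>i<m. cov (p i, q i)) * (?s p * ?s q)) \<le> B\<^sup>2 * (case z of (p, q) \<Rightarrow> \<Prod>i<m. cov (p i, q i) * (?b (p i) * ?b (q i)))"
      unfolding z prod.case .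
  qed
  also have "\<dots> = B\<^sup>2 * inner_H \<gamma> f ?b ?b ^ m"
    by (simp only: integral_mult_right_zero tensor(2))
  also have "\<dots> \<le> B\<^sup>2 * enn2real (box_bound T) ^ m"
  proof (intro mult_left_mono power_mono)
    have "0 \<le> inner_H \<gamma> f ?b ?b"
      unfolding inner_H_eq by (intro integral_nonneg_AE AE_I2) (auto simp: cov_nonneg)
    then show "0 \<le> inner_H \<gamma> f ?b ?b" .
    have "enn2real (ennreal (inner_H \<gamma> f ?b ?b)) \<le> enn2real (box_bound T)"
      by (rule enn2real_mono[OF inner_H_light_box_le[OF \<open>0 < T\<close>]]) (use box_bound_finite[of T] in simp)
    with \<open>0 \<le> inner_H \<gamma> f ?b ?b\<close> show "inner_H \<gamma> f ?b ?b \<le> enn2real (box_bound T)"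
      by (simp only: enn2real_ennreal)
  qed simp
  finally show ?thesis unfolding B2 .
qed

end

subsection \<open>The Malliavin derivative\<close>

text \<open>Cauchy-Schwarz with weights 2^(-m), whose sum is below 2. In the induction the first
  term is split off, and the shift of the index absorbs the additional factor 2.\<close>

lemma sum_square_le_geometric:
  fixes b :: "nat \<Rightarrow> real"
  shows "(\<Sum>m<N. b m)\<^sup>2 \<le> 2 * (\<Sum>m<N. 2 ^ m * (b m)\<^sup>2)"
proof (induction N arbitrary: b)
  case (Suc N)
  have sq: "(a + c)\<^sup>2 \<le> 2 * a\<^sup>2 + 2 * c\<^sup>2" for a c :: real
    using zero_le_power2[of "a - c"] by (simp add: power2_eq_square algebra_simps)
  have "(\<Sum>m<Suc N. b m)\<^sup>2 = (b 0 + (\<Sum>m<N. b (Suc m)))\<^sup>2" by (simp only: sum.lessThan_Suc_shift)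
  also have "\<dots> \<le> 2 * (b 0)\<^sup>2 + 2 * (\<Sum>m<N. b (Suc m))\<^sup>2" by (rule sq)
  also have "\<dots> \<le> 2 * (b 0)\<^sup>2 + 2 * (2 * (\<Sum>m<N. 2 ^ m * (b (Suc m))\<^sup>2))"
    using Suc[of "\<lambda>m. b (Suc m)"] by simp
  also have "\<dots> = 2 * (\<Sum>m<Suc N. 2 ^ m * (b m)\<^sup>2)"
    by (simp add: sum.lessThan_Suc_shift sum_distrib_left mult.assoc del: sum.lessThan_Suc)
  finally show ?case .
qed simp

text \<open>The weights 2^m turn r into 2 r. One factor 2 comes from
  \<open>sum_square_le_geometric\<close> and another from comparing the limit with the partial
  sums.\<close>

lemma L2_limit_second_moment_le:
  assumes L2: "L2_tendsto M (\<lambda>N \<omega>. \<Sum>m<N. a m * Y m \<omega>) Z"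
    and Y: "\<And>m. integrable M (\<lambda>\<omega>. (Y m \<omega>)\<^sup>2)"
    and le: "\<And>m. (a m)\<^sup>2 * (LINT \<omega>|M. (Y m \<omega>)\<^sup>2) \<le> c * (r ^ m / fact m)"
    and "0 \<le> c" "0 \<le> r"
  shows "(LINT \<omega>|M. (Z \<omega>)\<^sup>2) \<le> 4 * c * exp (2 * r)"
proof -
  define S where "S N \<omega> = (\<Sum>m<N. a m * Y m \<omega>)" for N \<omega>
  have [measurable]: "S N \<in> borel_measurable M" "Z \<in> borel_measurable M"
    and i: "integrable M (\<lambda>\<omega>. (S N \<omega>)\<^sup>2)" "integrable M (\<lambda>\<omega>. (Z \<omega>)\<^sup>2)" for N
    using L2 by (auto simp: L2_tendsto_def S_def[abs_def])
  have lim: "(\<lambda>N. LINT \<omega>|M. (S N \<omega> - Z \<omega>)\<^sup>2) \<longlonglongrightarrow> 0"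
    using L2 by (simp add: L2_tendsto_def S_def)
  have sq: "(a - b)\<^sup>2 \<le> 2 * a\<^sup>2 + 2 * b\<^sup>2" for a b :: real
    using zero_le_power2[of "a + b"] by (simp add: power2_eq_square algebra_simps)
  have SN: "(LINT \<omega>|M. (S N \<omega>)\<^sup>2) \<le> 2 * c * exp (2 * r)" for N
  proof -
    have iY: "integrable M (\<lambda>\<omega>. 2 ^ m * (a m * Y m \<omega>)\<^sup>2)" for m
      unfolding power_mult_distrib by (intro integrable_mult_right Y)
    have "(LINT \<omega>|M. (S N \<omega>)\<^sup>2) \<le> (LINT \<omega>|M. 2 * (\<Sum>m<N. 2 ^ m * (a m * Y m \<omega>)\<^sup>2))"
      using i(1) iY unfolding S_def
      by (intro integral_mono sum_square_le_geometric integrable_mult_right Bochner_Integration.integrable_sum) auto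
    also have "\<dots> = 2 * (\<Sum>m<N. 2 ^ m * ((a m)\<^sup>2 * (LINT \<omega>|M. (Y m \<omega>)\<^sup>2)))"
      using iY by (simp add: Bochner_Integration.integral_sum power_mult_distrib)
    also have "\<dots> \<le> 2 * (\<Sum>m<N. 2 ^ m * (c * (r ^ m / fact m)))"
      by (intro mult_left_mono sum_mono le) auto
    also have "\<dots> = 2 * c * (\<Sum>m<N. (2 * r) ^ m /\<^sub>R fact m)"
      by (simp add: sum_distrib_left power_mult_distrib divide_inverse ac_simps)
    also have "\<dots> \<le> 2 * c * exp (2 * r)"
      unfolding exp_def using summable_exp_generic[of "2 * r"] assms(4,5)
      by (intro mult_left_mono sum_le_suminf) auto
    finally show ?thesis .
  qed
  have "(LINT \<omega>|M. (Z \<omega>)\<^sup>2) \<le> 2 * (LINT \<omega>|M. (S N \<omega> - Z \<omega>)\<^sup>2) + 2 * (2 * c * exp (2 * r))" for N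
  proof -
    have d: "integrable M (\<lambda>\<omega>. (S N \<omega> - Z \<omega>)\<^sup>2)"
    proof (rule Bochner_Integration.integrable_bound)
      show "integrable M (\<lambda>\<omega>. 2 * (S N \<omega>)\<^sup>2 + 2 * (Z \<omega>)\<^sup>2)" using i by auto
      show "AE \<omega> in M. norm ((S N \<omega> - Z \<omega>)\<^sup>2) \<le> norm (2 * (S N \<omega>)\<^sup>2 + 2 * (Z \<omega>)\<^sup>2)"
        using sq by (intro AE_I2) simp
    qed measurable
    have "(LINT \<omega>|M. (Z \<omega>)\<^sup>2) \<le> (LINT \<omega>|M. 2 * (S N \<omega> - Z \<omega>)\<^sup>2 + 2 * (S N \<omega>)\<^sup>2)"
    proof (rule integral_mono)
      show "(Z \<omega>)\<^sup>2 \<le> 2 * (S N \<omega> - Z \<omega>)\<^sup>2 + 2 * (S N \<omega>)\<^sup>2" for \<omega>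
        using sq[of "S N \<omega> - Z \<omega>" "S N \<omega>"] by simp
    qed (use d i in auto)
    also have "\<dots> = 2 * (LINT \<omega>|M. (S N \<omega> - Z \<omega>)\<^sup>2) + 2 * (LINT \<omega>|M. (S N \<omega>)\<^sup>2)" using d i by simp
    finally show ?thesis using SN[of N] by simp
  qed
  moreover have "(\<lambda>N. 2 * (LINT \<omega>|M. (S N \<omega> - Z \<omega>)\<^sup>2) + 2 * (2 * c * exp (2 * r))) \<longlonglongrightarrow> 2 * 0 + 2 * (2 * c * exp (2 * r))"
    by (intro tendsto_intros lim)
  ultimately have "(LINT \<omega>|M. (Z \<omega>)\<^sup>2) \<le> 2 * 0 + 2 * (2 * c * exp (2 * r))"
    by (intro LIMSEQ_le_const) auto
  then show ?thesis by simp
qed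

theorem theorem3p11:
  fixes M :: "'w measure"
    and \<gamma> f :: "real \<Rightarrow> ennreal"
    and \<nu> \<mu> :: "real measure"
    and h g :: "real \<Rightarrow> real"
    and W :: "(real \<times> real \<Rightarrow> real) \<Rightarrow> 'w \<Rightarrow> real"
    and u :: "real \<Rightarrow> real \<Rightarrow> 'w \<Rightarrow> real"
    and D :: "real \<Rightarrow> real \<Rightarrow> real \<Rightarrow> real \<Rightarrow> 'w \<Rightarrow> real"
    and T :: real
  assumes "prob_space M"
    and "covariance_function \<gamma>" and "covariance_function f"
    and "tempered_measure \<nu>" and "is_fourier_of_measure \<gamma> \<nu>"
    and "tempered_measure \<mu>" and "is_fourier_of_measure f \<mu>"
    and "h \<in> borel_measurable borel" and "\<And>\<tau>. h \<tau> \<ge> 0"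
    and "g \<in> borel_measurable borel" and "\<And>\<xi>. g \<xi> \<ge> 0"
    and "\<nu> = density lborel (\<lambda>\<tau>. ennreal (h \<tau> / (2 * pi)))"
    and "\<mu> = density lborel (\<lambda>\<xi>. ennreal (g \<xi> / (2 * pi)))"
    and "\<exists>k::nat. k \<ge> 1 \<and>
      (\<integral>\<^sup>+(\<tau>, \<xi>)\<in>{(\<tau>, \<xi>). h \<tau> * g \<xi> > 0}.
          ennreal (1 / ((1 + \<tau>\<^sup>2 + \<bar>\<xi>\<bar>\<^sup>2) ^ k * (h \<tau> * g \<xi>))) \<partial>(lborel \<Otimes>\<^sub>M lborel)) < \<infinity>"
    and "gaussian_noise \<gamma> f M W"
    and "wave_solution \<gamma> f M W u"
    and "wave_malliavin_derivative \<gamma> f M W u D"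
    and "T > 0"
  shows "\<exists>C>0. (SUP (t, x)\<in>{0..T} \<times> UNIV. SUP r\<in>{0..t}.
      (\<integral>\<^sup>+\<omega>. (\<integral>\<^sup>+z. ennreal (\<bar>D t x r z \<omega>\<bar>\<^sup>2) \<partial>lborel) \<partial>M)) \<le> ennreal C"
proof -
  interpret prob_space M by fact
  interpret noise_spectrum \<gamma> \<nu> f \<mu>
    by unfold_locales fact+
  define A where "A = enn2real (box_bound T)"
  \<comment> \<open>The bound of \<open>L2_limit_second_moment_le\<close> for c = 1 and r = A /
    4.\<close>
  define K where "K = 4 * exp (2 * (A / 4))"
  have A: "0 \<le> A" by (simp add: A_def)
  have K: "0 < K" by (simp add: K_def)
  \<comment> \<open>Integrability is carried along because a divergent Bochner integral is 0 by
    convention; only with it does the estimate transfer to the non-negative integral.\<close>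
  have second: "D t x r z \<in> borel_measurable M \<and> integrable M (\<lambda>\<omega>. (D t x r z \<omega>)\<^sup>2)
      \<and> (LINT \<omega>|M. (D t x r z \<omega>)\<^sup>2) \<le> K * indicator {x - T<..<x + T} z"
    if t: "0 \<le> t" "t \<le> T" and r: "r \<in> {0..t}" for t x r z
  proof -
    have "is_malliavin_derivative \<gamma> f M W (wave_kernel t x) (u t x) (r, z) (D t x r z)"
      using assms(17) t r unfolding wave_malliavin_derivative_def by blast
    then obtain Y where Y: "\<And>m. is_wiener_integral \<gamma> f M W m (derivative_kernel t x (r, z) m) (Y m)"
      and L2: "L2_tendsto M (\<lambda>N \<omega>. \<Sum>m<N. real (Suc m) * Y m \<omega>) (D t x r z)"
      unfolding is_malliavin_derivative_def by blast
    have iY: "integrable M (\<lambda>\<omega>. (Y m \<omega>)\<^sup>2)" for m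
      using Y[of m] unfolding is_wiener_integral_def L2_tendsto_def by blast
    let ?i = "indicator (light_box T x) (r, z) :: real"
    have le: "(real (Suc m))\<^sup>2 * (LINT \<omega>|M. (Y m \<omega>)\<^sup>2) \<le> ?i * ((A / 4) ^ m / fact m)" for m
    proof -
      have meas: "derivative_kernel t x (r, z) m \<in> borel_measurable (pairs_measure m)"
        using Y[of m] unfolding is_wiener_integral_def abs_integrable_H_def by blast
      have "(LINT \<omega>|M. (Y m \<omega>)\<^sup>2) \<le> 4 * fact m * norm2_H \<gamma> f m (symmetrization m (derivative_kernel t x (r, z) m))"
        by (rule wiener_integral_second_moment_le[OF assms(1) assms(15) Y symmetrization_derivative_kernel_dominated[OF meas]])
      also have "\<dots> \<le> 4 * fact m * (?i * ((1 / 2) ^ Suc m / fact (Suc m))\<^sup>2 * A ^ m)"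
        unfolding A_def by (intro mult_left_mono norm2_H_derivative_kernel_le meas assms(18) t) simp
      finally have "(real (Suc m))\<^sup>2 * (LINT \<omega>|M. (Y m \<omega>)\<^sup>2) \<le> (real (Suc m))\<^sup>2 * (4 * fact m * (?i * ((1 / 2) ^ Suc m / fact (Suc m))\<^sup>2 * A ^ m))"
        by (rule mult_left_mono) simp
      \<comment> \<open>The factor (m + 1)^2 reduces ((m + 1)!)^2 to (m!)^2, of which m! cancels one
        factor. The loss of 4 in the isometry meets the extra 1 / 4 in the square of (1 / 2)^(m +
        1), so that the constant is exactly 1.\<close>
      also have "\<dots> = ?i * ((A / 4) ^ m / fact m)"
      proof -
        have f: "fact (Suc m) = real (Suc m) * (fact m :: real)" by (rule fact_Suc)
        have p: "((1 / 2) ^ Suc m)\<^sup>2 = (1 / 4 :: real) * (1 / 4) ^ m"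
          unfolding power_Suc power_mult_distrib power_mult[symmetric] mult.commute[of m 2] unfolding power_mult
          by (simp add: power2_eq_square)
        have "(c\<^sup>2 * (4 * q * (i * (h / (c * q))\<^sup>2 * a))) = i * (4 * h\<^sup>2 * a / q)" if "c > 0" "q > 0" for c q i h a :: real
          using that by (simp add: power2_eq_square field_simps)
        from this[of "real (Suc m)" "fact m" ?i "(1 / 2) ^ Suc m" "A ^ m"]
        show ?thesis unfolding f p by (simp add: power_divide power_mult_distrib field_simps)
      qed
      finally show ?thesis .
    qed
    have "(LINT \<omega>|M. (D t x r z \<omega>)\<^sup>2) \<le> 4 * ?i * exp (2 * (A / 4))"
      by (rule L2_limit_second_moment_le[OF L2 iY le]) (use A in auto)
    also have "\<dots> \<le> K * indicator {x - T<..<x + T} z"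
      by (auto simp: K_def light_box_def indicator_def)
    finally show ?thesis using L2 by (auto simp: L2_tendsto_def)
  qed
  have main: "(\<integral>\<^sup>+\<omega>. (\<integral>\<^sup>+z. ennreal (\<bar>D t x r z \<omega>\<bar>\<^sup>2) \<partial>lborel) \<partial>M) \<le> ennreal (K * (2 * T))"
    if t: "0 \<le> t" "t \<le> T" and r: "r \<in> {0..t}" for t x r
  proof -
    interpret P: pair_sigma_finite M "lborel :: real measure" by standard
    have "(\<lambda>(\<omega>, r, z). D t x r z \<omega>) \<in> borel_measurable (M \<Otimes>\<^sub>M (restrict_space borel {0..t} \<Otimes>\<^sub>M borel))"
      using assms(17) t unfolding wave_malliavin_derivative_def by blast
    \<comment> \<open>The section at r is taken inside the restricted space, so measurability of
      this map uses that r lies in [0, t].\<close>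
    moreover have "(\<lambda>(\<omega>, z). (\<omega>, r, z)) \<in> M \<Otimes>\<^sub>M borel \<rightarrow>\<^sub>M M \<Otimes>\<^sub>M (restrict_space borel {0..t} \<Otimes>\<^sub>M borel)"
      using r by (auto intro!: measurable_Pair simp: case_prod_unfold space_restrict_space)
    ultimately have "(\<lambda>x'. (\<lambda>(\<omega>, r, z). D t x r z \<omega>) ((\<lambda>(\<omega>, z). (\<omega>, r, z)) x')) \<in> borel_measurable (M \<Otimes>\<^sub>M borel)"
      by (rule measurable_compose[rotated])
    then have [measurable]: "(\<lambda>(\<omega>, z). D t x r z \<omega>) \<in> borel_measurable (M \<Otimes>\<^sub>M borel)"
      by (simp add: case_prod_unfold)
    have "(\<integral>\<^sup>+\<omega>. (\<integral>\<^sup>+z. ennreal (\<bar>D t x r z \<omega>\<bar>\<^sup>2) \<partial>lborel) \<partial>M) = (\<integral>\<^sup>+z. (\<integral>\<^sup>+\<omega>. ennreal (\<bar>D t x r z \<omega>\<bar>\<^sup>2) \<partial>M) \<partial>lborel)"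
      by (rule P.Fubini'[symmetric]) measurable
    \<comment> \<open>The second moment vanishes outside an interval of length 2 T, so integrating
      over the whole line costs only that factor.\<close>
    also have "\<dots> \<le> (\<integral>\<^sup>+z. ennreal K * indicator {x - T<..<x + T} z \<partial>lborel)"
    proof (rule nn_integral_mono)
      fix z
      have "(\<integral>\<^sup>+\<omega>. ennreal (\<bar>D t x r z \<omega>\<bar>\<^sup>2) \<partial>M) = ennreal (LINT \<omega>|M. (D t x r z \<omega>)\<^sup>2)"
        using second[OF t r, of x z] by (subst nn_integral_eq_integral[symmetric]) auto
      also have "\<dots> \<le> ennreal (K * indicator {x - T<..<x + T} z)"
        using second[OF t r, of x z] by (intro ennreal_leI) blast
      also have "\<dots> = ennreal K * indicator {x - T<..<x + T} z" by (simp add: indicator_def)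
      finally show "(\<integral>\<^sup>+\<omega>. ennreal (\<bar>D t x r z \<omega>\<bar>\<^sup>2) \<partial>M) \<le> ennreal K * indicator {x - T<..<x + T} z" .
    qed
    also have "\<dots> = ennreal (K * (2 * T))"
      using K assms(18) by (subst nn_integral_cmult) (auto simp: ennreal_mult)
    finally show ?thesis .
  qed
  show ?thesis
  proof (intro exI[of _ "K * (2 * T)"] conjI)
    show "0 < K * (2 * T)" using K assms(18) by simp
    show "(SUP (t, x)\<in>{0..T} \<times> UNIV. SUP r\<in>{0..t}.
      (\<integral>\<^sup>+\<omega>. (\<integral>\<^sup>+z. ennreal (\<bar>D t x r z \<omega>\<bar>\<^sup>2) \<partial>lborel) \<partial>M)) \<le> ennreal (K * (2 * T))"
      by (rule SUP_least) (auto intro!: SUP_least main[unfolded power2_abs])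
  qed
qed

end
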